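(* Let $\{\xi_k\}_{k\in\mathbb{Z}}$ be a stationary, centered, complex Gaussian process with unit variance and let $f(z)=\sum_{k=0}^\infty \xi_k z^k$. Let $f_{\mathrm{PV}}(z)=\sum_{k=0}^\infty\zeta_k z^k$, where $\{\zeta_k\}_{k\ge0}$ are i.i.d. standard complex Gaussian random variables. Let $D\subset\mathbb{D}$ be a domain with smooth boundaries, and let $N_f(D)$ and $N_{f_{\mathrm{PV}}}(D)$ denote the numbers of zeros inside $D$ of $f$ and $f_{\mathrm{PV}}$, respectively. Then $\mathbb{E}N_f(D)$ is always less than or equal to $\mathbb{E}N_{f_{\mathrm{PV}}}(D)$: $$\mathbb{E}N_f(D)\le \mathbb{E}N_{f_{\mathrm{PV}}}(D).$$ Moreover, the equality holds for some (hence any) domain $D$ if and only if $f$ is equal to $f_{\mathrm{PV}}$ in law.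
   Context: $\mathbb{D}=\{z\in\mathbb{C}:|z|<1\}$. The covariance function of the process is $\mathbb{E}[\xi_k\overline{\xi_l}]=\gamma(l-k)$ for $k,l\in\mathbb{Z}$, with $\gamma(0)=1$ and $\gamma(-k)=\overline{\gamma(k)}$. Complex Gaussian processes are circularly symmetric, so that their law is determined by this covariance. The covariance kernel of $f$ is $K_f(z,w)=\mathbb{E}[f(z)\overline{f(w)}]=\frac{1}{1-z\overline{w}}\left(1+G(z)+\overline{G(w)}\right)$ with $G(z)=\sum_{k=1}^\infty\overline{\gamma(k)}z^k$, which is analytic in $\mathbb{D}$.
   Formalization: The equality statement is restricted to domains D whose closure lies in the open unit disc; for D touching the unit circle both expectations can be infinite, hence equal, although the laws differ. *)

theory Defs
  imports "HOL-Probability.Probability" "HOL-Complex_Analysis.Complex_Analysis"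
begin

section \<open>Complex Gaussian processes\<close>

text \<open>Constants count as (degenerate) Gaussian variables. This is needed for processes whose
  finite-dimensional covariance matrices are singular, such as \<open>X k = cis (k * \<alpha>) * X 0\<close>.\<close>

definition gaussian_rv :: "'a measure \<Rightarrow> ('a \<Rightarrow> real) \<Rightarrow> bool" where
  "gaussian_rv M Y \<longleftrightarrow> Y \<in> borel_measurable M \<and>
     ((\<exists>\<mu>. AE \<omega> in M. Y \<omega> = \<mu>) \<or>
      (\<exists>\<mu> \<sigma>. 0 < \<sigma> \<and> distributed M lborel Y (\<lambda>x. ennreal (normal_density \<mu> \<sigma> x))))"

definition process_law :: "'a measure \<Rightarrow> ('i \<Rightarrow> 'a \<Rightarrow> complex) \<Rightarrow> ('i \<Rightarrow> complex) measure" where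
  "process_law M X = distr M (Pi\<^sub>M UNIV (\<lambda>_. borel)) (\<lambda>\<omega> k. X k \<omega>)"

text \<open>The real and imaginary parts are jointly Gaussian, and the law of the process is invariant
  under multiplication by constants of modulus one (circular symmetry).\<close>

definition complex_gaussian_process :: "'a measure \<Rightarrow> ('i \<Rightarrow> 'a \<Rightarrow> complex) \<Rightarrow> bool" where
  "complex_gaussian_process M X \<longleftrightarrow>
     (\<forall>k. X k \<in> borel_measurable M) \<and>
     (\<forall>J a b. finite J \<longrightarrow>
        gaussian_rv M (\<lambda>\<omega>. \<Sum>k\<in>J. a k * Re (X k \<omega>) + b k * Im (X k \<omega>))) \<and>
     (\<forall>\<theta>. process_law M (\<lambda>k \<omega>. cis \<theta> * X k \<omega>) = process_law M X)"

definition centered_process :: "'a measure \<Rightarrow> ('i \<Rightarrow> 'a \<Rightarrow> complex) \<Rightarrow> bool" where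
  "centered_process M X \<longleftrightarrow> (\<forall>k. (\<integral>\<omega>. X k \<omega> \<partial>M) = 0)"

text \<open>For a centered process this is the variance.\<close>

definition unit_variance_process :: "'a measure \<Rightarrow> ('i \<Rightarrow> 'a \<Rightarrow> complex) \<Rightarrow> bool" where
  "unit_variance_process M X \<longleftrightarrow> (\<forall>k. (\<integral>\<omega>. (cmod (X k \<omega>))\<^sup>2 \<partial>M) = 1)"

text \<open>Invariance of the law under shifts. For centered circularly symmetric Gaussian processes this
  is equivalent to the covariance of \<open>X k\<close> and \<open>X l\<close> depending only on \<open>l - k\<close>.\<close>

definition stationary_process :: "'a measure \<Rightarrow> (int \<Rightarrow> 'a \<Rightarrow> complex) \<Rightarrow> bool" where
  "stationary_process M X \<longleftrightarrow> (\<forall>n. process_law M (\<lambda>k. X (k + n)) = process_law M X)"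

definition iid_std_complex_gaussian :: "'a measure \<Rightarrow> (nat \<Rightarrow> 'a \<Rightarrow> complex) \<Rightarrow> bool" where
  "iid_std_complex_gaussian M X \<longleftrightarrow>
     prob_space.indep_vars M (\<lambda>_. borel) X UNIV \<and>
     (\<forall>k. distributed M lborel (X k) (\<lambda>z. ennreal (exp (- (cmod z)\<^sup>2) / pi)))"

section \<open>Random power series and their zeros\<close>

text \<open>The series below converge almost surely, simultaneously for all \<open>z\<close> in the unit disc.\<close>

definition random_series :: "(nat \<Rightarrow> 'a \<Rightarrow> complex) \<Rightarrow> 'a \<Rightarrow> complex \<Rightarrow> complex" where
  "random_series X \<omega> z = (\<Sum>k. X k \<omega> * z ^ k)"

text \<open>The Borel \<open>\<sigma>\<close>-algebra of the space of analytic functions on the disc (with locally uniform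
  convergence) is generated by the point evaluations, so the law of a random analytic function is
  its image measure on the product space.\<close>

definition law_on_disc :: "'a measure \<Rightarrow> ('a \<Rightarrow> complex \<Rightarrow> complex) \<Rightarrow> (complex \<Rightarrow> complex) measure" where
  "law_on_disc M F = distr M (Pi\<^sub>M (ball 0 1) (\<lambda>_. borel)) (\<lambda>\<omega>. \<lambda>z\<in>ball 0 1. F \<omega> z)"

text \<open>Zeros are counted with multiplicity. The value is only meaningful for functions that are
  analytic and not identically zero, which is almost surely the case for the random series considered
  here, as their constant coefficients are almost surely nonzero.\<close>

definition num_zeros :: "(complex \<Rightarrow> complex) \<Rightarrow> complex set \<Rightarrow> ennreal" where
  "num_zeros F D = (\<Sum>\<^sub>\<infinity>z\<in>{z\<in>D. F z = 0}. of_nat (nat (zorder F z)))"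

definition expected_zeros :: "'a measure \<Rightarrow> ('a \<Rightarrow> complex \<Rightarrow> complex) \<Rightarrow> complex set \<Rightarrow> ennreal" where
  "expected_zeros M F D = (\<integral>\<^sup>+\<omega>. num_zeros (F \<omega>) D \<partial>M)"

section \<open>Domains with smooth boundary\<close>

definition smooth_on_interval :: "(real \<Rightarrow> real) \<Rightarrow> real \<Rightarrow> bool" where
  "smooth_on_interval h a \<longleftrightarrow>
     (\<forall>n. \<forall>x\<in>{-a<..<a}. (deriv ^^ n) h field_differentiable (at x))"

text \<open>Near each boundary point, in suitably rotated coordinates centred at that point, the set
  is the part of a rectangle lying strictly above the graph of a \<open>C\<^sup>\<infinity>\<close> function.\<close>

definition smooth_boundary :: "complex set \<Rightarrow> bool" where
  "smooth_boundary D \<longleftrightarrow>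
     (\<forall>p\<in>frontier D. \<exists>\<theta> a b h. 0 < a \<and> 0 < b \<and> smooth_on_interval h a \<and>
        (\<forall>x y. \<bar>x\<bar> < a \<and> \<bar>y\<bar> < b \<longrightarrow> (p + cis \<theta> * Complex x y \<in> D \<longleftrightarrow> h x < y)))"

definition smooth_domain :: "complex set \<Rightarrow> bool" where
  "smooth_domain D \<longleftrightarrow> open D \<and> connected D \<and> D \<noteq> {} \<and> smooth_boundary D"

end

theory Submission
  imports Defs
begin

text \<open>
  Averaging Jensen's formula over \<open>\<omega>\<close> expresses the expected sum of \<open>log\<^sup>+ (r / \<bar>p - a\<bar>)\<close> over the zeros \<open>p\<close>
  of a Gaussian series through its variance \<open>V\<close>: it is half the mean of \<open>ln V\<close> over the circle of radius \<open>r\<close>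
  about \<open>a\<close> minus half its value at \<open>a\<close>, because \<open>ln \<bar>f z\<bar>\<close> has expectation \<open>ln (V z) / 2 + const\<close>. The
  variance of \<open>f\<close> is \<open>h z / (1 - \<bar>z\<bar>\<^sup>2)\<close> with the positive harmonic function \<open>h = 1 + 2 Re G\<close>, and that of
  \<open>f\<^sub>P\<^sub>V\<close> is \<open>1 / (1 - \<bar>z\<bar>\<^sup>2)\<close>. As \<open>ln h\<close> is superharmonic by concavity of the logarithm, the expected sums
  for \<open>f\<close> are at most those for \<open>f\<^sub>P\<^sub>V\<close>, with equality only if \<open>h\<close> is constant on the circle. The kernels
  \<open>log\<^sup>+ (r / \<bar>p - a\<bar>)\<close>, normalized, form an approximate identity as \<open>r \<rightarrow> 0\<close>, which carries the comparison
  over to test functions and then to indicators of open sets. Equality on one domain forces \<open>h\<close> to be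
  locally constant there, so \<open>G = 0\<close>; the coefficients are then uncorrelated, hence independent.
\<close>

section \<open>Circle means and Jensen's formula\<close>

text \<open>The density of expected zeros is a multiple of the Laplacian of \<open>ln V\<close>. The
  proof never differentiates: the Laplacian is replaced by a circle mean minus the value at the
  centre, called \<open>log_mod_excess\<close> on a path and \<open>log_excess\<close> for the
  variance. Hence only one-point laws of the series enter, encoded by characteristic functions. One
  obstacle is measurability: a sum over the zeros of a random function is not visibly measurable in
  \<omega>. Its mollifications are area integrals of a jointly measurable function, and their limits
  supply measurable representatives, on which additivity and monotone convergence rest. Another is
  cancellation: the equality case subtracts expected counts, which in \<open>ennreal\<close> asks
  for finite ones. For this the closure of the domain must lie in the open disc; for other
  subdomains both counts may be infinite. The variance is found without a double sum of covariances:
  stationarity gives a linear recursion in the number of terms, whose fixed point is the covariance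
  kernel on the diagonal.\<close>

definition circ :: "real measure" where
  "circ = density lborel (\<lambda>\<theta>. ennreal (indicator {0..2*pi} \<theta> / (2*pi)))"

lemma sets_circ [simp, measurable_cong]: "sets circ = sets borel"
  by (simp add: circ_def)

lemma space_circ [simp]: "space circ = UNIV"
  by (simp add: circ_def)

lemma prob_space_circ: "prob_space circ"
proof
  have "emeasure circ (space circ) = (\<integral>\<^sup>+ \<theta>. ennreal (1/(2*pi)) * indicator {0..2*pi} \<theta> \<partial>lborel)"
    unfolding circ_def by (subst emeasure_density) (auto intro!: nn_integral_cong simp: indicator_def)
  also have "\<dots> = 1"
    by (simp add: nn_integral_cmult_indicator ennreal_mult[symmetric])
  finally show "emeasure circ (space circ) = 1" .
qed

interpretation circ: prob_space circ by (rule prob_space_circ)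

lemma measure_circ_UNIV [simp]: "measure circ UNIV = 1"
  using circ.prob_space by simp

text \<open>Cauchy's integral formula: on the path \<open>u = a + r * cis t\<close> the form
  \<open>du / (u - a)\<close> equals \<open>\<i> dt\<close>, so the contour integral is a plain mean
  over the angle.\<close>

lemma circ_mean_value:
  fixes g :: "complex \<Rightarrow> complex"
  assumes "continuous_on (cball a r) g" "g holomorphic_on ball a r" "0 < r"
  shows "integrable circ (\<lambda>\<theta>. g (a + r * cis \<theta>))" "(\<integral>\<theta>. g (a + r * cis \<theta>) \<partial>circ) = g a"
proof -
  let ?u = "\<lambda>\<theta>. g (a + r * cis \<theta>)"
  have cont: "continuous_on A ?u" for A
    by (rule continuous_on_compose2[OF assms(1)]) (use \<open>0 < r\<close> in \<open>auto intro!: continuous_intros simp: dist_norm norm_mult\<close>)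
  have meas[measurable]: "?u \<in> borel_measurable borel"
    by (rule borel_measurable_continuous_onI[OF cont])
  have "((\<lambda>u. g u/(u-a)) has_contour_integral (2 * of_real pi * \<i> * g a)) (circlepath a r)"
    using assms by (intro Cauchy_integral_circlepath) auto
  then have "((\<lambda>t. g (a + r * cis t) / (a + r * cis t - a) * r * \<i> * cis t) has_integral (2 * of_real pi * \<i> * g a)) {0..2*pi}"
    unfolding circlepath_def by (subst (asm) has_contour_integral_part_circlepath_iff) auto
  then have "((\<lambda>t. \<i> * ?u t) has_integral (2 * of_real pi * \<i> * g a)) {0..2*pi}"
    by (rule has_integral_eq_rhs[OF has_integral_eq, rotated]) (use \<open>0 < r\<close> in \<open>auto simp: field_simps\<close>)
  from has_integral_mult_right[OF this, of "-\<i>/(2*pi)"]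
  have I: "((\<lambda>t. ?u t /(2*pi)) has_integral g a) {0..2*pi}"
    by (simp add: field_simps)
  have S: "set_integrable lborel {0..2*pi} (\<lambda>t. ?u t /(2*pi))"
    unfolding set_integrable_def by (rule borel_integrable_compact) (auto intro!: continuous_intros cont)
  have eq: "(indicat_real {0..2*pi} \<theta> / (2*pi)) *\<^sub>R ?u \<theta> = indicat_real {0..2*pi} \<theta> *\<^sub>R (?u \<theta> /(2*pi))" for \<theta>
    by (simp add: scaleR_conv_of_real)
  show "integrable circ ?u"
    unfolding circ_def using S by (subst integrable_density) (auto simp: set_integrable_def eq simp del: of_real_mult)
  have "(\<integral>\<theta>. ?u \<theta> \<partial>circ) = (LINT t:{0..2*pi}|lborel. ?u t /(2*pi))"
    unfolding circ_def set_lebesgue_integral_def by (subst integral_density) (auto simp: eq simp del: of_real_mult)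
  also have "\<dots> = g a"
    using set_borel_integral_eq_integral(2)[OF S] integral_unique[OF I] by metis
  finally show "(\<integral>\<theta>. ?u \<theta> \<partial>circ) = g a" .
qed

text \<open>A zero-free holomorphic function on a disc has a holomorphic logarithm \<open>L\<close>,
  and \<open>ln (cmod (g z))\<close> is the harmonic function \<open>Re (L z)\<close>.\<close>

lemma circ_mean_ln_nonzero:
  fixes r :: real
  assumes g: "g holomorphic_on ball a R" and r: "0 < r" "r < R" and nz: "\<And>z. z \<in> ball a R \<Longrightarrow> g z \<noteq> 0"
  shows "integrable circ (\<lambda>\<theta>. ln (cmod (g (a + r * cis \<theta>))))"
    "(\<integral>\<theta>. ln (cmod (g (a + r * cis \<theta>))) \<partial>circ) = ln (cmod (g a))"
proof -
  obtain L where L: "L holomorphic_on ball a R" "\<And>z. z \<in> ball a R \<Longrightarrow> g z = exp (L z)"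
    using contractible_imp_holomorphic_log[OF g _ nz] by (metis convex_ball convex_imp_contractible)
  have *: "ln (cmod (g z)) = Re (L z)" if "z \<in> ball a R" for z
    using L(2)[OF that] by simp
  have i: "a + r * cis \<theta> \<in> ball a R" for \<theta> using r by (simp add: dist_norm norm_mult)
  have sub: "cball a r \<subseteq> ball a R" using r by auto
  have 1: "integrable circ (\<lambda>\<theta>. L (a + r * cis \<theta>))" "(\<integral>\<theta>. L (a + r * cis \<theta>) \<partial>circ) = L a"
    using circ_mean_value[of a r L] holomorphic_on_subset[OF L(1), of "ball a r"]
      holomorphic_on_imp_continuous_on[OF holomorphic_on_subset[OF L(1) sub]] r
    by (auto simp: subset_ball)
  show "integrable circ (\<lambda>\<theta>. ln (cmod (g (a + r * cis \<theta>))))"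
    unfolding *[OF i] using 1(1) by simp
  show "(\<integral>\<theta>. ln (cmod (g (a + r * cis \<theta>))) \<partial>circ) = ln (cmod (g a))"
    unfolding *[OF i] using 1 r by (simp add: * del: Re_complex_of_real) 
qed


section \<open>Circle means of the logarithm of a distance\<close>

definition log_kernel :: "real \<Rightarrow> complex \<Rightarrow> real" where
  "log_kernel r x = max 0 (ln (r / cmod x))"

lemma log_kernel_nonneg [simp]: "0 \<le> log_kernel r x"
  by (simp add: log_kernel_def)

lemma log_kernel_eq_0: "0 < r \<Longrightarrow> r \<le> cmod x \<Longrightarrow> log_kernel r x = 0"
proof -
  assume "0 < r" "r \<le> cmod x"
  then have "0 < r / cmod x" "r / cmod x \<le> 1" by (auto simp: divide_simps)
  then show ?thesis by (simp add: log_kernel_def)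
qed

lemma log_kernel_eq: "0 < r \<Longrightarrow> cmod x \<le> r \<Longrightarrow> x \<noteq> 0 \<Longrightarrow> log_kernel r x = ln r - ln (cmod x)"
  by (simp add: log_kernel_def ln_div max_def)

text \<open>The zero inside the circle is reflected to the outside: multiplying by
  \<open>cis (-\<theta>)\<close> and conjugating turns \<open>u + r * cis \<theta>\<close> into
  \<open>r + cnj u * cis \<theta>\<close> without changing the modulus, and the latter is zero-free
  on a disc larger than the unit disc.\<close>

lemma circ_mean_ln_inside:
  assumes "cmod u < r"
  shows "integrable circ (\<lambda>\<theta>. ln (cmod (u + r * cis \<theta>)))"
    "(\<integral>\<theta>. ln (cmod (u + r * cis \<theta>)) \<partial>circ) = ln r"
proof -
  \<comment> \<open>The modulus of the reflected zero; for \<open>u = 0\<close> there is none, and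
    any number above 1 will do.\<close>
  define R where "R = (if u = 0 then 2 else r / cmod u)"
  have r: "0 < r" using assms norm_ge_zero[of u] by linarith
  have R: "1 < R" using assms by (auto simp: R_def)
  let ?g = "\<lambda>z. of_real r + cnj u * z"
  have nz: "?g z \<noteq> 0" if "z \<in> ball 0 R" for z
  proof
    assume "?g z = 0"
    then have "cmod (cnj u * z) = r" using r by (metis add_eq_0_iff norm_minus_cancel norm_of_real abs_of_pos)
    then have "cmod u * cmod z = r" by (simp add: norm_mult)
    moreover have "cmod u * cmod z < r" using that r by (auto simp: R_def field_simps split: if_splits)
    ultimately show False by simp
  qed
  have eq: "cmod (u + r * cis \<theta>) = cmod (?g (0 + of_real 1 * cis \<theta>))" for \<theta>
  proof -
    have "cmod (u + r * cis \<theta>) = cmod (cis (-\<theta>) * (u + r * cis \<theta>))" by (simp add: norm_mult)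
    also have "cis (-\<theta>) * (u + r * cis \<theta>) = cnj (?g (0 + of_real 1 * cis \<theta>))"
      by (simp add: algebra_simps cis_cnj cis_mult)
    finally show ?thesis by (simp only: complex_mod_cnj)
  qed
  have h: "?g holomorphic_on ball 0 R" by (intro holomorphic_intros)
  show "integrable circ (\<lambda>\<theta>. ln (cmod (u + r * cis \<theta>)))"
    unfolding eq by (rule circ_mean_ln_nonzero(1)[OF h _ R nz]) auto
  show "(\<integral>\<theta>. ln (cmod (u + r * cis \<theta>)) \<partial>circ) = ln r"
    unfolding eq using r by (subst circ_mean_ln_nonzero(2)[OF h _ R nz]) auto
qed

text \<open>The exceptional angles lie in one residue class modulo \<open>2 * pi\<close>, a
  countable set.\<close>

lemma AE_circ_nonzero:
  assumes "0 < r"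
  shows "AE \<theta> in circ. u + of_real r * cis \<theta> \<noteq> 0"
proof -
  have "{\<theta>. u + of_real r * cis \<theta> = 0} \<subseteq> range (\<lambda>k::int. Arg (- u / r) + 2 * pi * k)"
  proof safe
    fix \<theta> assume "u + of_real r * cis \<theta> = 0"
    then have c: "- u / r = cis \<theta>" using assms by (auto simp: field_simps add_eq_0_iff)
    then have "cis (Arg (-u/r)) = cis \<theta>" using cis_Arg[of "cis \<theta>"] by (simp add: sgn_div_norm)
    then have "sin \<theta> = sin (Arg (-u/r))" "cos \<theta> = cos (Arg (-u/r))" by (auto simp: complex_eq_iff)
    then obtain n::int where "\<theta> = Arg (-u/r) + 2 * pi * n"
      using sin_cos_eq_iff by blast
    then show "\<theta> \<in> range (\<lambda>k::int. Arg (- u / r) + 2 * pi * k)" by blast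
  qed
  then have "countable {\<theta>. u + of_real r * cis \<theta> = 0}" by (rule countable_subset) simp
  then have "{\<theta>. u + of_real r * cis \<theta> = 0} \<in> null_sets lborel" by (rule countable_imp_null_set_lborel)
  then have "AE \<theta> in lborel. u + of_real r * cis \<theta> \<noteq> 0"
    by (rule AE_I'[where N="{\<theta>. u + of_real r * cis \<theta> = 0}"]) auto
  then show ?thesis unfolding circ_def by (subst AE_density) auto
qed

text \<open>The pole of the logarithm lies on the circle: it is moved radially inwards, to \<open>s n * u\<close>. Fatou's lemma
  gives integrability, and then \<open>cmod (u + r * cis \<theta>) \<le> 2 * cmod (s n * u + r * cis \<theta>)\<close> a dominating function.\<close>

lemma circ_mean_ln_boundary:
  assumes u: "cmod u = r" and r: "0 < r"
  shows "integrable circ (\<lambda>\<theta>. ln (cmod (u + r * cis \<theta>)))"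
    "(\<integral>\<theta>. ln (cmod (u + r * cis \<theta>)) \<partial>circ) = ln r"
proof -
  define s where "s n = real n / (real n + 1)" for n
  have s: "0 \<le> s n" "s n < 1" for n by (auto simp: s_def divide_simps)
  have slim: "s \<longlonglongrightarrow> 1" unfolding s_def by real_asymp
  let ?f = "\<lambda>\<theta>. ln (cmod (u + r * cis \<theta>))"
  let ?F = "\<lambda>n \<theta>. ln (cmod (s n * u + r * cis \<theta>))"
  have su: "cmod (s n * u) < r" for n using u r s[of n] by (simp add: norm_mult abs_if)
  note I = circ_mean_ln_inside[OF su]
  have lim: "AE \<theta> in circ. (\<lambda>n. ?F n \<theta>) \<longlonglongrightarrow> ?f \<theta>"
    using AE_circ_nonzero[OF r, of u]
  proof eventually_elim
    case (elim \<theta>)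
    have "(\<lambda>n. s n * u + r * cis \<theta>) \<longlonglongrightarrow> of_real 1 * u + r * cis \<theta>"
      by (intro tendsto_intros slim)
    then show ?case using elim by (intro tendsto_ln tendsto_norm) auto
  qed
  have le: "?F n \<theta> \<le> ln (2 * r)" for n \<theta>
  proof -
    have "cmod (s n * u + r * cis \<theta>) \<le> cmod (s n * u) + cmod (r * cis \<theta>)" by (rule norm_triangle_ineq)
    also have "\<dots> \<le> 2 * r" using su[of n] r by (simp add: norm_mult)
    finally have *: "cmod (s n * u + r * cis \<theta>) \<le> 2 * r" .
    have "cmod (s n * u + r * cis \<theta>) \<noteq> 0"
    proof
      assume "cmod (s n * u + r * cis \<theta>) = 0"
      then have "cmod (s n * u) = cmod (r * cis \<theta>)" by (simp add: add_eq_0_iff del: norm_of_real)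
      then show False using su[of n] r by (simp add: norm_mult)
    qed
    then have "0 < cmod (s n * u + r * cis \<theta>)" by simp
    with * show ?thesis using r by (intro ln_mono) auto
  qed
  have [measurable]: "(\<lambda>\<theta>. ?F n \<theta>) \<in> borel_measurable borel" "?f \<in> borel_measurable borel" for n
    by (auto intro!: borel_measurable_continuous_onI borel_measurable_ln continuous_intros)
  have "(\<integral>\<^sup>+\<theta>. ennreal (ln (2*r) - ?f \<theta>) \<partial>circ) = (\<integral>\<^sup>+\<theta>. liminf (\<lambda>n. ennreal (ln (2*r) - ?F n \<theta>)) \<partial>circ)"
  proof (rule nn_integral_cong_AE, use lim in eventually_elim)
    case (elim \<theta>)
    have "(\<lambda>n. ennreal (ln (2*r) - ?F n \<theta>)) \<longlonglongrightarrow> ennreal (ln (2*r) - ?f \<theta>)"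
      by (intro tendsto_ennrealI tendsto_intros elim)
    then show ?case by (simp add: lim_imp_Liminf)
  qed
  also have "\<dots> \<le> liminf (\<lambda>n. \<integral>\<^sup>+\<theta>. ennreal (ln (2*r) - ?F n \<theta>) \<partial>circ)"
    by (rule nn_integral_liminf) simp
  also have "(\<lambda>n. \<integral>\<^sup>+\<theta>. ennreal (ln (2*r) - ?F n \<theta>) \<partial>circ) = (\<lambda>n. ennreal (ln (2*r) - ln r))"
    using I le by (subst nn_integral_eq_integral) (auto simp: circ.prob_space)
  finally have fin: "(\<integral>\<^sup>+\<theta>. ennreal (ln (2*r) - ?f \<theta>) \<partial>circ) < \<infinity>" by (auto simp: Liminf_const intro: le_less_trans)
  have fle: "AE \<theta> in circ. ?f \<theta> \<le> ln (2*r)"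
    using lim by eventually_elim (rule LIMSEQ_le_const2, auto intro: le)
  have "integrable circ (\<lambda>\<theta>. ln (2*r) - ?f \<theta>)"
    using fin fle by (intro integrableI_nonneg) auto
  then have "integrable circ (\<lambda>\<theta>. ln (2*r) - (ln (2*r) - ?f \<theta>))" by (rule Bochner_Integration.integrable_diff[rotated]) simp
  moreover have "(\<lambda>\<theta>. ln (2*r) - (ln (2*r) - ?f \<theta>)) = ?f" by simp
  ultimately show int: "integrable circ ?f" by (simp only:)
  have "AE \<theta> in circ. norm (?F n \<theta>) \<le> \<bar>ln (2*r)\<bar> + ln 2 + \<bar>?f \<theta>\<bar>" for n
    using AE_circ_nonzero[OF r, of u]
  proof eventually_elim
    case (elim \<theta>)
    have "cmod (u + r * cis \<theta>) \<le> cmod (s n * u + r * cis \<theta>) + cmod ((1 - s n) * u)"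
      using norm_triangle_ineq[of "s n * u + r * cis \<theta>" "(1 - s n) * u"] by (simp add: algebra_simps)
    also have "cmod ((1 - s n) * u) = r - s n * r" 
      unfolding norm_mult using s[of n] u by (subst norm_of_real) (auto simp: algebra_simps)
    also have "r - s n * r \<le> cmod (s n * u + r * cis \<theta>)"
      using norm_triangle_ineq2[of "r * cis \<theta>" "- (s n * u)"] u s[of n] r by (simp add: norm_mult add.commute)
    finally have q: "cmod (u + r * cis \<theta>) \<le> 2 * cmod (s n * u + r * cis \<theta>)" by simp
    have p: "0 < cmod (u + r * cis \<theta>)" using elim by simp
    have "?f \<theta> \<le> ln (2 * cmod (s n * u + r * cis \<theta>))" by (rule ln_mono[OF q p])
    also have "\<dots> = ln 2 + ?F n \<theta>" using p q by (subst ln_mult) auto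
    finally have "?f \<theta> \<le> ln 2 + ?F n \<theta>" .
    then show ?case using le[of n \<theta>] ln_ge_zero[of "2::real"] unfolding real_norm_def by linarith
  qed
  then have "(\<lambda>n. \<integral>\<theta>. ?F n \<theta> \<partial>circ) \<longlonglongrightarrow> (\<integral>\<theta>. ?f \<theta> \<partial>circ)"
    using int lim by (intro integral_dominated_convergence[where w="\<lambda>\<theta>. \<bar>ln (2*r)\<bar> + ln 2 + \<bar>?f \<theta>\<bar>"]) auto
  then show "(\<integral>\<theta>. ?f \<theta> \<partial>circ) = ln r"
    unfolding I by (simp add: LIMSEQ_const_iff)
qed

text \<open>Whether \<open>p\<close> lies outside, on or inside the circle, the mean is the
  logarithm of the larger of \<open>r\<close> and \<open>cmod (a - p)\<close>. The kernel is the
  excess of this over the value at the centre, which is why it is the weight of a zero in Jensen's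
  formula.\<close>

lemma circ_mean_ln_dist:
  assumes r: "0 < r" and ap: "a \<noteq> p"
  shows "integrable circ (\<lambda>\<theta>. ln (cmod (a + r * cis \<theta> - p)))"
    "(\<integral>\<theta>. ln (cmod (a + r * cis \<theta> - p)) \<partial>circ) = ln (cmod (a - p)) + log_kernel r (p - a)"
proof -
  have eq: "a + r * cis \<theta> - p = (a - p) + r * cis \<theta>" for \<theta> by simp
  consider "r < cmod (a - p)" | "cmod (a - p) = r" | "cmod (a - p) < r" by linarith
  then have "integrable circ (\<lambda>\<theta>. ln (cmod (a + r * cis \<theta> - p))) \<and>
    (\<integral>\<theta>. ln (cmod (a + r * cis \<theta> - p)) \<partial>circ) = ln (cmod (a - p)) + log_kernel r (p - a)"
  proof cases
    case 1
    have "(\<lambda>z. z - p) holomorphic_on ball a (cmod (a - p))" by (intro holomorphic_intros)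
    moreover have "z - p \<noteq> 0" if "z \<in> ball a (cmod (a - p))" for z using that by (auto simp: dist_norm)
    ultimately show ?thesis using circ_mean_ln_nonzero[of "\<lambda>z. z - p" a "cmod (a - p)" r] 1 r
      by (auto simp: log_kernel_eq_0 norm_minus_commute)
  next
    case 2
    then show ?thesis unfolding eq using circ_mean_ln_boundary[of "a - p" r] r
      by (auto simp: log_kernel_eq_0 norm_minus_commute)
  next
    case 3
    then show ?thesis unfolding eq using circ_mean_ln_inside[of "a - p" r] r ap
      by (auto simp: log_kernel_eq norm_minus_commute)
  qed
  then show "integrable circ (\<lambda>\<theta>. ln (cmod (a + r * cis \<theta> - p)))"
    "(\<integral>\<theta>. ln (cmod (a + r * cis \<theta> - p)) \<partial>circ) = ln (cmod (a - p)) + log_kernel r (p - a)" by blast+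
qed

lemma circle_in_disc: "0 < r \<Longrightarrow> cmod a + r < 1 \<Longrightarrow> a + of_real r * cis \<theta> \<in> ball 0 1"
  using norm_triangle_ineq[of a "of_real r * cis \<theta>"] by (simp add: norm_mult)

lemma cball_in_disc:
  assumes "cmod a + r < 1"
  shows "cball a r \<subseteq> ball 0 1"
proof
  fix z assume "z \<in> cball a r"
  then show "z \<in> ball 0 1"
    using norm_triangle_ineq[of a "z - a"] assms by (simp add: dist_norm norm_minus_commute)
qed

lemma circ_integrable_continuous:
  fixes u :: "real \<Rightarrow> real"
  assumes u: "continuous_on UNIV u"
  shows "integrable circ u"
proof -
  have "compact (u ` {0..2*pi})" using u by (intro compact_continuous_image) (auto intro: continuous_on_subset)
  from compact_imp_bounded[OF this] obtain B where B: "\<forall>x\<in>u ` {0..2*pi}. norm x \<le> B" unfolding bounded_iff by blast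
  have [measurable]: "u \<in> borel_measurable borel" by (rule borel_measurable_continuous_onI[OF u])
  have "AE \<theta> in circ. \<theta> \<in> {0..2*pi}" unfolding circ_def by (subst AE_density) (auto simp: indicator_def)
  then have "AE \<theta> in circ. norm (u \<theta>) \<le> B" by eventually_elim (use B in auto)
  then show ?thesis by (intro circ.integrable_const_bound[of _ B]) auto
qed

section \<open>Multiplicities and Jensen's formula\<close>

lemma zorder_prod_factor:
  fixes z :: complex
  assumes "finite Z" "z \<in> Z"
  shows "zorder (\<lambda>w. \<Prod>p\<in>Z. (w - p) ^ m p) z = int (m z)"
proof (rule zorder_eqI[where S="- (Z - {z})" and g="\<lambda>w. \<Prod>p\<in>Z - {z}. (w - p) ^ m p"])
  show "open (- (Z - {z}))" using assms by (intro open_Compl finite_imp_closed) auto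
  show "(\<lambda>w. \<Prod>p\<in>Z - {z}. (w - p) ^ m p) holomorphic_on - (Z - {z})" by (intro holomorphic_intros)
  show "(\<Prod>p\<in>Z - {z}. (z - p) ^ m p) \<noteq> 0" using assms by auto
  show "(\<Prod>p\<in>Z. (w - p) ^ m p) = (\<Prod>p\<in>Z - {z}. (w - p) ^ m p) * (w - z) powi int (m z)" for w
    using assms by (simp add: prod.remove[of Z z])
qed auto

lemma zorder_pos_zero:
  assumes "F holomorphic_on A" "open A" "connected A" "\<exists>w\<in>A. F w \<noteq> 0" "z \<in> A" "F z = 0"
  shows "0 < zorder F z"
  using zorder_exist_zero[OF assms(1,2,3,5,4)] assms(6) by auto

text \<open>Dividing out the finitely many zeros in a slightly larger disc leaves a zero-free factor
  \<open>h\<close>. Then \<open>ln (cmod F)\<close> is \<open>ln (cmod h)\<close> plus multiples of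
  logarithms of distances, and the circle mean of each of these terms is known.\<close>

theorem jensen_formula:
  fixes r R :: real
  assumes F: "F holomorphic_on ball a R" and r: "0 < r" "r < R" and a: "F a \<noteq> 0"
  shows "finite {p \<in> cball a r. F p = 0}"
    "integrable circ (\<lambda>\<theta>. ln (cmod (F (a + r * cis \<theta>))))"
    "(\<integral>\<theta>. ln (cmod (F (a + r * cis \<theta>))) \<partial>circ) =
      ln (cmod (F a)) + (\<Sum>p\<in>{p \<in> cball a r. F p = 0}. real (nat (zorder F p)) * log_kernel r (p - a))"
proof -
  \<comment> \<open>A radius strictly between \<open>r\<close> and \<open>R\<close>, so that zeros
    on the circle itself are divided out too and the circle lies in the open disc on which
    \<open>h\<close> has no zero.\<close>
  define s where "s = (r + R) / 2"
  have s: "r < s" "s < R" using r by (auto simp: s_def)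
  define Z where "Z = {p \<in> cball a s. F p = 0}"
  have sub: "cball a s \<subseteq> ball a R" using s by auto
  have ex: "\<exists>w\<in>ball a R. F w \<noteq> 0" using a r by (intro bexI[of _ a]) auto
  have fin: "finite Z"
  proof (cases "F constant_on ball a R")
    case True
    then have "F p = F a" if "p \<in> ball a R" for p using that r unfolding constant_on_def by (metis centre_in_ball less_trans)
    then have "Z = {}" using a sub by (force simp: Z_def)
    then show ?thesis by simp
  next
    case False
    then show ?thesis unfolding Z_def
      by (intro holomorphic_compact_finite_zeros[OF F _ _ _ sub]) auto
  qed
  define m where "m p = nat (zorder F p)" for p
  have pos: "0 < zorder F p" if "p \<in> Z" for p
    using zorder_pos_zero[OF F _ _ ex] that sub by (auto simp: Z_def)
  define P where "P w = (\<Prod>p\<in>Z. (w - p) ^ m p)" for w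
  have hol: "P holomorphic_on ball a s" unfolding P_def by (intro holomorphic_intros)
  have P0: "P w = 0 \<longleftrightarrow> w \<in> Z" for w
    using fin pos by (auto simp: P_def m_def)
  have holF: "F holomorphic_on ball a s" using F s by (meson holomorphic_on_subset subset_ball less_imp_le)
  obtain h where h: "h holomorphic_on ball a s" "\<And>z. z \<in> ball a s \<Longrightarrow> h z \<noteq> 0"
      "\<And>z. z \<in> ball a s \<Longrightarrow> F z = h z * P z"
  proof (rule holomorphic_zorder_factorization[OF holF _ _ hol])
    show "P z = 0 \<longleftrightarrow> F z = 0" if "z \<in> ball a s" for z using that P0 by (auto simp: Z_def)
    show "zorder P z = zorder F z" if z: "z \<in> ball a s" for z
    proof (cases "z \<in> Z")
      case True
      then show ?thesis unfolding P_def using zorder_prod_factor[OF fin True, of m] pos[OF True] by (simp add: m_def)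
    next
      case False
      then have "P z \<noteq> 0" "F z \<noteq> 0" using z by (auto simp: P0) (auto simp: Z_def)
      moreover have "P analytic_on {z}" "F analytic_on {z}"
        using hol holF z by (auto simp: analytic_at intro!: exI[of _ "ball a s"])
      ultimately show ?thesis by (simp add: zorder_eq_0I)
    qed
  qed auto
  have aZ: "a \<noteq> p" if "p \<in> Z" for p using that a by (auto simp: Z_def)
  have lnF: "ln (cmod (F z)) = ln (cmod (h z)) + (\<Sum>p\<in>Z. real (m p) * ln (cmod (z - p)))"
    if "z \<in> ball a s" "z \<notin> Z" for z
  proof -
    have nz: "z - p \<noteq> 0" if "p \<in> Z" for p using that \<open>z \<notin> Z\<close> by auto
    have eP: "cmod (P z) = (\<Prod>p\<in>Z. cmod (z - p) ^ m p)"
      by (simp add: P_def prod_norm[symmetric] norm_power)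
    have "P z \<noteq> 0" using P0 that by blast
    then have "ln (cmod (F z)) = ln (cmod (h z)) + ln (cmod (P z))"
      using h that by (simp add: norm_mult ln_mult)
    also note eP
    also have "ln (\<Prod>p\<in>Z. cmod (z - p) ^ m p) = (\<Sum>p\<in>Z. real (m p) * ln (cmod (z - p)))"
      using fin nz by (subst ln_prod) (auto simp: ln_realpow)
    finally show ?thesis .
  qed
  have inb: "a + r * cis \<theta> \<in> ball a s" for \<theta> using r s by (simp add: dist_norm norm_mult)
  \<comment> \<open>The splitting \<open>lnF\<close> of the logarithm fails at the zeros, where
    \<open>ln 0\<close> takes its default value; the angles that hit a zero form a null set.\<close>
  have AE: "AE \<theta> in circ. a + r * cis \<theta> \<notin> Z"
  proof -
    have "AE \<theta> in circ. \<forall>p\<in>Z. (a - p) + r * cis \<theta> \<noteq> 0"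
      using fin AE_circ_nonzero[OF r(1)] by (simp add: AE_finite_all)
    then show ?thesis
    proof eventually_elim
      case (elim \<theta>)
      show ?case
      proof
        assume "a + r * cis \<theta> \<in> Z"
        then show False using elim by (metis add_diff_eq add.commute diff_add_eq right_minus_eq)
      qed
    qed
  qed
  note H = circ_mean_ln_nonzero[OF h(1) r(1) s(1) h(2)]
  note D = circ_mean_ln_dist[OF r(1) aZ]
  let ?S = "\<lambda>\<theta>. ln (cmod (h (a + r * cis \<theta>))) + (\<Sum>p\<in>Z. real (m p) * ln (cmod (a + r * cis \<theta> - p)))"
  have S: "integrable circ ?S"
    by (intro Bochner_Integration.integrable_add H Bochner_Integration.integrable_sum integrable_mult_right D)
  have AES: "AE \<theta> in circ. ?S \<theta> = ln (cmod (F (a + r * cis \<theta>)))"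
    using AE by eventually_elim (simp add: lnF[OF inb])
  have cont: "continuous_on UNIV (\<lambda>\<theta>. F (a + r * cis \<theta>))"
    by (rule continuous_on_compose2[OF holomorphic_on_imp_continuous_on[OF holF]])
       (use inb in \<open>auto intro!: continuous_intros\<close>)
  then have [measurable]: "(\<lambda>\<theta>. F (a + r * cis \<theta>)) \<in> borel_measurable borel"
    by (rule borel_measurable_continuous_onI)
  have meas: "(\<lambda>\<theta>. ln (cmod (F (a + r * cis \<theta>)))) \<in> borel_measurable circ" by measurable
  show "integrable circ (\<lambda>\<theta>. ln (cmod (F (a + r * cis \<theta>))))"
    by (rule integrable_cong_AE_imp[OF S meas AES])
  have sub2: "{p \<in> cball a r. F p = 0} \<subseteq> Z" using s by (auto simp: Z_def)
  then show "finite {p \<in> cball a r. F p = 0}" using fin finite_subset by blast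
  have "(\<integral>\<theta>. ln (cmod (F (a + r * cis \<theta>))) \<partial>circ) = (\<integral>\<theta>. ?S \<theta> \<partial>circ)"
    using S meas AES by (intro integral_cong_AE) auto
  also have "\<dots> = (\<integral>\<theta>. ln (cmod (h (a + r * cis \<theta>))) \<partial>circ) + (\<Sum>p\<in>Z. real (m p) * (\<integral>\<theta>. ln (cmod (a + r * cis \<theta> - p)) \<partial>circ))"
    using H D by (subst Bochner_Integration.integral_add) (auto simp: Bochner_Integration.integral_sum)
  also have "\<dots> = ln (cmod (h a)) + (\<Sum>p\<in>Z. real (m p) * (ln (cmod (a - p)) + log_kernel r (p - a)))"
    using H D by simp
  also have "\<dots> = ln (cmod (F a)) + (\<Sum>p\<in>Z. real (m p) * log_kernel r (p - a))"
    using lnF[of a] r s aZ by (subst lnF) (auto simp: ring_distribs sum.distrib)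
  \<comment> \<open>Zeros on the circle of radius \<open>r\<close> or beyond it were divided out as
    well, but their kernel vanishes.\<close>
  also have "(\<Sum>p\<in>Z. real (m p) * log_kernel r (p - a)) = (\<Sum>p\<in>{p \<in> cball a r. F p = 0}. real (m p) * log_kernel r (p - a))"
  proof (rule sum.mono_neutral_right[OF fin sub2], rule ballI)
    fix p assume "p \<in> Z - {p \<in> cball a r. F p = 0}"
    then have "r \<le> cmod (p - a)" by (auto simp: Z_def dist_norm norm_minus_commute)
    then show "real (m p) * log_kernel r (p - a) = 0" using r by (simp add: log_kernel_eq_0)
  qed
  finally show "(\<integral>\<theta>. ln (cmod (F (a + r * cis \<theta>))) \<partial>circ) =
      ln (cmod (F a)) + (\<Sum>p\<in>{p \<in> cball a r. F p = 0}. real (nat (zorder F p)) * log_kernel r (p - a))"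
    by (simp add: m_def)
qed

section \<open>Uniqueness of characteristic functions of random vectors\<close>

lemma borel_measurable_cis [measurable]: "cis \<in> borel_measurable borel"
  by (intro borel_measurable_continuous_onI continuous_intros)

text \<open>Levy's uniqueness theorem for the probability measures with densities
  \<open>w / c\<close> and \<open>v / c\<close>, where \<open>c\<close> is the total weight. If
  \<open>c = 0\<close>, both weights vanish almost everywhere.\<close>

lemma weighted_char_unique:
  fixes X :: "'a \<Rightarrow> real" and Y :: "'b \<Rightarrow> real"
  assumes P: "finite_measure P" and Q: "finite_measure Q"
    and [measurable]: "X \<in> borel_measurable P" "Y \<in> borel_measurable Q"
      "w \<in> borel_measurable P" "v \<in> borel_measurable Q"
    and w: "\<And>x. 0 \<le> w x" "\<And>x. w x \<le> B" and v: "\<And>x. 0 \<le> v x" "\<And>x. v x \<le> B"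
    and eq: "\<And>s. (\<integral>x. of_real (w x) * cis (s * X x) \<partial>P) = (\<integral>x. of_real (v x) * cis (s * Y x) \<partial>Q)"
    and A[measurable]: "A \<in> sets borel"
  shows "(\<integral>x. w x * indicator A (X x) \<partial>P) = (\<integral>x. v x * indicator A (Y x) \<partial>Q)"
proof -
  interpret P: finite_measure P by fact
  interpret Q: finite_measure Q by fact
  have iw: "integrable P w" by (rule P.integrable_const_bound[of _ B]) (use w in \<open>auto simp: abs_of_nonneg\<close>)
  have iv: "integrable Q v" by (rule Q.integrable_const_bound[of _ B]) (use v in \<open>auto simp: abs_of_nonneg\<close>)
  define c where "c = (\<integral>x. w x \<partial>P)"
  \<comment> \<open>Frequency 0 shows that both sides have the same total weight.\<close>
  have c2: "c = (\<integral>x. v x \<partial>Q)"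
    using eq[of 0] by (simp add: c_def)
  show ?thesis
  proof (cases "c = 0")
    case True
    have "AE x in P. w x = 0" using True w iw by (simp add: c_def integral_nonneg_eq_0_iff_AE)
    moreover have "AE x in Q. v x = 0" using True v iv by (simp add: c2 integral_nonneg_eq_0_iff_AE)
    ultimately show ?thesis
      by (subst (1 2) integral_cong_AE[where g="\<lambda>_. 0"]) (auto intro: A)
  next
    case False
    have cpos: "0 < c" using False w by (simp add: c_def less_le integral_nonneg)
    have *: "real_distribution (distr (density R (\<lambda>x. ennreal (u x / c))) borel Z)
        \<and> char (distr (density R (\<lambda>x. ennreal (u x / c))) borel Z) s = (\<integral>x. of_real (u x) * cis (s * Z x) \<partial>R) / c
        \<and> measure (distr (density R (\<lambda>x. ennreal (u x / c))) borel Z) A = (\<integral>x. u x * indicator A (Z x) \<partial>R) / c"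
      if [measurable]: "u \<in> borel_measurable R" "Z \<in> borel_measurable R"
        and u: "\<And>x. 0 \<le> u x" "integrable R u" "(\<integral>x. u x \<partial>R) = c" for R :: "'c measure" and u Z s
    proof (intro conjI)
      have "emeasure (density R (\<lambda>x. ennreal (u x / c))) (space R) = (\<integral>\<^sup>+x. ennreal (u x / c) \<partial>R)"
        by (subst emeasure_density) (auto intro!: nn_integral_cong)
      also have "\<dots> = 1" using u cpos by (subst nn_integral_eq_integral) auto
      finally have p: "prob_space (density R (\<lambda>x. ennreal (u x / c)))" by (intro prob_spaceI) simp
      show "real_distribution (distr (density R (\<lambda>x. ennreal (u x / c))) borel Z)"
        using p by (intro real_distribution.intro prob_space.prob_space_distr real_distribution_axioms.intro) auto
      show "char (distr (density R (\<lambda>x. ennreal (u x / c))) borel Z) s = (\<integral>x. of_real (u x) * cis (s * Z x) \<partial>R) / c"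
        unfolding char_def using u cpos
        by (subst integral_distr, simp, simp, subst integral_density)
           (auto simp: cis_conv_exp scaleR_conv_of_real field_simps simp flip: integral_divide_zero intro!: Bochner_Integration.integral_cong)
      interpret D: prob_space "density R (\<lambda>x. ennreal (u x / c))" by (rule p)
      have "measure (distr (density R (\<lambda>x. ennreal (u x / c))) borel Z) A
        = (\<integral>x. indicator (Z -` A \<inter> space R) x \<partial>density R (\<lambda>x. ennreal (u x / c)))"
        using A by (subst measure_distr) auto
      also have "\<dots> = (\<integral>x. (u x / c) * indicator (Z -` A \<inter> space R) x \<partial>R)"
        using u cpos A by (subst integral_density) auto
      also have "\<dots> = (\<integral>x. (u x * indicator A (Z x)) / c \<partial>R)"
        by (intro Bochner_Integration.integral_cong) (auto simp: indicator_def)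
      finally show "measure (distr (density R (\<lambda>x. ennreal (u x / c))) borel Z) A = (\<integral>x. u x * indicator A (Z x) \<partial>R) / c"
        by simp
    qed
    note 1 = *[of w P X, OF _ _ w(1) iw c_def[symmetric]] and 2 = *[of v Q Y, OF _ _ v(1) iv c2[symmetric]]
    have "distr (density P (\<lambda>x. ennreal (w x / c))) borel X = distr (density Q (\<lambda>x. ennreal (v x / c))) borel Y"
      using 1 2 eq by (intro Levy_uniqueness) auto
    then show ?thesis using 1 2 cpos by (metis (no_types, lifting) assms(3-6) divide_cancel_right less_irrefl)
  qed
qed

text \<open>Coordinates are removed one at a time by the one-dimensional uniqueness theorem: with the
  weight \<open>w\<close> replaced by \<open>w * (1 + cos (S + \<tau>))\<close>, where \<open>S\<close> is a linear combination of the remaining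
  coordinates, it determines the integrals of \<open>w * indicator A (X k) * cis S\<close>.\<close>

lemma char_family_unique:
  fixes X :: "'i \<Rightarrow> 'a \<Rightarrow> real" and Y :: "'i \<Rightarrow> 'b \<Rightarrow> real"
  assumes "finite J" and P: "finite_measure P" and Q: "finite_measure Q"
    and X[measurable]: "\<And>j. X j \<in> borel_measurable P" and Y[measurable]: "\<And>j. Y j \<in> borel_measurable Q"
    and A: "\<And>j. j \<in> J \<Longrightarrow> A j \<in> sets borel"
    and "w \<in> borel_measurable P" "v \<in> borel_measurable Q"
    and "\<And>x. 0 \<le> w x" "\<And>x. w x \<le> B" and "\<And>x. 0 \<le> v x" "\<And>x. v x \<le> B"
    and "\<And>t. (\<integral>x. of_real (w x) * cis (\<Sum>j\<in>J. t j * X j x) \<partial>P) = (\<integral>x. of_real (v x) * cis (\<Sum>j\<in>J. t j * Y j x) \<partial>Q)"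
  shows "(\<integral>x. w x * (\<Prod>j\<in>J. indicator (A j) (X j x)) \<partial>P) = (\<integral>x. v x * (\<Prod>j\<in>J. indicator (A j) (Y j x)) \<partial>Q)"
  using assms(1,6-)
proof (induction J arbitrary: w v)
  case empty
  from empty(8)[of undefined] show ?case by simp
next
  case (insert k J)
  note [measurable] = insert.prems(2,3)
  note w = insert.prems(4,5) and v = insert.prems(6,7) and eq = insert.prems(8)
  have [measurable]: "A k \<in> sets borel" using insert.prems(1) by auto
  interpret P: finite_measure P by fact
  interpret Q: finite_measure Q by fact
  have intP: "complex_integrable P (\<lambda>x. of_real (w x) * cis (g x))"
    if [measurable]: "g \<in> borel_measurable P" for g
    by (rule P.integrable_const_bound[of _ B]) (use w in \<open>auto simp: norm_mult abs_of_nonneg\<close>)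
  have intQ: "complex_integrable Q (\<lambda>x. of_real (v x) * cis (g x))"
    if [measurable]: "g \<in> borel_measurable Q" for g
    by (rule Q.integrable_const_bound[of _ B]) (use v in \<open>auto simp: norm_mult abs_of_nonneg\<close>)
  have B0: "0 \<le> B" using w[of undefined] by linarith
  have step: "(\<integral>x. of_real (w x * indicator (A k) (X k x)) * cis (\<Sum>j\<in>J. t j * X j x) \<partial>P) =
      (\<integral>x. of_real (v x * indicator (A k) (Y k x)) * cis (\<Sum>j\<in>J. t j * Y j x) \<partial>Q)" for t
  proof -
    define S where "S x = (\<Sum>j\<in>J. t j * X j x)" for x
    define T where "T y = (\<Sum>j\<in>J. t j * Y j y)" for y
    have [measurable]: "S \<in> borel_measurable P" "T \<in> borel_measurable Q" unfolding S_def T_def by auto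
    have lin: "(\<integral>x. of_real (w x) * cis (s * X k x + \<sigma> * S x) \<partial>P) = (\<integral>x. of_real (v x) * cis (s * Y k x + \<sigma> * T x) \<partial>Q)" for s \<sigma>
    proof -
      have *: "(\<Sum>j\<in>insert k J. (if j = k then s else \<sigma> * t j) * Z j) = s * Z k + \<sigma> * (\<Sum>j\<in>J. t j * Z j)" for Z :: "'i \<Rightarrow> real"
      proof -
        have "(\<Sum>j\<in>J. (if j = k then s else \<sigma> * t j) * Z j) = (\<Sum>j\<in>J. \<sigma> * (t j * Z j))"
          using insert.hyps by (intro sum.cong) auto
        then show ?thesis using insert.hyps by (simp add: sum_distrib_left)
      qed
      from eq[of "\<lambda>j. if j = k then s else \<sigma> * t j"] show ?thesis unfolding * S_def T_def .
    qed
    have e0: "(\<integral>x. of_real (w x) * cis (s * X k x) \<partial>P) = (\<integral>x. of_real (v x) * cis (s * Y k x) \<partial>Q)" for s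
      using lin[of s 0] by simp
    \<comment> \<open>Product-to-sum: the modulated character is a combination of characters at
      \<open>a\<close> and \<open>a + b\<close> and \<open>a - b\<close>, all of which
      \<open>lin\<close> controls with \<sigma> equal to 0, 1 and -1.\<close>
    have trig: "complex_of_real (1 + cos (b + \<tau>)) * cis a = cis a + (cis \<tau> * cis (a + 1 * b) + cis (- \<tau>) * cis (a + (-1) * b)) / 2" for a b \<tau>
      by (auto simp: complex_eq_iff cos_add sin_add cos_diff sin_diff field_simps)
    have ec: "(\<integral>x. of_real (w x * (1 + cos (S x + \<tau>))) * cis (s * X k x) \<partial>P) = (\<integral>x. of_real (v x * (1 + cos (T x + \<tau>))) * cis (s * Y k x) \<partial>Q)" for s \<tau>
    proof -
      have "(\<integral>x. of_real (w x * (1 + cos (S x + \<tau>))) * cis (s * X k x) \<partial>P) =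
        (\<integral>x. of_real (w x) * cis (s * X k x) + (cis \<tau> * (of_real (w x) * cis (s * X k x + 1 * S x)) + cis (- \<tau>) * (of_real (w x) * cis (s * X k x + (-1) * S x))) / 2 \<partial>P)"
        by (intro Bochner_Integration.integral_cong refl) (simp only: of_real_mult mult.assoc trig, simp add: algebra_simps)
      also have "\<dots> = (\<integral>x. of_real (w x) * cis (s * X k x) \<partial>P) + (cis \<tau> * (\<integral>x. of_real (w x) * cis (s * X k x + 1 * S x) \<partial>P) + cis (- \<tau>) * (\<integral>x. of_real (w x) * cis (s * X k x + (-1) * S x) \<partial>P)) / 2"
        by (simp add: intP)
      also have "\<dots> = (\<integral>x. of_real (v x) * cis (s * Y k x) \<partial>Q) + (cis \<tau> * (\<integral>x. of_real (v x) * cis (s * Y k x + 1 * T x) \<partial>Q) + cis (- \<tau>) * (\<integral>x. of_real (v x) * cis (s * Y k x + (-1) * T x) \<partial>Q)) / 2"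
        unfolding lin e0 ..
      also have "\<dots> = (\<integral>x. of_real (v x) * cis (s * Y k x) + (cis \<tau> * (of_real (v x) * cis (s * Y k x + 1 * T x)) + cis (- \<tau>) * (of_real (v x) * cis (s * Y k x + (-1) * T x))) / 2 \<partial>Q)"
        by (simp add: intQ)
      also have "\<dots> = (\<integral>x. of_real (v x * (1 + cos (T x + \<tau>))) * cis (s * Y k x) \<partial>Q)"
        by (intro Bochner_Integration.integral_cong refl) (simp only: of_real_mult mult.assoc trig, simp add: algebra_simps)
      finally show ?thesis .
    qed
    \<comment> \<open>The summand 1 keeps the modulated weight nonnegative and bounded by
      \<open>2 * B\<close>, as the one-dimensional lemma demands. Its contribution is known from
      \<open>m0\<close> and drops out in \<open>c\<tau>\<close>; the phases 0 and
      \<open>- (pi / 2)\<close> then give the cosine and the sine of \<open>S\<close>.\<close>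
    have sc: "0 \<le> 1 + cos y" "1 + cos y \<le> 2" for y :: real
      using cos_ge_minus_one[of y] cos_le_one[of y] by linarith+
    have bw: "w x * (1 + cos y) \<le> B * 2" for x y
      using w B0 sc by (auto intro!: mult_mono)
    have bv: "v x * (1 + cos y) \<le> B * 2" for x y
      using v B0 sc by (auto intro!: mult_mono)
    have m0: "(\<integral>x. w x * indicator (A k) (X k x) \<partial>P) = (\<integral>x. v x * indicator (A k) (Y k x) \<partial>Q)"
      by (rule weighted_char_unique[OF P Q _ _ _ _ w v e0]) auto
    have mc: "(\<integral>x. w x * (1 + cos (S x + \<tau>)) * indicator (A k) (X k x) \<partial>P) = (\<integral>x. v x * (1 + cos (T x + \<tau>)) * indicator (A k) (Y k x) \<partial>Q)" for \<tau>
      by (rule weighted_char_unique[OF P Q _ _ _ _ _ bw _ bv ec]) (auto intro!: mult_nonneg_nonneg sc w v)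
    have iP: "integrable P (\<lambda>x. w x * indicator (A k) (X k x) * g x)" if [measurable]: "g \<in> borel_measurable P" and g: "\<And>x. \<bar>g x\<bar> \<le> 1" for g
      by (rule P.integrable_const_bound[of _ B])
         (use w g B0 in \<open>auto simp: abs_mult abs_of_nonneg indicator_def intro!: mult_mono[of _ B _ 1, simplified]\<close>)
    have iQ: "integrable Q (\<lambda>x. v x * indicator (A k) (Y k x) * g x)" if [measurable]: "g \<in> borel_measurable Q" and g: "\<And>x. \<bar>g x\<bar> \<le> 1" for g
      by (rule Q.integrable_const_bound[of _ B])
         (use v g B0 in \<open>auto simp: abs_mult abs_of_nonneg indicator_def intro!: mult_mono[of _ B _ 1, simplified]\<close>)
    have splitP: "(\<integral>x. w x * (1 + g x) * indicator (A k) (X k x) \<partial>P) = (\<integral>x. w x * indicator (A k) (X k x) \<partial>P) + (\<integral>x. w x * indicator (A k) (X k x) * g x \<partial>P)"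
      if [measurable]: "g \<in> borel_measurable P" and g: "\<And>x. \<bar>g x\<bar> \<le> 1" for g
      using iP[OF that] iP[of "\<lambda>_. 1"] by (subst Bochner_Integration.integral_add[symmetric]) (auto simp: algebra_simps)
    have splitQ: "(\<integral>x. v x * (1 + g x) * indicator (A k) (Y k x) \<partial>Q) = (\<integral>x. v x * indicator (A k) (Y k x) \<partial>Q) + (\<integral>x. v x * indicator (A k) (Y k x) * g x \<partial>Q)"
      if [measurable]: "g \<in> borel_measurable Q" and g: "\<And>x. \<bar>g x\<bar> \<le> 1" for g
      using iQ[OF that] iQ[of "\<lambda>_. 1"] by (subst Bochner_Integration.integral_add[symmetric]) (auto simp: algebra_simps)
    have c\<tau>: "(\<integral>x. w x * indicator (A k) (X k x) * cos (S x + \<tau>) \<partial>P) = (\<integral>x. v x * indicator (A k) (Y k x) * cos (T x + \<tau>) \<partial>Q)" for \<tau>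
      using mc[of \<tau>] m0 by (simp add: splitP splitQ)
    have c: "(\<integral>x. w x * indicator (A k) (X k x) * cos (S x) \<partial>P) = (\<integral>x. v x * indicator (A k) (Y k x) * cos (T x) \<partial>Q)"
      using c\<tau>[of 0] by simp
    have s: "(\<integral>x. w x * indicator (A k) (X k x) * sin (S x) \<partial>P) = (\<integral>x. v x * indicator (A k) (Y k x) * sin (T x) \<partial>Q)"
      using c\<tau>[of "- (pi / 2)"] by (simp add: cos_diff)
    have "(\<integral>x. of_real (w x * indicator (A k) (X k x)) * cis (S x) \<partial>P) =
       (\<integral>x. complex_of_real (w x * indicator (A k) (X k x) * cos (S x)) + \<i> * complex_of_real (w x * indicator (A k) (X k x) * sin (S x)) \<partial>P)"
      by (intro Bochner_Integration.integral_cong) (auto simp: complex_eq_iff)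
    also have "\<dots> = complex_of_real (\<integral>x. w x * indicator (A k) (X k x) * cos (S x) \<partial>P) + \<i> * complex_of_real (\<integral>x. w x * indicator (A k) (X k x) * sin (S x) \<partial>P)"
      using iP[of "\<lambda>x. cos (S x)"] iP[of "\<lambda>x. sin (S x)"]
      by (subst Bochner_Integration.integral_add) (auto simp del: of_real_mult intro!: integrable_mult_right integrable_of_real)
    also have "\<dots> = complex_of_real (\<integral>x. v x * indicator (A k) (Y k x) * cos (T x) \<partial>Q) + \<i> * complex_of_real (\<integral>x. v x * indicator (A k) (Y k x) * sin (T x) \<partial>Q)"
      unfolding c s ..
    also have "\<dots> = (\<integral>x. complex_of_real (v x * indicator (A k) (Y k x) * cos (T x)) + \<i> * complex_of_real (v x * indicator (A k) (Y k x) * sin (T x)) \<partial>Q)"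
      using iQ[of "\<lambda>x. cos (T x)"] iQ[of "\<lambda>x. sin (T x)"]
      by (subst Bochner_Integration.integral_add) (auto simp del: of_real_mult intro!: integrable_mult_right integrable_of_real)
    also have "\<dots> = (\<integral>x. of_real (v x * indicator (A k) (Y k x)) * cis (T x) \<partial>Q)"
      by (intro Bochner_Integration.integral_cong) (auto simp: complex_eq_iff)
    finally show ?thesis unfolding S_def T_def .
  qed
  have "(\<integral>x. (w x * indicator (A k) (X k x)) * (\<Prod>j\<in>J. indicator (A j) (X j x)) \<partial>P) =
    (\<integral>x. (v x * indicator (A k) (Y k x)) * (\<Prod>j\<in>J. indicator (A j) (Y j x)) \<partial>Q)"
    by (rule insert.IH) (use insert.prems(1) w v B0 step in \<open>auto simp: indicator_def\<close>)
  then show ?case using insert.hyps by (simp add: mult.assoc)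
qed

text \<open>Cylinder sets determine a finite measure on the product space, and the measure of a
  cylinder is the expectation of a product of indicators: \<open>char_family_unique\<close> with
  weight 1.\<close>

lemma real_process_law_unique:
  fixes X :: "'i \<Rightarrow> 'a \<Rightarrow> real" and Y :: "'i \<Rightarrow> 'b \<Rightarrow> real"
  assumes P: "prob_space P" and Q: "prob_space Q"
    and X[measurable]: "\<And>j. X j \<in> borel_measurable P" and Y[measurable]: "\<And>j. Y j \<in> borel_measurable Q"
    and eq: "\<And>t J. finite J \<Longrightarrow> (\<integral>x. cis (\<Sum>j\<in>J. t j * X j x) \<partial>P) = (\<integral>x. cis (\<Sum>j\<in>J. t j * Y j x) \<partial>Q)"
  shows "distr P (\<Pi>\<^sub>M j\<in>UNIV. borel) (\<lambda>x j. X j x) = distr Q (\<Pi>\<^sub>M j\<in>UNIV. borel) (\<lambda>x j. Y j x)"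
proof (rule measure_eqI_PiM_infinite)
  interpret P: prob_space P by fact
  interpret Q: prob_space Q by fact
  have mX: "(\<lambda>x j. X j x) \<in> measurable P (\<Pi>\<^sub>M j\<in>UNIV. borel)" by (rule measurable_PiM_single') auto
  have mY: "(\<lambda>x j. Y j x) \<in> measurable Q (\<Pi>\<^sub>M j\<in>UNIV. borel)" by (rule measurable_PiM_single') auto
  show "finite_measure (distr P (\<Pi>\<^sub>M j\<in>UNIV. borel) (\<lambda>x j. X j x))"
    using P.finite_measure_distr[OF mX] .
  fix A :: "'i \<Rightarrow> real set" and J :: "'i set"
  assume J: "finite J" and A: "\<And>i. i \<in> J \<Longrightarrow> A i \<in> sets borel"
  let ?E = "prod_emb UNIV (\<lambda>_. borel) J (Pi\<^sub>E J A)"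
  have E: "?E \<in> sets (\<Pi>\<^sub>M j\<in>UNIV. borel)" using J A by (intro sets_PiM_I) auto
  have E_eq: "x \<in> ?E \<longleftrightarrow> (\<forall>j\<in>J. x j \<in> A j)" for x
    by (auto simp: prod_emb_def PiE_iff)
  have ind: "indicator ?E x = (\<Prod>j\<in>J. indicator (A j) (x j) :: real)" for x
    using J by (auto simp: E_eq indicator_def prod_zero_iff)
  have gm: "(\<lambda>x. \<Prod>j\<in>J. indicator (A j) (x j) :: real) \<in> borel_measurable (\<Pi>\<^sub>M j\<in>UNIV. borel)"
    using E unfolding ind[symmetric] by simp
  have "measure (distr P (\<Pi>\<^sub>M j\<in>UNIV. borel) (\<lambda>x j. X j x)) ?E = (\<integral>x. 1 * (\<Prod>j\<in>J. indicator (A j) (X j x)) \<partial>P)"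
  proof -
    have "measure (distr P (\<Pi>\<^sub>M j\<in>UNIV. borel) (\<lambda>x j. X j x)) ?E = (\<integral>x. indicator ?E x \<partial>distr P (\<Pi>\<^sub>M j\<in>UNIV. borel) (\<lambda>x j. X j x))"
      using E by (simp add: space_PiM)
    then show ?thesis by (simp add: ind integral_distr[OF mX gm])
  qed
  also have "\<dots> = (\<integral>x. 1 * (\<Prod>j\<in>J. indicator (A j) (Y j x)) \<partial>Q)"
    by (rule char_family_unique[OF J P.finite_measure_axioms Q.finite_measure_axioms X Y A, where B=1])
       (use eq[OF J] in auto)
  also have "\<dots> = measure (distr Q (\<Pi>\<^sub>M j\<in>UNIV. borel) (\<lambda>x j. Y j x)) ?E"
  proof -
    have "measure (distr Q (\<Pi>\<^sub>M j\<in>UNIV. borel) (\<lambda>x j. Y j x)) ?E = (\<integral>x. indicator ?E x \<partial>distr Q (\<Pi>\<^sub>M j\<in>UNIV. borel) (\<lambda>x j. Y j x))"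
      using E by (simp add: space_PiM)
    then show ?thesis by (simp add: ind integral_distr[OF mY gm])
  qed
  finally show "emeasure (distr P (\<Pi>\<^sub>M j\<in>UNIV. borel) (\<lambda>x j. X j x)) ?E = emeasure (distr Q (\<Pi>\<^sub>M j\<in>UNIV. borel) (\<lambda>x j. Y j x)) ?E"
    using P.finite_measure_distr[OF mX] Q.finite_measure_distr[OF mY] by (simp add: finite_measure.emeasure_eq_measure)
qed auto

lemma complex_process_law_unique:
  fixes X :: "'i \<Rightarrow> 'a \<Rightarrow> complex" and Y :: "'i \<Rightarrow> 'b \<Rightarrow> complex"
  assumes P: "prob_space P" and Q: "prob_space Q"
    and X[measurable]: "\<And>j. X j \<in> borel_measurable P" and Y[measurable]: "\<And>j. Y j \<in> borel_measurable Q"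
    and eq: "\<And>c J. finite J \<Longrightarrow> (\<integral>x. cis (Re (\<Sum>j\<in>J. c j * X j x)) \<partial>P) = (\<integral>x. cis (Re (\<Sum>j\<in>J. c j * Y j x)) \<partial>Q)"
  shows "process_law P X = process_law Q Y"
proof -
  define R where "R z b = (if b then Re z else Im z)" for z b
  have [measurable]: "(\<lambda>z. R z b) \<in> borel_measurable borel" for b by (cases b) (auto simp: R_def)
  have *: "distr P (\<Pi>\<^sub>M j\<in>UNIV. borel) (\<lambda>x j. R (X (fst j) x) (snd j)) = distr Q (\<Pi>\<^sub>M j\<in>UNIV. borel) (\<lambda>x j. R (Y (fst j) x) (snd j))"
  proof (rule real_process_law_unique[OF P Q])
    fix t :: "'i \<times> bool \<Rightarrow> real" and J :: "('i \<times> bool) set"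
    assume J: "finite J"
    \<comment> \<open>Extension by zero, as \<open>J\<close> need not be a product set and may
      contain only one of the two parts of a coordinate.\<close>
    define t' where "t' j = (if j \<in> J then t j else 0)" for j
    \<comment> \<open>The sign comes from
      \<open>Re (c * z) = Re c * Re z - Im c * Im z\<close>.\<close>
    define c where "c k = Complex (t' (k, True)) (- t' (k, False))" for k
    have **: "(\<Sum>j\<in>J. t j * R (Z (fst j)) (snd j)) = Re (\<Sum>k\<in>fst ` J. c k * Z k)" for Z
    proof -
      have "(\<Sum>j\<in>J. t j * R (Z (fst j)) (snd j)) = (\<Sum>j\<in>fst ` J \<times> UNIV. t' j * R (Z (fst j)) (snd j))"
        using J by (intro sum.mono_neutral_cong_left) (auto simp: t'_def image_iff, force)
      also have "\<dots> = (\<Sum>k\<in>fst ` J. \<Sum>b\<in>UNIV. t' (k, b) * R (Z k) b)"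
        by (subst sum.cartesian_product) (auto intro!: sum.cong)
      also have "\<dots> = (\<Sum>k\<in>fst ` J. Re (c k * Z k))"
        by (simp add: UNIV_bool R_def c_def algebra_simps)
      finally show ?thesis by (simp add: Re_sum)
    qed
    show "(\<integral>x. cis (\<Sum>j\<in>J. t j * R (X (fst j) x) (snd j)) \<partial>P) = (\<integral>x. cis (\<Sum>j\<in>J. t j * R (Y (fst j) x) (snd j)) \<partial>Q)"
      by (simp only: **[of "\<lambda>k. X k x" for x] **[of "\<lambda>k. Y k x" for x] eq finite_imageI[OF J])
  qed auto
  define \<Phi> where "\<Phi> x k = complex_of_real (x (k, True)) + \<i> * complex_of_real (x (k, False))" for x :: "'i \<times> bool \<Rightarrow> real" and k
  have \<Phi>: "\<Phi> \<in> measurable (\<Pi>\<^sub>M j\<in>UNIV. borel) (\<Pi>\<^sub>M j\<in>UNIV. borel)"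
    unfolding \<Phi>_def by (rule measurable_PiM_single') auto
  have "process_law P X = distr (distr P (\<Pi>\<^sub>M j\<in>UNIV. borel) (\<lambda>x j. R (X (fst j) x) (snd j))) (\<Pi>\<^sub>M j\<in>UNIV. borel) \<Phi>"
    unfolding process_law_def using \<Phi>
    by (subst distr_distr) (auto intro!: distr_cong measurable_PiM_single' simp: \<Phi>_def R_def complex_eq_iff fun_eq_iff)
  moreover have "process_law Q Y = distr (distr Q (\<Pi>\<^sub>M j\<in>UNIV. borel) (\<lambda>x j. R (Y (fst j) x) (snd j))) (\<Pi>\<^sub>M j\<in>UNIV. borel) \<Phi>"
    unfolding process_law_def using \<Phi>
    by (subst distr_distr) (auto intro!: distr_cong measurable_PiM_single' simp: \<Phi>_def R_def complex_eq_iff fun_eq_iff)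
  ultimately show ?thesis unfolding * by simp
qed

section \<open>Complex Gaussian variables\<close>

definition complex_normal :: "complex measure" where
  "complex_normal = density lborel (\<lambda>z. ennreal (exp (- (cmod z)\<^sup>2) / pi))"

lemma sets_complex_normal [simp, measurable_cong]: "sets complex_normal = sets borel"
  by (simp add: complex_normal_def)

lemma space_complex_normal [simp]: "space complex_normal = UNIV"
  by (simp add: complex_normal_def)

lemma lborel_complex: "(lborel :: complex measure) = distr (lborel \<Otimes>\<^sub>M lborel) borel (\<lambda>(x, y). of_real x + \<i> * of_real y)"
proof (rule lborel_eqI)
  fix l u :: complex
  assume lu: "\<And>b. b \<in> Basis \<Longrightarrow> l \<bullet> b \<le> u \<bullet> b"
  have "(\<lambda>(x, y). of_real x + \<i> * of_real y) -` box l u = {Re l<..<Re u} \<times> {Im l<..<Im u}"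
    by (auto simp: box_def Basis_complex_def)
  then have "emeasure (distr (lborel \<Otimes>\<^sub>M lborel) borel (\<lambda>(x, y). of_real x + \<i> * of_real y)) (box l u)
    = emeasure (lborel \<Otimes>\<^sub>M lborel) ({Re l<..<Re u} \<times> {Im l<..<Im u})"
    by (subst emeasure_distr) (auto simp: space_pair_measure)
  also have "\<dots> = ennreal (Re u - Re l) * ennreal (Im u - Im l)"
    using lu[of 1] lu[of \<i>] by (subst lborel.emeasure_pair_measure_Times) (auto simp: Basis_complex_def)
  also have "\<dots> = ennreal (\<Prod>b\<in>Basis. (u - l) \<bullet> b)"
    using lu[of 1] lu[of \<i>] by (simp add: Basis_complex_def ennreal_mult)
  finally show "emeasure (distr (lborel \<Otimes>\<^sub>M lborel) borel (\<lambda>(x, y). of_real x + \<i> * of_real y)) (box l u)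
     = ennreal (\<Prod>b\<in>Basis. (u - l) \<bullet> b)" .
qed simp

text \<open>The law of the real part and of the imaginary part of a standard complex Gaussian
  variable, which share the unit variance equally.\<close>

definition half_var_normal :: "real measure" where
  "half_var_normal = density lborel (normal_density 0 (1 / sqrt 2))"

lemma sets_half_var_normal [simp, measurable_cong]: "sets half_var_normal = sets borel"
  by (simp add: half_var_normal_def)

lemma space_half_var_normal [simp]: "space half_var_normal = UNIV"
  by (simp add: half_var_normal_def)

lemma prob_space_half_var_normal: "prob_space half_var_normal"
  unfolding half_var_normal_def by (rule prob_space_normal_density) simp

interpretation half_var_normal: prob_space half_var_normal
  by (rule prob_space_half_var_normal)

interpretation half_var_normal_pair: pair_sigma_finite half_var_normal half_var_normal ..

lemma complex_normal_eq: "complex_normal = distr (half_var_normal \<Otimes>\<^sub>M half_var_normal) borel (\<lambda>(x, y). of_real x + \<i> * of_real y)"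
proof -
  have d: "ennreal (exp (- (cmod (of_real x + \<i> * of_real y))\<^sup>2) / pi) =
     ennreal (normal_density 0 (1 / sqrt 2) x) * ennreal (normal_density 0 (1 / sqrt 2) y)" for x y
    by (simp add: normal_density_def cmod_power2 ennreal_mult[symmetric] power_divide exp_add[symmetric])
  have "complex_normal = distr (density (lborel \<Otimes>\<^sub>M lborel) (\<lambda>p. ennreal (exp (- (cmod (case p of (x, y) \<Rightarrow> of_real x + \<i> * of_real y))\<^sup>2) / pi))) borel
    (\<lambda>(x, y). of_real x + \<i> * of_real y)"
    unfolding complex_normal_def by (subst lborel_complex, subst density_distr) auto
  also have "density (lborel \<Otimes>\<^sub>M lborel) (\<lambda>p. ennreal (exp (- (cmod (case p of (x, y) \<Rightarrow> of_real x + \<i> * of_real y))\<^sup>2) / pi))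
     = half_var_normal \<Otimes>\<^sub>M half_var_normal"
    unfolding half_var_normal_def
    by (subst pair_measure_density)
       (auto simp: d split_beta lborel.sigma_finite_measure_axioms half_var_normal.sigma_finite_measure_axioms simp flip: half_var_normal_def intro!: density_cong AE_I2)
  finally show ?thesis .
qed

lemma prob_space_complex_normal: "prob_space complex_normal"
proof -
  interpret pair_prob_space half_var_normal half_var_normal ..
  show ?thesis unfolding complex_normal_eq by (rule P.prob_space_distr) simp
qed

interpretation complex_normal: prob_space complex_normal
  by (rule prob_space_complex_normal)

lemma (in prob_space) expectation_cis_normal:
  assumes D: "distributed M lborel Y (normal_density \<mu> \<sigma>)" and s: "0 < \<sigma>"
  shows "expectation (\<lambda>\<omega>. cis (t * Y \<omega>)) = cis (t * \<mu>) * of_real (exp (- (\<sigma>\<^sup>2 * t\<^sup>2) / 2))"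
proof -
  let ?Z = "\<lambda>x. (Y x - \<mu>) / \<sigma>"
  have Z: "distributed M lborel ?Z std_normal_density"
    using D s by (simp add: normal_standard_normal_convert[symmetric])
  then have [measurable]: "?Z \<in> borel_measurable M" and dZ: "distr M lborel ?Z = std_normal_distribution"
    by (auto simp: distributed_def)
  have "expectation (\<lambda>\<omega>. cis (t * Y \<omega>)) = expectation (\<lambda>\<omega>. cis (t * \<mu>) * cis (t * \<sigma> * ?Z \<omega>))"
  proof (intro Bochner_Integration.integral_cong refl)
    fix x
    have "t * Y x = t * \<mu> + t * \<sigma> * ?Z x" using s by (simp add: field_simps)
    then show "cis (t * Y x) = cis (t * \<mu>) * cis (t * \<sigma> * ?Z x)" by (simp only: cis_mult)
  qed
  also have "\<dots> = cis (t * \<mu>) * expectation (\<lambda>\<omega>. cis (t * \<sigma> * ?Z \<omega>))" by simp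
  also have "expectation (\<lambda>\<omega>. cis (t * \<sigma> * ?Z \<omega>)) = (\<integral>x. cis (t * \<sigma> * x) \<partial>distr M lborel ?Z)"
    by (subst integral_distr) auto
  also have "\<dots> = char std_normal_distribution (t * \<sigma>)"
    unfolding dZ char_def by (intro Bochner_Integration.integral_cong) (auto simp: cis_conv_exp mult.commute)
  also have "\<dots> = of_real (exp (- (\<sigma>\<^sup>2 * t\<^sup>2) / 2))"
    by (simp add: char_std_normal_distribution power_mult_distrib mult.commute)
  finally show ?thesis .
qed

lemma half_var_normal_cis: "(\<integral>x. cis (t * x) \<partial>half_var_normal) = of_real (exp (- t\<^sup>2 / 4))"
proof -
  have "distributed half_var_normal lborel (\<lambda>x. x) (normal_density 0 (1 / sqrt 2))"
    by (auto simp: distributed_def half_var_normal_def distr_id2)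
  from half_var_normal.expectation_cis_normal[OF this, of t] show ?thesis by (simp add: power_divide)
qed

text \<open>\<open>Re (w * z)\<close> is a real Gaussian variable of variance
  \<open>(cmod w)\<^sup>2 / 2\<close>, whence the 4 in the exponent here and in all characteristic
  functions below.\<close>

lemma complex_normal_cis: "(\<integral>z. cis (Re (w * z)) \<partial>complex_normal) = of_real (exp (- (cmod w)\<^sup>2 / 4))"
proof -
  have int: "complex_integrable (half_var_normal \<Otimes>\<^sub>M half_var_normal) (\<lambda>(x, y). cis (Re w * x) * cis (- Im w * y))"
  proof -
    interpret pair_prob_space half_var_normal half_var_normal ..
    show ?thesis by (rule P.integrable_const_bound[of _ 1]) (auto simp: norm_mult)
  qed
  have "(\<integral>z. cis (Re (w * z)) \<partial>complex_normal) = (\<integral>p. (case p of (x, y) \<Rightarrow> cis (Re w * x) * cis (- Im w * y)) \<partial>(half_var_normal \<Otimes>\<^sub>M half_var_normal))"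
    unfolding complex_normal_eq by (subst integral_distr) (auto simp: case_prod_unfold cis_mult mult.commute intro!: Bochner_Integration.integral_cong)
  also have "\<dots> = (\<integral>x. \<integral>y. cis (Re w * x) * cis (- Im w * y) \<partial>half_var_normal \<partial>half_var_normal)"
    using half_var_normal_pair.integral_fst[OF int] by simp
  also have "\<dots> = of_real (exp (- (Re w)\<^sup>2 / 4)) * of_real (exp (- (Im w)\<^sup>2 / 4))"
    using half_var_normal_cis[of "Re w"] half_var_normal_cis[of "- Im w"] by simp
  also have "\<dots> = of_real (exp (- (cmod w)\<^sup>2 / 4))"
    by (simp add: cmod_power2 exp_add[symmetric] diff_divide_distrib flip: of_real_mult)
  finally show ?thesis .
qed

section \<open>Integrability of the logarithm under Gaussian laws\<close>

lemma nn_integral_abs_ln_finite: "(\<integral>\<^sup>+x\<in>{-1<..<1}. ennreal \<bar>ln \<bar>x\<bar>\<bar> \<partial>lborel) < \<infinity>"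
proof -
  define g where "g x = (if x \<in> {0..1} then x powr (-1/2) else 0)" for x :: real
  have g[measurable]: "g \<in> borel_measurable borel" unfolding g_def by measurable
  have "((\<lambda>x::real. x powr (-1/2)) has_integral (1 powr (-1/2 + 1) / (-1/2 + 1))) {0..1}"
    by (rule has_integral_powr_from_0) auto
  then have "(g has_integral 2) UNIV"
    unfolding g_def by (subst has_integral_restrict_UNIV) simp
  then have I: "(\<integral>\<^sup>+x. ennreal (g x) \<partial>lborel) = 2"
    by (subst nn_integral_has_integral_lborel) (auto simp: g_def)
  have I': "(\<integral>\<^sup>+x. ennreal (g (- x)) \<partial>lborel) = 2"
    unfolding I[symmetric] by (subst (2) lborel_distr_uminus[symmetric], subst nn_integral_distr) auto
  have le: "\<bar>ln x\<bar> \<le> 2 * x powr (-1/2)" if "0 < x" "x < 1" for x :: real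
  proof -
    \<comment> \<open>The inequality \<open>ln y < y\<close> at \<open>y = x powr (-1/2)\<close>,
      whose logarithm is half of \<open>\<bar>ln x\<bar>\<close>; this power is integrable at
      0.\<close>
    have "ln (x powr (-1/2)) \<le> x powr (-1/2)" using that by (intro less_imp_le ln_less_self) auto
    then show ?thesis using that by (simp add: ln_powr)
  qed
  have "(\<integral>\<^sup>+x\<in>{-1<..<1}. ennreal \<bar>ln \<bar>x\<bar>\<bar> \<partial>lborel) \<le> (\<integral>\<^sup>+x. 2 * (ennreal (g x) + ennreal (g (- x))) \<partial>lborel)"
  proof (rule nn_integral_mono)
    fix x :: real
    consider "x = 0" | "0 < x" "x < 1" | "-1 < x" "x < 0" | "x \<notin> {-1<..<1}" by fastforce
    then show "ennreal \<bar>ln \<bar>x\<bar>\<bar> * indicator {-1<..<1} x \<le> 2 * (ennreal (g x) + ennreal (g (- x)))"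
    proof cases
      case 2
      then have "ennreal \<bar>ln \<bar>x\<bar>\<bar> \<le> ennreal (2 * g x)" using le[of x] by (intro ennreal_leI) (auto simp: g_def)
      also have "\<dots> = 2 * ennreal (g x)" using 2 by (subst ennreal_mult) (auto simp: g_def)
      finally show ?thesis using 2 by (simp add: g_def)
    next
      case 3
      then have "ennreal \<bar>ln \<bar>x\<bar>\<bar> \<le> ennreal (2 * g (-x))" using le[of "-x"] by (intro ennreal_leI) (auto simp: g_def)
      also have "\<dots> = 2 * ennreal (g (-x))" using 3 by (subst ennreal_mult) (auto simp: g_def)
      finally show ?thesis using 3 by (simp add: g_def)
    qed auto
  qed
  also have "\<dots> = 2 * (2 + 2)" by (subst nn_integral_cmult, simp, subst nn_integral_add) (auto simp: I I')
  also have "\<dots> < \<infinity>" by (simp add: ennreal_mult_less_top)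
  finally show ?thesis .
qed

lemma integrable_half_var_normal_id: "integrable half_var_normal (\<lambda>x. x)"
  unfolding half_var_normal_def by (subst integrable_density) (auto intro: integrable_normal_moment_nz_1)

text \<open>On the unit interval the density is at most 1, which reduces to Lebesgue measure; beyond
  it the logarithm is dominated by \<open>\<bar>x\<bar>\<close>.\<close>

lemma integrable_ln_half_var_normal: "integrable half_var_normal (\<lambda>x. ln \<bar>x\<bar>)"
proof (rule integrableI_bounded)
  have ab: "(\<integral>\<^sup>+x. ennreal \<bar>x\<bar> \<partial>half_var_normal) < \<infinity>"
    using integrable_half_var_normal_id by (simp add: integrable_iff_bounded)
  have dens: "normal_density 0 (1 / sqrt 2) x \<le> 1" for x
  proof -
    have "normal_density 0 (1 / sqrt 2) x = exp (- x\<^sup>2) / sqrt pi" by (simp add: normal_density_def power_divide)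
    also have "\<dots> \<le> 1 / 1" using pi_gt3 by (intro frac_le) (auto simp: real_le_rsqrt)
    finally show ?thesis by simp
  qed
  have "(\<integral>\<^sup>+x. ennreal (norm (ln \<bar>x\<bar>)) \<partial>half_var_normal) \<le> (\<integral>\<^sup>+x. ennreal \<bar>ln \<bar>x\<bar>\<bar> * indicator {-1<..<1} x + ennreal \<bar>x\<bar> \<partial>half_var_normal)"
  proof (rule nn_integral_mono)
    fix x :: real
    show "ennreal (norm (ln \<bar>x\<bar>)) \<le> ennreal \<bar>ln \<bar>x\<bar>\<bar> * indicator {-1<..<1} x + ennreal \<bar>x\<bar>"
    proof (cases "x \<in> {-1<..<1}")
      case False
      then have "1 \<le> \<bar>x\<bar>" by auto
      then have "0 \<le> ln \<bar>x\<bar>" "ln \<bar>x\<bar> \<le> \<bar>x\<bar>" using ln_less_self[of "\<bar>x\<bar>"] by (simp, linarith)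
      then show ?thesis using False by (auto intro!: ennreal_leI)
    qed (auto intro!: add_increasing2)
  qed
  also have "\<dots> = (\<integral>\<^sup>+x. ennreal \<bar>ln \<bar>x\<bar>\<bar> * indicator {-1<..<1} x \<partial>half_var_normal) + (\<integral>\<^sup>+x. ennreal \<bar>x\<bar> \<partial>half_var_normal)"
    by (rule nn_integral_add) auto
  also have "(\<integral>\<^sup>+x. ennreal \<bar>ln \<bar>x\<bar>\<bar> * indicator {-1<..<1} x \<partial>half_var_normal) \<le> (\<integral>\<^sup>+x\<in>{-1<..<1}. ennreal \<bar>ln \<bar>x\<bar>\<bar> \<partial>lborel)"
    unfolding half_var_normal_def
  proof (subst nn_integral_density)
    have "ennreal (normal_density 0 (1 / sqrt 2) x) * u \<le> u" for x u
      using mult_right_mono[of "ennreal (normal_density 0 (1 / sqrt 2) x)" 1 u] dens[of x] by (simp add: ennreal_le_1)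
    then show "(\<integral>\<^sup>+x. ennreal (normal_density 0 (1 / sqrt 2) x) * (ennreal \<bar>ln \<bar>x\<bar>\<bar> * indicator {-1<..<1} x) \<partial>lborel)
        \<le> (\<integral>\<^sup>+x\<in>{-1<..<1}. ennreal \<bar>ln \<bar>x\<bar>\<bar> \<partial>lborel)"
      by (intro nn_integral_mono)
  qed auto
  finally show "(\<integral>\<^sup>+x. ennreal (norm (ln \<bar>x\<bar>)) \<partial>half_var_normal) < \<infinity>"
    using ab nn_integral_abs_ln_finite by (auto intro: le_less_trans simp: ennreal_add_less_top)
qed simp

text \<open>For \<open>z\<close> with parts \<open>x\<close> and \<open>y\<close> the modulus lies
  between \<open>\<bar>x\<bar>\<close> and \<open>\<bar>x\<bar> + \<bar>y\<bar>\<close>. So only the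
  singularity of the real part counts, and the planar integral reduces to one-dimensional
  ones.\<close>

lemma integrable_ln_complex_normal: "integrable complex_normal (\<lambda>z. ln (cmod z))"
proof -
  interpret pair_prob_space half_var_normal half_var_normal ..
  have i1: "integrable (half_var_normal \<Otimes>\<^sub>M half_var_normal) (\<lambda>p. g (fst p))" if "integrable half_var_normal g" for g :: "real \<Rightarrow> real"
  proof -
    have "distr (half_var_normal \<Otimes>\<^sub>M half_var_normal) half_var_normal fst = half_var_normal"
      by (rule half_var_normal.distr_pair_fst)
    then show ?thesis using that by (metis integrable_distr measurable_fst)
  qed
  have i2: "integrable (half_var_normal \<Otimes>\<^sub>M half_var_normal) (\<lambda>p. g (snd p))" if "integrable half_var_normal g" for g :: "real \<Rightarrow> real"
    using half_var_normal_pair.integrable_product_swap[OF i1[OF that]] by (simp add: case_prod_unfold)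
  have n0: "AE p in half_var_normal \<Otimes>\<^sub>M half_var_normal. fst p \<noteq> 0"
  proof -
    have "AE x in half_var_normal. x \<noteq> 0"
      unfolding half_var_normal_def by (subst AE_density) (auto intro: AE_mp[OF AE_lborel_singleton])
    then have "AE x in distr (half_var_normal \<Otimes>\<^sub>M half_var_normal) half_var_normal fst. x \<noteq> 0"
      by (subst half_var_normal.distr_pair_fst)
    then show ?thesis by (subst (asm) AE_distr_iff) auto
  qed
  have "integrable (half_var_normal \<Otimes>\<^sub>M half_var_normal) (\<lambda>p. ln (cmod (of_real (fst p) + \<i> * of_real (snd p))))"
  proof (rule Bochner_Integration.integrable_bound)
    show "integrable (half_var_normal \<Otimes>\<^sub>M half_var_normal) (\<lambda>p. \<bar>ln \<bar>fst p\<bar>\<bar> + \<bar>fst p\<bar> + \<bar>snd p\<bar>)"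
      by (intro Bochner_Integration.integrable_add i1 i2 integrable_abs integrable_ln_half_var_normal integrable_half_var_normal_id)
    show "AE p in half_var_normal \<Otimes>\<^sub>M half_var_normal. norm (ln (cmod (of_real (fst p) + \<i> * of_real (snd p)))) \<le> norm (\<bar>ln \<bar>fst p\<bar>\<bar> + \<bar>fst p\<bar> + \<bar>snd p\<bar>)"
      using n0
    proof eventually_elim
      case (elim p)
      obtain x y where p: "p = (x, y)" by (cases p)
      let ?z = "complex_of_real x + \<i> * complex_of_real y"
      have x0: "x \<noteq> 0" using elim p by simp
      have lb: "\<bar>x\<bar> \<le> cmod ?z" using abs_Re_le_cmod[of ?z] by simp
      have ub: "cmod ?z \<le> \<bar>x\<bar> + \<bar>y\<bar>" using norm_triangle_ineq[of "complex_of_real x" "\<i> * complex_of_real y"] by (simp add: norm_mult)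
      have "ln \<bar>x\<bar> \<le> ln (cmod ?z)" using lb x0 by (intro ln_mono) auto
      moreover have "ln (cmod ?z) \<le> \<bar>x\<bar> + \<bar>y\<bar>"
        using ln_less_self[of "cmod ?z"] lb ub x0 by linarith
      ultimately have "\<bar>ln (cmod ?z)\<bar> \<le> \<bar>ln \<bar>x\<bar>\<bar> + \<bar>x\<bar> + \<bar>y\<bar>" by linarith
      then show ?case by (simp add: p)
    qed
  qed simp
  then show ?thesis unfolding complex_normal_eq
    by (subst integrable_distr_eq) (auto simp: split_beta)
qed

lemma AE_complex_normal_nonzero: "AE z in complex_normal. z \<noteq> 0"
  unfolding complex_normal_def by (subst AE_density) (auto intro: AE_mp[OF AE_lborel_singleton])

text \<open>A single variable is treated as a process indexed by the one-point type
  \<open>unit\<close>.\<close>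

lemma complex_law_eqI:
  assumes "prob_space P" "prob_space Q" and [measurable]: "X \<in> borel_measurable P" "Y \<in> borel_measurable Q"
    and eq: "\<And>w. (\<integral>x. cis (Re (w * X x)) \<partial>P) = (\<integral>x. cis (Re (w * Y x)) \<partial>Q)"
  shows "distr P borel X = distr Q borel Y"
proof -
  have e: "process_law P (\<lambda>_::unit. X) = process_law Q (\<lambda>_::unit. Y)"
  proof (rule complex_process_law_unique[OF assms(1,2)])
    fix c :: "unit \<Rightarrow> complex" and J :: "unit set"
    show "(\<integral>x. cis (Re (\<Sum>j\<in>J. c j * X x)) \<partial>P) = (\<integral>x. cis (Re (\<Sum>j\<in>J. c j * Y x)) \<partial>Q)"
      using eq[of "\<Sum>j\<in>J. c j"] by (simp add: sum_distrib_right)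
  qed auto
  have "distr (process_law R (\<lambda>_::unit. Z)) borel (\<lambda>f. f ()) = distr R borel Z" if [measurable]: "Z \<in> borel_measurable R"
    for R :: "'c measure" and Z :: "'c \<Rightarrow> complex"
    unfolding process_law_def by (subst distr_distr) (auto simp: o_def intro!: measurable_PiM_single')
  from this[of X P] this[of Y Q] e show ?thesis by simp
qed

section \<open>Mollified sums over zeros\<close>

text \<open>The condition at 0 excludes the zero function and allows Jensen's formula to be centred
  at 0. Almost every path of a Gaussian series satisfies both conditions.\<close>

definition admissible :: "(complex \<Rightarrow> complex) \<Rightarrow> bool" where
  "admissible F \<longleftrightarrow> F holomorphic_on ball 0 1 \<and> F 0 \<noteq> 0"

text \<open>Zeros may accumulate at the unit circle. Summing only where \<phi> is nonzero keeps the
  index set finite when \<phi> is supported in a smaller disc; a sum over an infinite set would be 0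
  by default.\<close>

definition zero_sum :: "(complex \<Rightarrow> complex) \<Rightarrow> (complex \<Rightarrow> real) \<Rightarrow> real" where
  "zero_sum F \<phi> = (\<Sum>p\<in>{p \<in> ball 0 1. F p = 0 \<and> \<phi> p \<noteq> 0}. real (nat (zorder F p)) * \<phi> p)"

definition log_mod_excess :: "real \<Rightarrow> (complex \<Rightarrow> complex) \<Rightarrow> complex \<Rightarrow> real" where
  "log_mod_excess r F a = (\<integral>\<theta>. ln (cmod (F (a + of_real r * cis \<theta>))) \<partial>circ) - ln (cmod (F a))"

definition test_fun :: "real \<Rightarrow> (complex \<Rightarrow> real) \<Rightarrow> bool" where
  "test_fun \<rho> \<phi> \<longleftrightarrow> 0 \<le> \<rho> \<and> \<rho> < 1 \<and> continuous_on UNIV \<phi> \<and> (\<forall>p. 0 \<le> \<phi> p) \<and> (\<forall>p. \<phi> p \<noteq> 0 \<longrightarrow> cmod p \<le> \<rho>)"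

lemma admissible_finite_zeros:
  assumes "admissible F" "\<rho> < 1"
  shows "finite {p \<in> cball 0 \<rho>. F p = 0}"
proof (cases "0 < \<rho>")
  case True
  then show ?thesis using jensen_formula(1)[of F 0 1 \<rho>] assms by (auto simp: admissible_def)
next
  case False
  have "{p \<in> cball 0 \<rho>. F p = 0} \<subseteq> {0}"
  proof
    fix p assume "p \<in> {p \<in> cball 0 \<rho>. F p = 0}"
    then have "cmod p \<le> \<rho>" by simp
    then have "cmod p \<le> 0" using False by linarith
    then show "p \<in> {0}" by simp
  qed
  then show ?thesis using finite_subset by blast
qed

lemma zero_sum_eq:
  assumes "admissible F" "\<rho> < 1" "\<And>p. \<phi> p \<noteq> 0 \<Longrightarrow> cmod p \<le> \<rho>"
  shows "zero_sum F \<phi> = (\<Sum>p\<in>{p \<in> cball 0 \<rho>. F p = 0}. real (nat (zorder F p)) * \<phi> p)"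
  unfolding zero_sum_def using admissible_finite_zeros[OF assms(1,2)] assms(2,3)
  by (intro sum.mono_neutral_left) (auto intro: le_less_trans)

text \<open>Jensen's formula in the largest disc about \<open>a\<close> inside the unit disc, with
  the zeros regrouped in a disc about 0.\<close>

lemma log_mod_excess_eq_zero_sum:
  assumes F: "admissible F" and r: "0 < r" and a: "cmod a + r < 1" "F a \<noteq> 0"
  shows "log_mod_excess r F a = zero_sum F (\<lambda>p. log_kernel r (p - a))"
proof -
  have sub: "ball a (1 - cmod a) \<subseteq> ball 0 1"
  proof
    fix z assume "z \<in> ball a (1 - cmod a)"
    then show "z \<in> ball 0 1" using norm_triangle_ineq[of a "z - a"] by (simp add: dist_norm norm_minus_commute)
  qed
  then have hol: "F holomorphic_on ball a (1 - cmod a)" using F by (auto simp: admissible_def intro: holomorphic_on_subset)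
  have s: "cmod p \<le> cmod a + r" if "cmod (p - a) \<le> r" for p
    using that norm_triangle_ineq[of a "p - a"] by simp
  have k: "log_kernel r (p - a) \<noteq> 0 \<Longrightarrow> cmod (p - a) \<le> r" for p
    using log_kernel_eq_0[OF r, of "p - a"] by linarith
  have "log_mod_excess r F a = (\<Sum>p\<in>{p \<in> cball a r. F p = 0}. real (nat (zorder F p)) * log_kernel r (p - a))"
    unfolding log_mod_excess_def using jensen_formula(3)[OF hol r _ a(2)] a by simp
  also have "\<dots> = (\<Sum>p\<in>{p \<in> cball 0 (cmod a + r). F p = 0}. real (nat (zorder F p)) * log_kernel r (p - a))"
    using admissible_finite_zeros[OF F a(1)] k s
    by (intro sum.mono_neutral_left) (auto simp: dist_norm norm_minus_commute)
  also have "\<dots> = zero_sum F (\<lambda>p. log_kernel r (p - a))"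
    by (rule zero_sum_eq[symmetric, OF F a(1)]) (use k s in auto)
  finally show ?thesis .
qed

lemma zero_sum_nonneg: "(\<And>p. 0 \<le> \<phi> p) \<Longrightarrow> 0 \<le> zero_sum F \<phi>"
  unfolding zero_sum_def by (intro sum_nonneg) auto

lemma zero_sum_mono:
  assumes "admissible F" "\<rho> < 1" "\<And>p. \<phi> p \<noteq> 0 \<Longrightarrow> cmod p \<le> \<rho>" "\<And>p. \<psi> p \<noteq> 0 \<Longrightarrow> cmod p \<le> \<rho>"
    and le: "\<And>p. p \<in> ball 0 1 \<Longrightarrow> F p = 0 \<Longrightarrow> \<phi> p \<le> \<psi> p"
  shows "zero_sum F \<phi> \<le> zero_sum F \<psi>"
  using zero_sum_eq[OF assms(1-3)] zero_sum_eq[OF assms(1,2,4)] le \<open>\<rho> < 1\<close> by (auto intro!: sum_mono mult_left_mono)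

lemma zero_sum_add:
  assumes "admissible F" "\<rho> < 1" "\<And>p. \<phi> p \<noteq> 0 \<Longrightarrow> cmod p \<le> \<rho>" "\<And>p. \<psi> p \<noteq> 0 \<Longrightarrow> cmod p \<le> \<rho>"
  shows "zero_sum F (\<lambda>p. \<phi> p + \<psi> p) = zero_sum F \<phi> + zero_sum F \<psi>"
proof -
  have "zero_sum F (\<lambda>p. \<phi> p + \<psi> p) = (\<Sum>p\<in>{p \<in> cball 0 \<rho>. F p = 0}. real (nat (zorder F p)) * (\<phi> p + \<psi> p))"
    by (rule zero_sum_eq[OF assms(1,2)]) (metis add_0 assms(3,4))
  then show ?thesis using zero_sum_eq[OF assms(1-3)] zero_sum_eq[OF assms(1,2,4)] by (simp add: ring_distribs sum.distrib)
qed

lemma zero_sum_cmult: "zero_sum F (\<lambda>p. c * \<phi> p) = c * zero_sum F \<phi>"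
  by (cases "c = 0") (auto simp: zero_sum_def sum_distrib_left ac_simps)

text \<open>All functions are eventually supported in one disc with finitely many zeros of
  \<open>F\<close>, so pointwise convergence at those zeros is enough.\<close>

lemma zero_sum_tendsto:
  assumes F: "admissible F" "\<rho> < 1" and s: "\<forall>\<^sub>F n in net. \<forall>p. \<phi> n p \<noteq> 0 \<longrightarrow> cmod p \<le> \<rho>" "\<And>p. \<psi> p \<noteq> 0 \<Longrightarrow> cmod p \<le> \<rho>"
    and l: "\<And>p. p \<in> ball 0 1 \<Longrightarrow> F p = 0 \<Longrightarrow> ((\<lambda>n. \<phi> n p) \<longlongrightarrow> \<psi> p) net"
  shows "((\<lambda>n. zero_sum F (\<phi> n)) \<longlongrightarrow> zero_sum F \<psi>) net"
proof -
  have e: "zero_sum F \<psi> = (\<Sum>p\<in>{p \<in> cball 0 \<rho>. F p = 0}. real (nat (zorder F p)) * \<psi> p)"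
    by (rule zero_sum_eq[OF F s(2)])
  have "((\<lambda>n. \<Sum>p\<in>{p \<in> cball 0 \<rho>. F p = 0}. real (nat (zorder F p)) * \<phi> n p) \<longlongrightarrow> zero_sum F \<psi>) net"
    unfolding e using F(2) by (intro tendsto_intros l) auto
  moreover have "\<forall>\<^sub>F n in net. (\<Sum>p\<in>{p \<in> cball 0 \<rho>. F p = 0}. real (nat (zorder F p)) * \<phi> n p) = zero_sum F (\<phi> n)"
    using s(1) by eventually_elim (rule zero_sum_eq[symmetric, OF F], auto)
  ultimately show ?thesis by (rule Lim_transform_eventually)
qed

section \<open>The logarithmic kernel as an approximate identity\<close>

lemma borel_measurable_log_kernel [measurable]: "log_kernel r \<in> borel_measurable borel"
  unfolding log_kernel_def by measurable

lemma integrable_log_kernel: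
  assumes r: "0 < r" "r \<le> 1"
  shows "integrable lborel (log_kernel r)"
proof (rule integrableI_bounded)
  \<comment> \<open>The comparison reuses the integrability of \<open>ln (cmod z)\<close> under
    \<open>complex_normal\<close>. The factor \<open>pi * exp 1\<close> compensates for the Gaussian
    density, which is at least \<open>exp (-1) / pi\<close> on the unit disc.\<close>
  have "(\<integral>\<^sup>+z. ennreal (norm (log_kernel r z)) \<partial>lborel) \<le> (\<integral>\<^sup>+z. ennreal (exp (- (cmod z)\<^sup>2) / pi) * ennreal (pi * exp 1 * \<bar>ln (cmod z)\<bar>) \<partial>lborel)"
  proof (rule nn_integral_mono)
    fix z :: complex
    show "ennreal (norm (log_kernel r z)) \<le> ennreal (exp (- (cmod z)\<^sup>2) / pi) * ennreal (pi * exp 1 * \<bar>ln (cmod z)\<bar>)"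
    proof (cases "z = 0 \<or> r \<le> cmod z")
      case True
      then show ?thesis using r by (auto simp: log_kernel_eq_0) (simp add: log_kernel_def)
    next
      case False
      then have z: "0 < cmod z" "cmod z \<le> r" by auto
      have "log_kernel r z = ln r - ln (cmod z)" using z r by (intro log_kernel_eq) auto
      also have "\<dots> \<le> 1 * \<bar>ln (cmod z)\<bar>" using r ln_le_zero_iff[of r] by linarith
      also have "\<dots> \<le> exp (1 - (cmod z)\<^sup>2) * \<bar>ln (cmod z)\<bar>"
        using z r by (intro mult_right_mono) (auto simp: power_le_one)
      also have "\<dots> = exp (- (cmod z)\<^sup>2) / pi * (pi * exp 1 * \<bar>ln (cmod z)\<bar>)"
        by (simp add: exp_diff exp_minus field_simps)
      finally show ?thesis by (subst ennreal_mult[symmetric]) (auto intro!: ennreal_leI)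
    qed
  qed
  also have "\<dots> = (\<integral>\<^sup>+z. ennreal (norm (pi * exp 1 * ln (cmod z))) \<partial>complex_normal)"
    unfolding complex_normal_def by (subst nn_integral_density) (auto simp: abs_mult)
  also have "\<dots> < \<infinity>"
    using integrable_mult_right[OF integrable_ln_complex_normal, of "pi * exp 1"] unfolding integrable_iff_bounded by auto
  finally show "(\<integral>\<^sup>+z. ennreal (norm (log_kernel r z)) \<partial>lborel) < \<infinity>" .
qed simp

definition kernel_mass :: "real \<Rightarrow> real" where
  "kernel_mass r = (\<integral>z. log_kernel r z \<partial>lborel)"

lemma kernel_mass_pos:
  assumes r: "0 < r" "r \<le> 1"
  shows "0 < kernel_mass r"
proof -
  \<comment> \<open>A ball that avoids 0 and stays within distance \<open>r / 2\<close> of it, so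
    that the kernel is at least \<open>ln 2\<close> there.\<close>
  let ?B = "ball (of_real (r / 4)) (r / 8) :: complex set"
  have le: "ln 2 * indicator ?B z \<le> log_kernel r z" for z
  proof (cases "z \<in> ?B")
    case True
    have "cmod z \<le> r / 2" "0 < cmod z"
      using True r norm_triangle_ineq2[of z "of_real (r / 4)"] norm_triangle_ineq2[of "of_real (r / 4)" z]
      by (auto simp: dist_norm norm_minus_commute simp del: of_real_divide)
    then have "2 \<le> r / cmod z" by (simp add: field_simps)
    then have "ln 2 \<le> ln (r / cmod z)" by (intro ln_mono) auto
    then show ?thesis using True by (simp add: log_kernel_def)
  qed auto
  have "0 < ln 2 * measure lborel ?B" using r by (simp add: content_ball_pos)
  also have "\<dots> = (\<integral>z. ln 2 * indicator ?B z \<partial>lborel)" by simp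
  also have "\<dots> \<le> kernel_mass r" unfolding kernel_mass_def
    using le by (intro integral_mono integrable_log_kernel r) (auto intro!: integrable_real_indicator emeasure_lborel_ball_finite)
  finally show ?thesis .
qed

lemma lborel_reflect: "distr lborel borel (\<lambda>a. p - a) = (lborel :: complex measure)"
proof (rule lborel_eqI[symmetric])
  fix l u :: complex
  assume lu: "\<And>b. b \<in> Basis \<Longrightarrow> l \<bullet> b \<le> u \<bullet> b"
  have "(\<lambda>a. p - a) -` box l u = box (p - u) (p - l)"
    by (auto simp: box_def inner_diff_left)
  then have "emeasure (distr lborel borel (\<lambda>a. p - a)) (box l u) = emeasure lborel (box (p - u) (p - l))"
    by (subst emeasure_distr) auto
  also have "\<dots> = ennreal (\<Prod>b\<in>Basis. (u - l) \<bullet> b)"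
    using lu by (subst emeasure_lborel_box) (auto simp: inner_diff_left)
  finally show "emeasure (distr lborel borel (\<lambda>a. p - a)) (box l u) = ennreal (\<Prod>b\<in>Basis. (u - l) \<bullet> b)" .
qed simp

lemma log_kernel_reflect:
  assumes "0 < r" "r \<le> 1"
  shows "integrable lborel (\<lambda>a. log_kernel r (p - a))" "(\<integral>a. log_kernel r (p - a) \<partial>lborel) = kernel_mass r"
proof -
  have "integrable (distr lborel borel (\<lambda>a. p - a)) (log_kernel r)"
    unfolding lborel_reflect by (rule integrable_log_kernel[OF assms])
  then show "integrable lborel (\<lambda>a. log_kernel r (p - a))"
    by (subst (asm) integrable_distr_eq) auto
  show "(\<integral>a. log_kernel r (p - a) \<partial>lborel) = kernel_mass r"
    unfolding kernel_mass_def by (subst (2) lborel_reflect[of p, symmetric], subst integral_distr) auto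
qed

text \<open>By Jensen's formula the sum of \<open>mollify r \<phi>\<close> over the zeros is an integral of \<open>ln (cmod F)\<close> against an explicit
  kernel, and \<open>mollify r \<phi>\<close> tends to \<open>\<phi>\<close> as \<open>r\<close> tends to 0. The junk value \<open>log_kernel r 0 = 0\<close> only matters
  on a null set of centres.\<close>

definition mollify :: "real \<Rightarrow> (complex \<Rightarrow> real) \<Rightarrow> complex \<Rightarrow> real" where
  "mollify r \<phi> p = (\<integral>a. \<phi> a * log_kernel r (p - a) \<partial>lborel) / kernel_mass r"

lemma test_fun_bounded:
  assumes "test_fun \<rho> \<phi>"
  obtains B where "0 < B" "\<And>p. \<phi> p \<le> B"
proof -
  have "compact (\<phi> ` cball 0 \<rho>)"
    using assms by (intro compact_continuous_image) (auto simp: test_fun_def intro: continuous_on_subset)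
  from compact_imp_bounded[OF this] obtain B where "\<forall>x\<in>\<phi> ` cball 0 \<rho>. norm x \<le> B"
    unfolding bounded_iff by blast
  then have B: "\<And>p. p \<in> cball 0 \<rho> \<Longrightarrow> norm (\<phi> p) \<le> B" by blast
  have "\<phi> p \<le> \<bar>B\<bar> + 1" for p
    using B[of p] assms by (cases "\<phi> p = 0") (auto simp: test_fun_def)
  then show ?thesis using that[of "\<bar>B\<bar> + 1"] by auto
qed

lemma test_fun_measurable: "test_fun \<rho> \<phi> \<Longrightarrow> \<phi> \<in> borel_measurable borel"
  by (auto simp: test_fun_def intro: borel_measurable_continuous_onI)

lemma integrable_test_fun_log_kernel:
  assumes t: "test_fun \<rho> \<phi>" and r: "0 < r" "r \<le> 1"
  shows "integrable lborel (\<lambda>a. \<phi> a * log_kernel r (p - a))"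
proof -
  obtain B where B: "0 < B" "\<And>p. \<phi> p \<le> B" using test_fun_bounded[OF t] by blast
  note [measurable] = test_fun_measurable[OF t]
  show ?thesis
  proof (rule Bochner_Integration.integrable_bound)
    show "integrable lborel (\<lambda>a. B * log_kernel r (p - a))" using log_kernel_reflect(1)[OF r] by simp
    show "AE a in lborel. norm (\<phi> a * log_kernel r (p - a)) \<le> norm (B * log_kernel r (p - a))"
      using B t by (intro AE_I2) (auto simp: abs_mult test_fun_def intro!: mult_right_mono)
  qed simp
qed

lemma mollify_nonneg:
  assumes "test_fun \<rho> \<phi>" "0 < r" "r \<le> 1"
  shows "0 \<le> mollify r \<phi> p"
  unfolding mollify_def using assms kernel_mass_pos[of r]
  by (intro divide_nonneg_pos Bochner_Integration.integral_nonneg) (auto simp: test_fun_def)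

lemma mollify_support:
  assumes t: "test_fun \<rho> \<phi>" and r: "0 < r" and p: "mollify r \<phi> p \<noteq> 0"
  shows "cmod p \<le> \<rho> + r"
proof (rule ccontr)
  assume n: "\<not> cmod p \<le> \<rho> + r"
  have "\<phi> a * log_kernel r (p - a) = 0" for a
  proof (cases "\<phi> a = 0")
    case False
    then have "cmod a \<le> \<rho>" using t by (auto simp: test_fun_def)
    then have "r \<le> cmod (p - a)" using n norm_triangle_ineq2[of p a] by linarith
    then show ?thesis using r by (simp add: log_kernel_eq_0)
  qed simp
  then have "(\<integral>a. \<phi> a * log_kernel r (p - a) \<partial>lborel) = 0" by (simp only: integral_zero)
  then show False using p by (simp add: mollify_def)
qed

text \<open>\<open>mollify r \<phi> p\<close> is a weighted average of \<phi> over the disc of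
  radius \<open>r\<close> about \<open>p\<close>, so it differs from \<open>\<phi> p\<close> by at
  most the oscillation of \<phi> there.\<close>

lemma mollify_approx:
  assumes t: "test_fun \<rho> \<phi>" and r: "0 < r" "r \<le> 1" and e: "\<And>a. cmod (a - p) < r \<Longrightarrow> \<bar>\<phi> a - \<phi> p\<bar> \<le> \<epsilon>"
  shows "\<bar>mollify r \<phi> p - \<phi> p\<bar> \<le> \<epsilon>"
proof -
  note c = kernel_mass_pos[OF r]
  note i1 = integrable_test_fun_log_kernel[OF t r, of p] and i2 = log_kernel_reflect[OF r, of p]
  have "(mollify r \<phi> p - \<phi> p) * kernel_mass r = (\<integral>a. \<phi> a * log_kernel r (p - a) \<partial>lborel) - \<phi> p * (\<integral>a. log_kernel r (p - a) \<partial>lborel)"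
    using c by (simp add: mollify_def i2 field_simps)
  also have "\<dots> = (\<integral>a. (\<phi> a - \<phi> p) * log_kernel r (p - a) \<partial>lborel)"
    using i1 i2(1) by (simp add: left_diff_distrib)
  finally have "\<bar>mollify r \<phi> p - \<phi> p\<bar> * kernel_mass r = \<bar>\<integral>a. (\<phi> a - \<phi> p) * log_kernel r (p - a) \<partial>lborel\<bar>"
    using c by (metis abs_mult abs_of_pos)
  also have "\<dots> \<le> (\<integral>a. \<bar>(\<phi> a - \<phi> p) * log_kernel r (p - a)\<bar> \<partial>lborel)" by (rule integral_abs_bound)
  also have "\<dots> \<le> (\<integral>a. \<epsilon> * log_kernel r (p - a) \<partial>lborel)"
  proof (rule integral_mono)
    show "integrable lborel (\<lambda>a. \<bar>(\<phi> a - \<phi> p) * log_kernel r (p - a)\<bar>)"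
      using i1 i2(1) by (auto simp: left_diff_distrib)
    show "integrable lborel (\<lambda>a. \<epsilon> * log_kernel r (p - a))" using i2(1) by simp
    fix a
    show "\<bar>(\<phi> a - \<phi> p) * log_kernel r (p - a)\<bar> \<le> \<epsilon> * log_kernel r (p - a)"
    proof (cases "cmod (a - p) < r")
      case True
      then show ?thesis using e[OF True] by (auto simp: abs_mult intro!: mult_right_mono)
    next
      case False
      then have "log_kernel r (p - a) = 0" using r by (intro log_kernel_eq_0) (auto simp: norm_minus_commute)
      then show ?thesis by simp
    qed
  qed
  also have "\<dots> = \<epsilon> * kernel_mass r" using i2 by simp
  finally show ?thesis using c by simp
qed

text \<open>Jensen's formula holds at every centre that is not a zero. Exchanging the finite sum
  over zeros with the area integral over centres turns each kernel into a mollification. The left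
  side is visibly measurable in the random parameter once \<open>F\<close> is random.\<close>

lemma nn_integral_log_mod_excess:
  assumes F: "admissible F" and t: "test_fun \<rho> \<phi>" and r: "0 < r" "\<rho> + r < 1"
  shows "(\<integral>\<^sup>+a. ennreal (\<phi> a * log_mod_excess r F a) \<partial>lborel) = ennreal (kernel_mass r * zero_sum F (mollify r \<phi>))"
proof -
  have r1: "r \<le> 1" using r t by (auto simp: test_fun_def)
  note [measurable] = test_fun_measurable[OF t]
  let ?Z = "{p \<in> cball 0 (\<rho> + r). F p = 0}"
  let ?m = "\<lambda>p. real (nat (zorder F p))"
  have zs: "zero_sum F (mollify r \<phi>) = (\<Sum>p\<in>?Z. ?m p * mollify r \<phi> p)"
    by (rule zero_sum_eq[OF F r(2)]) (rule mollify_support[OF t r(1)])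
  have fin: "finite ?Z" by (rule admissible_finite_zeros[OF F r(2)])
  have "finite {p \<in> cball 0 \<rho>. F p = 0}" using admissible_finite_zeros[OF F, of \<rho>] r by simp
  then have "{p \<in> cball 0 \<rho>. F p = 0} \<in> null_sets lborel" by (intro countable_imp_null_set_lborel countable_finite)
  then have "AE a in lborel. a \<notin> {p \<in> cball 0 \<rho>. F p = 0}" by (rule AE_not_in)
  then have AE: "AE a in lborel. ennreal (\<phi> a * log_mod_excess r F a) = (\<Sum>p\<in>?Z. ennreal (?m p) * ennreal (\<phi> a * log_kernel r (p - a)))"
  proof eventually_elim
    case (elim a)
    show ?case
    proof (cases "\<phi> a = 0")
      case False
      then have a: "cmod a \<le> \<rho>" using t by (auto simp: test_fun_def)
      then have "F a \<noteq> 0" using elim by auto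
      then have "log_mod_excess r F a = zero_sum F (\<lambda>p. log_kernel r (p - a))" using a r by (intro log_mod_excess_eq_zero_sum[OF F]) auto
      also have "\<dots> = (\<Sum>p\<in>?Z. ?m p * log_kernel r (p - a))"
      proof (rule zero_sum_eq[OF F r(2)])
        fix p assume "log_kernel r (p - a) \<noteq> 0"
        then have "cmod (p - a) \<le> r" using log_kernel_eq_0[OF r(1), of "p - a"] by linarith
        then show "cmod p \<le> \<rho> + r" using a norm_triangle_ineq[of a "p - a"] by simp
      qed
      finally have "\<phi> a * log_mod_excess r F a = (\<Sum>p\<in>?Z. ?m p * (\<phi> a * log_kernel r (p - a)))"
        by (simp add: sum_distrib_left ac_simps)
      then have "ennreal (\<phi> a * log_mod_excess r F a) = (\<Sum>p\<in>?Z. ennreal (?m p * (\<phi> a * log_kernel r (p - a))))"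
        using t by (simp add: sum_ennreal test_fun_def)
      then show ?thesis using t by (simp add: ennreal_mult test_fun_def)
    qed auto
  qed
  have "(\<integral>\<^sup>+a. ennreal (\<phi> a * log_mod_excess r F a) \<partial>lborel) = (\<integral>\<^sup>+a. (\<Sum>p\<in>?Z. ennreal (?m p) * ennreal (\<phi> a * log_kernel r (p - a))) \<partial>lborel)"
    by (rule nn_integral_cong_AE[OF AE])
  also have "\<dots> = (\<Sum>p\<in>?Z. ennreal (?m p) * (\<integral>\<^sup>+a. ennreal (\<phi> a * log_kernel r (p - a)) \<partial>lborel))"
    by (subst nn_integral_sum) (auto simp: nn_integral_cmult)
  also have "\<dots> = (\<Sum>p\<in>?Z. ennreal (?m p) * ennreal (kernel_mass r * mollify r \<phi> p))"
    using kernel_mass_pos[OF r(1) r1] t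
    by (intro sum.cong refl, subst nn_integral_eq_integral[OF integrable_test_fun_log_kernel[OF t r(1) r1]]) (auto simp: mollify_def test_fun_def)
  also have "\<dots> = (\<Sum>p\<in>?Z. ennreal (kernel_mass r * (?m p * mollify r \<phi> p)))"
    using kernel_mass_pos[OF r(1) r1] mollify_nonneg[OF t r(1) r1] by (simp add: ennreal_mult ac_simps)
  also have "\<dots> = ennreal (kernel_mass r * zero_sum F (mollify r \<phi>))"
    unfolding zs using kernel_mass_pos[OF r(1) r1] mollify_nonneg[OF t r(1) r1] by (subst sum_ennreal) (auto simp: sum_distrib_left)
  finally show ?thesis .
qed

section \<open>Gaussian power series\<close>

text \<open>The derivative-free substitute for the Laplacian of \<open>ln V\<close>: positive for
  subharmonic behaviour, negative for superharmonic, zero for harmonic.\<close>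

definition log_excess :: "(complex \<Rightarrow> real) \<Rightarrow> complex \<Rightarrow> real \<Rightarrow> real" where
  "log_excess V a r = (\<integral>\<theta>. ln (V (a + of_real r * cis \<theta>)) \<partial>circ) - ln (V a)"

lemma borel_measurable_random_series [measurable (raw)]:
  assumes "\<And>k. X k \<in> borel_measurable M" and [measurable]: "g \<in> measurable N M" "h \<in> borel_measurable N"
  shows "(\<lambda>x. random_series X (g x) (h x)) \<in> borel_measurable N"
proof -
  have [measurable]: "(\<lambda>x. X k (g x)) \<in> borel_measurable N" for k
    using assms(1)[of k] by measurable
  show ?thesis unfolding random_series_def by measurable
qed

text \<open>The radii \<open>n / (n + 1)\<close> exhaust the disc. A countable family of conditions
  can hold almost surely at once, and it covers all \<open>z\<close> simultaneously.\<close>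

lemma random_series_holomorphic:
  assumes "\<And>n. summable (\<lambda>k. cmod (X k \<omega>) * (real n / (real n + 1)) ^ k)"
  shows "random_series X \<omega> holomorphic_on ball 0 1"
    "\<And>z. z \<in> ball 0 1 \<Longrightarrow> (\<lambda>k. X k \<omega> * z ^ k) sums random_series X \<omega> z"
proof -
  have *: "summable (\<lambda>k. X k \<omega> * (of_real r) ^ k)" if "r = real n / (real n + 1)" for n r
  proof (rule summable_norm_cancel)
    have "0 \<le> r" using that by simp
    then have "norm (X k \<omega> * (of_real r) ^ k) = cmod (X k \<omega>) * r ^ k" for k
      by (simp add: norm_mult norm_power)
    then show "summable (\<lambda>k. norm (X k \<omega> * (of_real r) ^ k))" using assms[of n] that by simp
  qed
  have ex: "\<exists>n. cmod z < real n / (real n + 1)" if "z \<in> ball 0 1" for z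
  proof -
    have "(\<lambda>n. real n / (real n + 1)) \<longlonglongrightarrow> 1" by real_asymp
    then have "\<forall>\<^sub>F n in sequentially. cmod z < real n / (real n + 1)"
      using that by (intro order_tendstoD(1)) auto
    then show ?thesis by (auto simp: eventually_sequentially)
  qed
  have D: "(\<lambda>k. X k \<omega> * z ^ k) sums random_series X \<omega> z \<and> random_series X \<omega> field_differentiable at z" if z: "z \<in> ball 0 1" for z
  proof -
    obtain n where n: "cmod z < real n / (real n + 1)" using ex[OF z] by blast
    then have lt: "cmod z < cmod (of_real (real n / (real n + 1)))" by (subst norm_of_real) simp
    have "summable (\<lambda>k. X k \<omega> * z ^ k)"
      by (rule powser_inside[OF *[OF refl] lt])
    moreover have "((\<lambda>z. \<Sum>k. X k \<omega> * z ^ k) has_field_derivative (\<Sum>k. diffs (\<lambda>k. X k \<omega>) k * z ^ k)) (at z)"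
      by (rule termdiffs_strong[OF *[OF refl] lt])
    ultimately show ?thesis
      unfolding random_series_def[abs_def] field_differentiable_def by (auto simp: summable_sums)
  qed
  then show "random_series X \<omega> holomorphic_on ball 0 1" by (simp add: holomorphic_on_open field_differentiable_def)
  show "\<And>z. z \<in> ball 0 1 \<Longrightarrow> (\<lambda>k. X k \<omega> * z ^ k) sums random_series X \<omega> z" using D by blast
qed

text \<open>A bound on the first moments makes the expectation of the whole sum at most
  \<open>C / (1 - r)\<close>, so the sum is finite almost surely. No independence enters.\<close>

lemma (in prob_space) AE_summable_coefficients:
  assumes [measurable]: "\<And>k. X k \<in> borel_measurable M" and X: "\<exists>C. \<forall>k. (\<integral>\<^sup>+\<omega>. ennreal (cmod (X k \<omega>)) \<partial>M) \<le> ennreal C"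
  shows "AE \<omega> in M. \<forall>n. summable (\<lambda>k. cmod (X k \<omega>) * (real n / (real n + 1)) ^ k)"
proof (subst AE_all_countable, rule allI)
  fix n
  from X obtain C where C: "\<And>k. (\<integral>\<^sup>+\<omega>. ennreal (cmod (X k \<omega>)) \<partial>M) \<le> ennreal C" by blast
  define r where "r = real n / (real n + 1)"
  have r: "0 \<le> r" "r < 1" by (auto simp: r_def field_simps)
  have "(\<integral>\<^sup>+\<omega>. (\<Sum>k. ennreal (cmod (X k \<omega>) * r ^ k)) \<partial>M) = (\<Sum>k. \<integral>\<^sup>+\<omega>. ennreal (cmod (X k \<omega>) * r ^ k) \<partial>M)"
    by (rule nn_integral_suminf) auto
  also have "\<dots> \<le> (\<Sum>k. ennreal C * ennreal (r ^ k))"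
  proof (rule suminf_le)
    fix k
    have "(\<integral>\<^sup>+\<omega>. ennreal (cmod (X k \<omega>) * r ^ k) \<partial>M) = (\<integral>\<^sup>+\<omega>. ennreal (cmod (X k \<omega>)) \<partial>M) * ennreal (r ^ k)"
      using r by (subst nn_integral_multc[symmetric]) (auto simp: ennreal_mult)
    also have "\<dots> \<le> ennreal C * ennreal (r ^ k)" by (intro mult_right_mono C) auto
    finally show "(\<integral>\<^sup>+\<omega>. ennreal (cmod (X k \<omega>) * r ^ k) \<partial>M) \<le> ennreal C * ennreal (r ^ k)" .
  qed auto
  also have "\<dots> = ennreal C * ennreal (1 / (1 - r))"
    using r by (simp add: suminf_ennreal_eq[OF _ geometric_sums] suminf_geometric)
  also have "\<dots> < \<infinity>" by (simp add: ennreal_mult_less_top)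
  finally have "AE \<omega> in M. (\<Sum>k. ennreal (cmod (X k \<omega>) * r ^ k)) \<noteq> \<infinity>"
    by (intro nn_integral_noteq_infinite) auto
  then show "AE \<omega> in M. summable (\<lambda>k. cmod (X k \<omega>) * (real n / (real n + 1)) ^ k)"
    unfolding r_def[symmetric]
  proof eventually_elim
    case (elim \<omega>)
    show ?case by (rule summable_suminf_not_top) (use elim r in auto)
  qed
qed

text \<open>The one-point laws of the series, encoded by their characteristic functions, are all that the
  expected number of zeros depends on.\<close>

locale gaussian_series = prob_space M for M :: "'a measure" +
  fixes X :: "nat \<Rightarrow> 'a \<Rightarrow> complex" and V :: "complex \<Rightarrow> real"
  assumes X_meas[measurable]: "\<And>k. X k \<in> borel_measurable M"
    and X_norm: "\<exists>C. \<forall>k. (\<integral>\<^sup>+\<omega>. ennreal (cmod (X k \<omega>)) \<partial>M) \<le> ennreal C"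
    and char_series: "\<And>w z. z \<in> ball 0 1 \<Longrightarrow>
        expectation (\<lambda>\<omega>. cis (Re (w * random_series X \<omega> z))) = of_real (exp (- ((cmod w)\<^sup>2 * V z) / 4))"
    and V_pos: "\<And>z. z \<in> ball 0 1 \<Longrightarrow> 0 < V z"
    and V_cont: "continuous_on (ball 0 1) V"
begin

abbreviation "f \<equiv> random_series X"

text \<open>Characteristic functions determine the law, so at each point the series is a standard
  complex Gaussian variable scaled by the standard deviation.\<close>

lemma law_at:
  assumes z: "z \<in> ball 0 1"
  shows "distr M borel (\<lambda>\<omega>. f \<omega> z) = distr complex_normal borel (\<lambda>x. of_real (sqrt (V z)) * x)"
proof (rule complex_law_eqI[OF prob_space_axioms prob_space_complex_normal])
  fix w
  have "(\<integral>x. cis (Re (w * (of_real (sqrt (V z)) * x))) \<partial>complex_normal) = of_real (exp (- ((cmod w)\<^sup>2 * V z) / 4))"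
    using complex_normal_cis[of "w * of_real (sqrt (V z))"] V_pos[OF z] by (simp add: norm_mult power_mult_distrib mult.assoc)
  then show "expectation (\<lambda>\<omega>. cis (Re (w * f \<omega> z))) = (\<integral>x. cis (Re (w * (of_real (sqrt (V z)) * x))) \<partial>complex_normal)"
    using char_series[OF z] by simp
qed auto

lemma AE_nonzero:
  assumes z: "z \<in> ball 0 1"
  shows "AE \<omega> in M. f \<omega> z \<noteq> 0"
proof -
  have "AE x in distr complex_normal borel (\<lambda>x. of_real (sqrt (V z)) * x). x \<noteq> 0"
    using AE_complex_normal_nonzero V_pos[OF z] by (subst AE_distr_iff) (auto elim: AE_mp)
  then show ?thesis unfolding law_at[OF z, symmetric] by (subst (asm) AE_distr_iff) auto
qed

text \<open>By the scaling of the one-point law, \<open>ln (cmod (f \<omega> z))\<close> is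
  \<open>ln (V z) / 2\<close> plus a variable whose law does not depend on \<open>z\<close>. Its
  mean therefore cancels in differences, and the third bound is uniform on circles, which serves
  Fubini's theorem.\<close>

lemma ln_series:
  assumes z: "z \<in> ball 0 1"
  shows "integrable M (\<lambda>\<omega>. ln (cmod (f \<omega> z)))"
    "expectation (\<lambda>\<omega>. ln (cmod (f \<omega> z))) = ln (V z) / 2 + (\<integral>x. ln (cmod x) \<partial>complex_normal)"
    "expectation (\<lambda>\<omega>. \<bar>ln (cmod (f \<omega> z))\<bar>) \<le> \<bar>ln (V z)\<bar> / 2 + (\<integral>x. \<bar>ln (cmod x)\<bar> \<partial>complex_normal)"
proof -
  let ?s = "\<lambda>x. complex_of_real (sqrt (V z)) * x"
  note V = V_pos[OF z]
  have AE: "AE x in complex_normal. ln (cmod (?s x)) = ln (V z) / 2 + ln (cmod x)"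
    using AE_complex_normal_nonzero by eventually_elim (use V in \<open>simp add: norm_mult ln_mult ln_sqrt\<close>)
  have i0: "integrable complex_normal (\<lambda>x. ln (V z) / 2 + ln (cmod x))"
    using integrable_ln_complex_normal by simp
  have i1: "integrable complex_normal (\<lambda>x. ln (cmod (?s x)))"
    by (rule integrable_cong_AE_imp[OF i0]) (use AE in auto)
  then have "integrable (distr complex_normal borel ?s) (\<lambda>x. ln (cmod x))" by (subst integrable_distr_eq) auto
  then show i2: "integrable M (\<lambda>\<omega>. ln (cmod (f \<omega> z)))"
    unfolding law_at[OF z, symmetric] by (subst (asm) integrable_distr_eq) auto
  have "expectation (\<lambda>\<omega>. ln (cmod (f \<omega> z))) = (\<integral>x. ln (cmod x) \<partial>distr M borel (\<lambda>\<omega>. f \<omega> z))"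
    by (subst integral_distr) auto
  also have "\<dots> = (\<integral>x. ln (cmod (?s x)) \<partial>complex_normal)" unfolding law_at[OF z] by (subst integral_distr) auto
  also have "\<dots> = (\<integral>x. ln (V z) / 2 + ln (cmod x) \<partial>complex_normal)" using AE by (intro integral_cong_AE) auto
  also have "\<dots> = ln (V z) / 2 + (\<integral>x. ln (cmod x) \<partial>complex_normal)" using integrable_ln_complex_normal complex_normal.prob_space by simp
  finally show "expectation (\<lambda>\<omega>. ln (cmod (f \<omega> z))) = ln (V z) / 2 + (\<integral>x. ln (cmod x) \<partial>complex_normal)" .
  have "expectation (\<lambda>\<omega>. \<bar>ln (cmod (f \<omega> z))\<bar>) = (\<integral>x. \<bar>ln (cmod x)\<bar> \<partial>distr M borel (\<lambda>\<omega>. f \<omega> z))"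
    by (subst integral_distr) auto
  also have "\<dots> = (\<integral>x. \<bar>ln (cmod (?s x))\<bar> \<partial>complex_normal)" unfolding law_at[OF z] by (subst integral_distr) auto
  also have "\<dots> \<le> (\<integral>x. \<bar>ln (V z)\<bar> / 2 + \<bar>ln (cmod x)\<bar> \<partial>complex_normal)"
  proof (rule integral_mono_AE)
    show "AE x in complex_normal. \<bar>ln (cmod (?s x))\<bar> \<le> \<bar>ln (V z)\<bar> / 2 + \<bar>ln (cmod x)\<bar>"
      using AE by eventually_elim linarith
  qed (use i1 integrable_ln_complex_normal in auto)
  also have "\<dots> = \<bar>ln (V z)\<bar> / 2 + (\<integral>x. \<bar>ln (cmod x)\<bar> \<partial>complex_normal)" using integrable_ln_complex_normal complex_normal.prob_space by simp
  finally show "expectation (\<lambda>\<omega>. \<bar>ln (cmod (f \<omega> z))\<bar>) \<le> \<bar>ln (V z)\<bar> / 2 + (\<integral>x. \<bar>ln (cmod x)\<bar> \<partial>complex_normal)" .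
qed

lemma AE_admissible: "AE \<omega> in M. admissible (f \<omega>)"
proof -
  have "AE \<omega> in M. f \<omega> 0 \<noteq> 0" by (rule AE_nonzero) simp
  with AE_summable_coefficients[of X, OF X_meas X_norm] show ?thesis
    by eventually_elim (auto simp: admissible_def intro: random_series_holomorphic)
qed

lemma log_mod_excess_measurable: "(\<lambda>(\<omega>, a). log_mod_excess r (f \<omega>) a) \<in> borel_measurable (M \<Otimes>\<^sub>M borel)"
  unfolding log_mod_excess_def case_prod_beta by measurable

text \<open>Fubini's theorem for the angle and the random parameter. The bound \<open>B\<close> for
  \<open>ln V\<close> on the closed disc makes the integrand integrable, and the constant from
  \<open>ln_series\<close> cancels between circle mean and centre.\<close>

lemma log_mod_excess_expectation:
  assumes r: "0 < r" and a: "cmod a + r < 1"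
  shows "integrable M (\<lambda>\<omega>. log_mod_excess r (f \<omega>) a)" "expectation (\<lambda>\<omega>. log_mod_excess r (f \<omega>) a) = log_excess V a r / 2"
proof -
  interpret C: pair_sigma_finite circ M ..
  note in_ball = circle_in_disc[OF r a]
  have a_ball: "a \<in> ball 0 1" using r a by simp
  have contV: "continuous_on UNIV (\<lambda>\<theta>. ln (V (a + of_real r * cis \<theta>)))"
  proof (intro continuous_on_ln continuous_on_compose2[OF V_cont] continuous_intros)
    show "(\<lambda>\<theta>. a + of_real r * cis \<theta>) ` UNIV \<subseteq> ball 0 1" using in_ball by blast
    show "\<forall>\<theta>\<in>UNIV. V (a + of_real r * cis \<theta>) \<noteq> 0" using V_pos[OF in_ball] by (metis less_irrefl)
  qed
  have V_meas[measurable]: "(\<lambda>\<theta>. ln (V (a + of_real r * cis \<theta>))) \<in> borel_measurable borel"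
    by (rule borel_measurable_continuous_onI[OF contV])
  have "continuous_on (cball a r) (\<lambda>z. ln (V z))"
    using cball_in_disc[OF a] V_pos by (intro continuous_on_ln continuous_on_subset[OF V_cont]) fastforce+
  then have "compact ((\<lambda>z. ln (V z)) ` cball a r)" by (intro compact_continuous_image) auto
  from compact_imp_bounded[OF this] obtain B where "\<forall>x\<in>(\<lambda>z. ln (V z)) ` cball a r. norm x \<le> B" unfolding bounded_iff by blast
  then have B: "\<bar>ln (V (a + of_real r * cis \<theta>))\<bar> \<le> B" for \<theta> using r by (auto simp: dist_norm norm_mult)
  have iV: "integrable circ (\<lambda>\<theta>. ln (V (a + of_real r * cis \<theta>)))"
    by (rule circ.integrable_const_bound[of _ B]) (use B in auto)
  let ?h = "\<lambda>(\<theta>, \<omega>). ln (cmod (f \<omega> (a + of_real r * cis \<theta>)))"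
  have int: "integrable (circ \<Otimes>\<^sub>M M) ?h"
  proof (rule C.Fubini_integrable)
    show "integrable circ (\<lambda>\<theta>. \<integral>\<omega>. norm (?h (\<theta>, \<omega>)) \<partial>M)"
    proof (rule circ.integrable_const_bound[of _ "B / 2 + (\<integral>x. \<bar>ln (cmod x)\<bar> \<partial>complex_normal)"])
      show "AE \<theta> in circ. norm (\<integral>\<omega>. norm (?h (\<theta>, \<omega>)) \<partial>M) \<le> B / 2 + (\<integral>x. \<bar>ln (cmod x)\<bar> \<partial>complex_normal)"
      proof (rule AE_I2)
        fix \<theta>
        have "0 \<le> (\<integral>\<omega>. norm (?h (\<theta>, \<omega>)) \<partial>M)" by simp
        then show "norm (\<integral>\<omega>. norm (?h (\<theta>, \<omega>)) \<partial>M) \<le> B / 2 + (\<integral>x. \<bar>ln (cmod x)\<bar> \<partial>complex_normal)"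
          using ln_series(3)[OF in_ball, of \<theta>] B[of \<theta>] by simp
      qed
    qed simp
    show "AE \<theta> in circ. integrable M (\<lambda>\<omega>. ?h (\<theta>, \<omega>))"
      using ln_series(1)[OF in_ball] by simp
  qed simp
  have i1: "integrable M (\<lambda>\<omega>. \<integral>\<theta>. ln (cmod (f \<omega> (a + of_real r * cis \<theta>))) \<partial>circ)"
    using C.integrable_snd[OF int] by simp
  then show "integrable M (\<lambda>\<omega>. log_mod_excess r (f \<omega>) a)"
    unfolding log_mod_excess_def using ln_series(1)[OF a_ball] by simp
  have "expectation (\<lambda>\<omega>. log_mod_excess r (f \<omega>) a) = (\<integral>\<omega>. \<integral>\<theta>. ln (cmod (f \<omega> (a + of_real r * cis \<theta>))) \<partial>circ \<partial>M) - expectation (\<lambda>\<omega>. ln (cmod (f \<omega> a)))"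
    unfolding log_mod_excess_def using i1 ln_series(1)[OF a_ball] by simp
  also have "(\<integral>\<omega>. \<integral>\<theta>. ln (cmod (f \<omega> (a + of_real r * cis \<theta>))) \<partial>circ \<partial>M) = (\<integral>\<theta>. \<integral>\<omega>. ln (cmod (f \<omega> (a + of_real r * cis \<theta>))) \<partial>M \<partial>circ)"
    using C.Fubini_integral[OF int] .
  also have "\<dots> = (\<integral>\<theta>. ln (V (a + of_real r * cis \<theta>)) / 2 + (\<integral>x. ln (cmod x) \<partial>complex_normal) \<partial>circ)"
    by (simp only: ln_series(2)[OF in_ball])
  also have "\<dots> = (\<integral>\<theta>. ln (V (a + of_real r * cis \<theta>)) \<partial>circ) / 2 + (\<integral>x. ln (cmod x) \<partial>complex_normal)"
    using iV by simp
  finally show "expectation (\<lambda>\<omega>. log_mod_excess r (f \<omega>) a) = log_excess V a r / 2"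
    using ln_series(2)[OF a_ball] by (simp add: log_excess_def field_simps)
qed

lemma AE_log_mod_excess_eq:
  assumes r: "0 < r" and a: "cmod a + r < 1"
  shows "AE \<omega> in M. log_mod_excess r (f \<omega>) a = zero_sum (f \<omega>) (\<lambda>p. log_kernel r (p - a))"
proof -
  have "a \<in> ball 0 1" using r a by simp
  from AE_admissible AE_nonzero[OF this] show ?thesis
    by eventually_elim (rule log_mod_excess_eq_zero_sum[OF _ r a])
qed

lemma nn_integral_log_mod_excess_at:
  assumes r: "0 < r" and a: "cmod a + r < 1"
  shows "(\<integral>\<^sup>+\<omega>. ennreal (log_mod_excess r (f \<omega>) a) \<partial>M) = ennreal (log_excess V a r / 2)"
proof -
  have "AE \<omega> in M. 0 \<le> log_mod_excess r (f \<omega>) a"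
    using AE_log_mod_excess_eq[OF r a] by eventually_elim (simp add: zero_sum_nonneg)
  then show ?thesis using log_mod_excess_expectation(1)[OF r a] by (simp add: nn_integral_eq_integral log_mod_excess_expectation(2)[OF r a])
qed

text \<open>Tonelli's theorem moves the expectation under the area integral. The right side knows
  the series only through \<open>V\<close>, so here two series on different probability spaces
  become comparable.\<close>

lemma nn_integral_mollify:
  assumes t: "test_fun \<rho> \<phi>" and r: "0 < r" "\<rho> + r < 1"
  shows "(\<integral>\<^sup>+\<omega>. ennreal (kernel_mass r * zero_sum (f \<omega>) (mollify r \<phi>)) \<partial>M) = (\<integral>\<^sup>+a. ennreal (\<phi> a) * ennreal (log_excess V a r / 2) \<partial>lborel)"
proof -
  interpret C: pair_sigma_finite lborel M ..
  note [measurable] = test_fun_measurable[OF t]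
  note log_mod_excess_measurable[measurable]
  have "(\<integral>\<^sup>+\<omega>. ennreal (kernel_mass r * zero_sum (f \<omega>) (mollify r \<phi>)) \<partial>M) = (\<integral>\<^sup>+\<omega>. \<integral>\<^sup>+a. ennreal (\<phi> a * log_mod_excess r (f \<omega>) a) \<partial>lborel \<partial>M)"
    by (rule nn_integral_cong_AE) (use AE_admissible in eventually_elim, simp add: nn_integral_log_mod_excess[OF _ t r])
  also have "\<dots> = (\<integral>\<^sup>+a. \<integral>\<^sup>+\<omega>. ennreal (\<phi> a * log_mod_excess r (f \<omega>) a) \<partial>M \<partial>lborel)"
    by (rule C.Fubini') measurable
  also have "\<dots> = (\<integral>\<^sup>+a. ennreal (\<phi> a) * ennreal (log_excess V a r / 2) \<partial>lborel)"
  proof (rule nn_integral_cong)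
    fix a
    have 0: "0 \<le> \<phi> a" using t by (auto simp: test_fun_def)
    show "(\<integral>\<^sup>+\<omega>. ennreal (\<phi> a * log_mod_excess r (f \<omega>) a) \<partial>M) = ennreal (\<phi> a) * ennreal (log_excess V a r / 2)"
    proof (cases "\<phi> a = 0")
      case False
      then have a: "cmod a + r < 1" using t r by (force simp: test_fun_def)
      have "(\<integral>\<^sup>+\<omega>. ennreal (\<phi> a * log_mod_excess r (f \<omega>) a) \<partial>M) = (\<integral>\<^sup>+\<omega>. ennreal (\<phi> a) * ennreal (log_mod_excess r (f \<omega>) a) \<partial>M)"
        using 0 by (intro nn_integral_cong) (simp add: ennreal_mult')
      also have "\<dots> = ennreal (\<phi> a) * (\<integral>\<^sup>+\<omega>. ennreal (log_mod_excess r (f \<omega>) a) \<partial>M)"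
        by (rule nn_integral_cmult) measurable
      finally show ?thesis by (simp add: nn_integral_log_mod_excess_at[OF r(1) a])
    qed simp
  qed
  finally show ?thesis .
qed

end

section \<open>Shrinking the mollification radius\<close>

definition radius_seq :: "real \<Rightarrow> nat \<Rightarrow> real" where
  "radius_seq \<rho> n = (1 - \<rho>) / (real n + 2)"

text \<open>The 2 in the denominator keeps \<rho> plus the radius at most halfway between \<rho> and
  1, so all mollifications are supported in one compact disc; the radii are also at most 1, as the
  kernel estimates require.\<close>

lemma radius_seq:
  assumes "0 \<le> \<rho>" "\<rho> < 1"
  shows "0 < radius_seq \<rho> n" "\<rho> + radius_seq \<rho> n \<le> (1 + \<rho>) / 2" "\<rho> + radius_seq \<rho> n < 1" "radius_seq \<rho> n \<le> 1" "radius_seq \<rho> \<longlonglongrightarrow> 0"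
proof -
  show "0 < radius_seq \<rho> n" using assms by (simp add: radius_seq_def)
  have "radius_seq \<rho> n \<le> (1 - \<rho>) / 2" unfolding radius_seq_def using assms by (intro divide_left_mono) auto
  then show "\<rho> + radius_seq \<rho> n \<le> (1 + \<rho>) / 2" "\<rho> + radius_seq \<rho> n < 1" "radius_seq \<rho> n \<le> 1" using assms by (simp_all add: field_simps)
  show "radius_seq \<rho> \<longlonglongrightarrow> 0" unfolding radius_seq_def by real_asymp
qed

lemma mollify_uniform:
  assumes t: "test_fun \<rho> \<phi>" and e: "0 < \<epsilon>"
  shows "\<forall>\<^sub>F n in sequentially. \<forall>p\<in>ball 0 1. \<bar>mollify (radius_seq \<rho> n) \<phi> p - \<phi> p\<bar> \<le> \<epsilon>"
proof -
  have \<rho>: "0 \<le> \<rho>" "\<rho> < 1" using t by (auto simp: test_fun_def)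
  \<comment> \<open>All radii are at most 1, so centres near points of the unit disc stay in
    \<open>cball 0 2\<close>.\<close>
  have "uniformly_continuous_on (cball 0 2) \<phi>"
    using t by (intro compact_uniformly_continuous) (auto simp: test_fun_def intro: continuous_on_subset)
  then obtain d where d: "0 < d" "\<And>a p. a \<in> cball 0 2 \<Longrightarrow> p \<in> cball 0 2 \<Longrightarrow> dist a p < d \<Longrightarrow> dist (\<phi> a) (\<phi> p) < \<epsilon>"
    using e unfolding uniformly_continuous_on_def by (metis dist_commute)
  have "\<forall>\<^sub>F n in sequentially. radius_seq \<rho> n < d"
    using order_tendstoD(2)[OF radius_seq(5)[OF \<rho>] d(1)] .
  then show ?thesis
  proof eventually_elim
    case (elim n)
    show ?case
    proof
      fix p :: complex assume p: "p \<in> ball 0 1"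
      show "\<bar>mollify (radius_seq \<rho> n) \<phi> p - \<phi> p\<bar> \<le> \<epsilon>"
      proof (rule mollify_approx[OF t radius_seq(1,4)[OF \<rho>]])
        fix a assume a: "cmod (a - p) < radius_seq \<rho> n"
        have "cmod a \<le> 2" using norm_triangle_ineq[of "a - p" p] a p radius_seq(4)[OF \<rho>, of n] by simp
        then show "\<bar>\<phi> a - \<phi> p\<bar> \<le> \<epsilon>"
          using d(2)[of a p] a p elim by (auto simp: dist_norm)
      qed
    qed
  qed
qed

lemma mollify_support':
  assumes t: "test_fun \<rho> \<phi>" and "mollify (radius_seq \<rho> n) \<phi> p \<noteq> 0"
  shows "cmod p \<le> (1 + \<rho>) / 2"
  using mollify_support[OF t radius_seq(1) assms(2)] radius_seq(2)[of \<rho> n] t by (force simp: test_fun_def)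

lemma test_fun_half: "test_fun \<rho> \<phi> \<Longrightarrow> \<phi> p \<noteq> 0 \<Longrightarrow> cmod p \<le> (1 + \<rho>) / 2"
  by (force simp: test_fun_def)

lemma zero_sum_mollify_tendsto:
  assumes F: "admissible F" and t: "test_fun \<rho> \<phi>"
  shows "(\<lambda>n. zero_sum F (mollify (radius_seq \<rho> n) \<phi>)) \<longlonglongrightarrow> zero_sum F \<phi>"
proof -
  have \<rho>: "(1 + \<rho>) / 2 < 1" using t by (auto simp: test_fun_def)
  show ?thesis
  proof (rule zero_sum_tendsto[OF F \<rho>])
    show "\<forall>\<^sub>F n in sequentially. \<forall>p. mollify (radius_seq \<rho> n) \<phi> p \<noteq> 0 \<longrightarrow> cmod p \<le> (1 + \<rho>) / 2"
      using mollify_support'[OF t] by (intro always_eventually) auto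
    show "\<phi> p \<noteq> 0 \<Longrightarrow> cmod p \<le> (1 + \<rho>) / 2" for p
      by (rule test_fun_half[OF t])
    fix p :: complex assume p: "p \<in> ball 0 1"
    show "(\<lambda>n. mollify (radius_seq \<rho> n) \<phi> p) \<longlonglongrightarrow> \<phi> p"
    proof (rule tendstoI)
      fix e :: real assume "0 < e"
      then have "0 < e / 2" by simp
      from mollify_uniform[OF t this] show "\<forall>\<^sub>F n in sequentially. dist (mollify (radius_seq \<rho> n) \<phi> p) (\<phi> p) < e"
      proof eventually_elim
        case (elim n)
        then have "\<bar>mollify (radius_seq \<rho> n) \<phi> p - \<phi> p\<bar> \<le> e / 2" using p by blast
        then show ?case using \<open>0 < e\<close> by (simp add: dist_real_def)
      qed
    qed
  qed
qed

text \<open>The classical zero count from Jensen's formula at centre 0: each zero of modulus at most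
  \<rho> carries a kernel of at least \<open>ln (R / \<rho>)\<close>. The zero cannot be 0 itself,
  where the kernel has its default value.\<close>

lemma zero_sum_le_log_mod_excess:
  assumes F: "admissible F" and \<rho>: "0 < \<rho>" "\<rho> < R" "R < 1" and B: "0 \<le> B"
    and \<phi>: "\<And>p. \<phi> p \<noteq> 0 \<Longrightarrow> cmod p \<le> \<rho>" "\<And>p. \<phi> p \<le> B"
  shows "zero_sum F \<phi> \<le> B / ln (R / \<rho>) * log_mod_excess R F 0"
proof -
  have l: "0 < ln (R / \<rho>)" using \<rho> by (intro ln_gt_zero) auto
  have s: "log_kernel R p \<noteq> 0 \<Longrightarrow> cmod p \<le> R" for p using log_kernel_eq_0[of R p] \<rho> by linarith
  have "zero_sum F \<phi> \<le> zero_sum F (\<lambda>p. B / ln (R / \<rho>) * log_kernel R p)"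
  proof (rule zero_sum_mono[OF F \<rho>(3)])
    fix p assume Fp: "F p = 0"
    have p0: "p \<noteq> 0" using F Fp by (auto simp: admissible_def)
    show "\<phi> p \<le> B / ln (R / \<rho>) * log_kernel R p"
    proof (cases "\<phi> p = 0")
      case True
      then show ?thesis using B l by simp
    next
      case False
      then have p: "cmod p \<le> \<rho>" by (rule \<phi>)
      have "ln (R / \<rho>) \<le> ln (R / cmod p)" using p p0 \<rho> by (intro ln_mono frac_le) auto
      also have "\<dots> \<le> log_kernel R p" by (simp add: log_kernel_def)
      finally have "B / ln (R / \<rho>) * ln (R / \<rho>) \<le> B / ln (R / \<rho>) * log_kernel R p" using B l by (intro mult_left_mono) auto
      then show ?thesis using \<phi>(2)[of p] l by simp
    qed
  qed (use \<phi>(1) s \<rho> in \<open>fastforce+\<close>)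
  also have "\<dots> = B / ln (R / \<rho>) * zero_sum F (log_kernel R)" by (rule zero_sum_cmult)
  also have "\<dots> = B / ln (R / \<rho>) * log_mod_excess R F 0"
    using log_mod_excess_eq_zero_sum[of F R 0] F \<rho> by (simp add: admissible_def)
  finally show ?thesis .
qed

abbreviation expected_zero_sum ::
  "'a measure \<Rightarrow> (nat \<Rightarrow> 'a \<Rightarrow> complex) \<Rightarrow> (complex \<Rightarrow> real) \<Rightarrow> ennreal" where
  "expected_zero_sum M X \<phi> \<equiv> (\<integral>\<^sup>+\<omega>. ennreal (zero_sum (random_series X \<omega>) \<phi>) \<partial>M)"

text \<open>For a Gaussian series this is the expected zero sum of
  \<open>mollify (radius_seq \<rho> n) \<phi>\<close>, expressed through the variance alone.\<close>

abbreviation mollified_sum :: "(complex \<Rightarrow> real) \<Rightarrow> (complex \<Rightarrow> real) \<Rightarrow> real \<Rightarrow> nat \<Rightarrow> ennreal" where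
  "mollified_sum V \<phi> \<rho> n \<equiv> (\<integral>\<^sup>+a. ennreal (\<phi> a) * ennreal (log_excess V a (radius_seq \<rho> n) / 2) \<partial>lborel) / ennreal (kernel_mass (radius_seq \<rho> n))"

section \<open>Expected zero sums as limits of mollified sums\<close>

context gaussian_series
begin

lemma log_mod_excess_mollify_measurable:
  assumes t: "test_fun \<rho> \<phi>"
  shows "(\<lambda>\<omega>. \<integral>\<^sup>+a. ennreal (\<phi> a * log_mod_excess r (f \<omega>) a) \<partial>lborel) \<in> borel_measurable M"
proof -
  note [measurable] = test_fun_measurable[OF t] log_mod_excess_measurable
  show ?thesis by measurable
qed

text \<open>On almost every path the zero sum is the limit of mollified sums, which are measurable
  as integrals over centres.\<close>

lemma zero_sum_AE_measurable:
  assumes t: "test_fun \<rho> \<phi>"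
  obtains T where "T \<in> borel_measurable M" "AE \<omega> in M. T \<omega> = zero_sum (f \<omega>) \<phi>"
proof -
  have \<rho>: "0 \<le> \<rho>" "\<rho> < 1" using t by (auto simp: test_fun_def)
  define u where "u n \<omega> = enn2real (\<integral>\<^sup>+a. ennreal (\<phi> a * log_mod_excess (radius_seq \<rho> n) (f \<omega>) a) \<partial>lborel) / kernel_mass (radius_seq \<rho> n)" for n \<omega>
  have [measurable]: "u n \<in> borel_measurable M" for n
    unfolding u_def using log_mod_excess_mollify_measurable[OF t] by measurable
  have "AE \<omega> in M. lim (\<lambda>n. u n \<omega>) = zero_sum (f \<omega>) \<phi>"
    using AE_admissible
  proof eventually_elim
    case (elim \<omega>)
    have "u n \<omega> = zero_sum (f \<omega>) (mollify (radius_seq \<rho> n) \<phi>)" for n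
    proof -
      have c: "0 < kernel_mass (radius_seq \<rho> n)" by (rule kernel_mass_pos[OF radius_seq(1,4)[OF \<rho>]])
      have "0 \<le> zero_sum (f \<omega>) (mollify (radius_seq \<rho> n) \<phi>)"
        by (intro zero_sum_nonneg mollify_nonneg[OF t radius_seq(1,4)[OF \<rho>]])
      then show ?thesis unfolding u_def nn_integral_log_mod_excess[OF elim t radius_seq(1,3)[OF \<rho>]] using c by simp
    qed
    then show ?case using zero_sum_mollify_tendsto[OF elim t] by (simp add: limI)
  qed
  moreover have "(\<lambda>\<omega>. lim (\<lambda>n. u n \<omega>)) \<in> borel_measurable M" by measurable
  ultimately show ?thesis using that by blast
qed

lemma nn_integral_zero_sum_add:
  assumes "test_fun \<rho> \<phi>" "test_fun \<rho> \<psi>"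
  shows "expected_zero_sum M X (\<lambda>p. \<phi> p + \<psi> p) = expected_zero_sum M X \<phi> + expected_zero_sum M X \<psi>"
proof -
  obtain S where S[measurable]: "S \<in> borel_measurable M" and S': "AE \<omega> in M. S \<omega> = zero_sum (f \<omega>) \<phi>"
    using zero_sum_AE_measurable[OF assms(1)] .
  obtain T where T[measurable]: "T \<in> borel_measurable M" and T': "AE \<omega> in M. T \<omega> = zero_sum (f \<omega>) \<psi>"
    using zero_sum_AE_measurable[OF assms(2)] .
  have "expected_zero_sum M X (\<lambda>p. \<phi> p + \<psi> p) = (\<integral>\<^sup>+\<omega>. ennreal (S \<omega>) + ennreal (T \<omega>) \<partial>M)"
  proof (rule nn_integral_cong_AE, use S' T' AE_admissible in eventually_elim)
    case (elim \<omega>)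
    have "zero_sum (f \<omega>) (\<lambda>p. \<phi> p + \<psi> p) = zero_sum (f \<omega>) \<phi> + zero_sum (f \<omega>) \<psi>"
      by (rule zero_sum_add[OF elim(3), of \<rho>]) (use assms in \<open>auto simp: test_fun_def\<close>)
    moreover have "0 \<le> zero_sum (f \<omega>) \<phi>" "0 \<le> zero_sum (f \<omega>) \<psi>"
      using assms by (auto simp: test_fun_def intro: zero_sum_nonneg)
    ultimately show ?case using elim by simp
  qed
  also have "\<dots> = (\<integral>\<^sup>+\<omega>. ennreal (S \<omega>) \<partial>M) + (\<integral>\<^sup>+\<omega>. ennreal (T \<omega>) \<partial>M)"
    by (rule nn_integral_add) auto
  also have "(\<integral>\<^sup>+\<omega>. ennreal (S \<omega>) \<partial>M) = expected_zero_sum M X \<phi>"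
    by (rule nn_integral_cong_AE) (use S' in eventually_elim, simp)
  also have "(\<integral>\<^sup>+\<omega>. ennreal (T \<omega>) \<partial>M) = expected_zero_sum M X \<psi>"
    by (rule nn_integral_cong_AE) (use T' in eventually_elim, simp)
  finally show ?thesis .
qed

lemma nn_integral_zero_sum_bound:
  assumes \<rho>: "0 < \<rho>" "\<rho> < 1"
  obtains C where "0 \<le> C" "\<And>(\<phi> :: complex \<Rightarrow> real) B. 0 \<le> B \<Longrightarrow> (\<And>p. \<phi> p \<noteq> 0 \<Longrightarrow> cmod p \<le> \<rho>) \<Longrightarrow> (\<And>p. \<phi> p \<le> B) \<Longrightarrow>
    expected_zero_sum M X \<phi> \<le> ennreal (B * C)"
proof -
  define R where "R = (1 + \<rho>) / 2"
  have R: "\<rho> < R" "R < 1" "0 < R" using \<rho> by (auto simp: R_def)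
  have l: "0 < ln (R / \<rho>)" using \<rho> R by (intro ln_gt_zero) auto
  \<comment> \<open>The maximum makes \<open>C\<close> nonnegative without appeal to the sign of the
    excess, which is established only later.\<close>
  define C where "C = max 0 (log_excess V 0 R / 2 / ln (R / \<rho>))"
  show ?thesis
  proof (rule that[of C])
    fix \<phi> :: "complex \<Rightarrow> real" and B :: real assume B: "0 \<le> B" and \<phi>: "\<And>p. \<phi> p \<noteq> 0 \<Longrightarrow> cmod p \<le> \<rho>" "\<And>p. \<phi> p \<le> B"
    note log_mod_excess_measurable[measurable]
    have "expected_zero_sum M X \<phi> \<le> (\<integral>\<^sup>+\<omega>. ennreal (B / ln (R / \<rho>)) * ennreal (log_mod_excess R (f \<omega>) 0) \<partial>M)"
    proof (rule nn_integral_mono_AE, use AE_admissible in eventually_elim)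
      case (elim \<omega>)
      have "zero_sum (f \<omega>) \<phi> \<le> B / ln (R / \<rho>) * log_mod_excess R (f \<omega>) 0"
        by (rule zero_sum_le_log_mod_excess[OF elim \<rho>(1) R(1,2) B \<phi>])
      then show ?case using B l by (subst ennreal_mult'[symmetric]) (auto intro: ennreal_leI)
    qed
    also have "\<dots> = ennreal (B / ln (R / \<rho>)) * ennreal (log_excess V 0 R / 2)"
      using R by (subst nn_integral_cmult) (auto simp: nn_integral_log_mod_excess_at)
    also have "\<dots> \<le> ennreal (B / ln (R / \<rho>)) * ennreal (C * ln (R / \<rho>))"
      using l by (intro mult_left_mono ennreal_leI) (auto simp: C_def max_mult_distrib_right)
    also have "\<dots> = ennreal (B * C)"
      using l B by (subst ennreal_mult[symmetric]) (auto simp: C_def)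
    finally show "expected_zero_sum M X \<phi> \<le> ennreal (B * C)" .
  qed (simp add: C_def)
qed

text \<open>Fatou's lemma along the mollified sums, which converge to the zero sum on almost every
  path.\<close>

lemma nn_integral_zero_sum_liminf:
  assumes t: "test_fun \<rho> \<phi>"
  shows "expected_zero_sum M X \<phi> \<le>
    liminf (mollified_sum V \<phi> \<rho>)"
proof -
  have \<rho>: "0 \<le> \<rho>" "\<rho> < 1" using t by (auto simp: test_fun_def)
  note r = radius_seq(1,3)[OF \<rho>]
  define u where "u n \<omega> = (\<integral>\<^sup>+a. ennreal (\<phi> a * log_mod_excess (radius_seq \<rho> n) (f \<omega>) a) \<partial>lborel) / ennreal (kernel_mass (radius_seq \<rho> n))" for n \<omega>
  have [measurable]: "u n \<in> borel_measurable M" for n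
    unfolding u_def using log_mod_excess_mollify_measurable[OF t] by measurable
  have c: "0 < kernel_mass (radius_seq \<rho> n)" for n by (rule kernel_mass_pos[OF radius_seq(1,4)[OF \<rho>]])
  have u: "u n \<omega> = ennreal (zero_sum (f \<omega>) (mollify (radius_seq \<rho> n) \<phi>))" if "admissible (f \<omega>)" for n \<omega>
    unfolding u_def nn_integral_log_mod_excess[OF that t r] using c[of n]
    by (subst divide_ennreal) (auto intro!: mult_nonneg_nonneg zero_sum_nonneg mollify_nonneg[OF t radius_seq(1,4)[OF \<rho>]])
  have "expected_zero_sum M X \<phi> = (\<integral>\<^sup>+\<omega>. liminf (\<lambda>n. u n \<omega>) \<partial>M)"
  proof (rule nn_integral_cong_AE, use AE_admissible in eventually_elim)
    case (elim \<omega>)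
    have "(\<lambda>n. u n \<omega>) \<longlonglongrightarrow> ennreal (zero_sum (f \<omega>) \<phi>)"
      unfolding u[OF elim] by (intro tendsto_ennrealI zero_sum_mollify_tendsto[OF elim t])
    then show ?case by (simp add: lim_imp_Liminf)
  qed
  also have "\<dots> \<le> liminf (\<lambda>n. \<integral>\<^sup>+\<omega>. u n \<omega> \<partial>M)" by (rule nn_integral_liminf) simp
  also have "(\<lambda>n. \<integral>\<^sup>+\<omega>. u n \<omega> \<partial>M) = (mollified_sum V \<phi> \<rho>)"
  proof
    fix n
    have "(\<integral>\<^sup>+\<omega>. u n \<omega> \<partial>M) = (\<integral>\<^sup>+\<omega>. \<integral>\<^sup>+a. ennreal (\<phi> a * log_mod_excess (radius_seq \<rho> n) (f \<omega>) a) \<partial>lborel \<partial>M) / ennreal (kernel_mass (radius_seq \<rho> n))"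
      unfolding u_def by (rule nn_integral_divide) (rule log_mod_excess_mollify_measurable[OF t])
    also have "(\<integral>\<^sup>+\<omega>. \<integral>\<^sup>+a. ennreal (\<phi> a * log_mod_excess (radius_seq \<rho> n) (f \<omega>) a) \<partial>lborel \<partial>M) = (\<integral>\<^sup>+\<omega>. ennreal (kernel_mass (radius_seq \<rho> n) * zero_sum (f \<omega>) (mollify (radius_seq \<rho> n) \<phi>)) \<partial>M)"
      by (rule nn_integral_cong_AE) (use AE_admissible in eventually_elim, simp add: nn_integral_log_mod_excess[OF _ t r])
    finally show "(\<integral>\<^sup>+\<omega>. u n \<omega> \<partial>M) = mollified_sum V \<phi> \<rho> n"
      unfolding nn_integral_mollify[OF t r] .
  qed
  finally show ?thesis .
qed

text \<open>The mollification exceeds \<phi> by at most \<epsilon>, and only on the disc of radius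
  \<open>(1 + \<rho>) / 2\<close>. The expected number of zeros in that disc is bounded by Jensen's
  formula, so the error is at most \<epsilon> times a constant.\<close>

lemma nn_integral_zero_sum_limsup:
  assumes t: "test_fun \<rho> \<phi>"
  shows "limsup (mollified_sum V \<phi> \<rho>)
     \<le> expected_zero_sum M X \<phi>"
proof -
  have \<rho>: "0 \<le> \<rho>" "\<rho> < 1" using t by (auto simp: test_fun_def)
  note r = radius_seq(1,3)[OF \<rho>]
  have c: "0 < kernel_mass (radius_seq \<rho> n)" for n by (rule kernel_mass_pos[OF radius_seq(1,4)[OF \<rho>]])
  have h: "0 < (1 + \<rho>) / 2" "(1 + \<rho>) / 2 < 1" using \<rho> by auto
  obtain T where T[measurable]: "T \<in> borel_measurable M" and T': "AE \<omega> in M. T \<omega> = zero_sum (f \<omega>) \<phi>"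
    using zero_sum_AE_measurable[OF t] .
  define R where "R = (1 + (1 + \<rho>) / 2) / 2"
  have R: "(1 + \<rho>) / 2 < R" "R < 1" "0 < R" using h by (simp_all add: R_def field_simps)
  define C where "C = 1 / ln (R / ((1 + \<rho>) / 2))"
  have C: "0 < C" unfolding C_def using R h by (intro divide_pos_pos ln_gt_zero) auto
  define K where "K = C * \<bar>log_excess V 0 R / 2\<bar>"
  note log_mod_excess_measurable[measurable]
  have main: "limsup (mollified_sum V \<phi> \<rho>)
     \<le> expected_zero_sum M X \<phi> + ennreal (\<epsilon> * K)" if e: "0 < \<epsilon>" for \<epsilon>
  proof (rule Limsup_bounded, use mollify_uniform[OF t e] in eventually_elim)
    case (elim n)
    note m = elim
    have "mollified_sum V \<phi> \<rho> n
       = (\<integral>\<^sup>+\<omega>. ennreal (kernel_mass (radius_seq \<rho> n)) * ennreal (zero_sum (f \<omega>) (mollify (radius_seq \<rho> n) \<phi>)) \<partial>M) / ennreal (kernel_mass (radius_seq \<rho> n))"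
      unfolding nn_integral_mollify[OF t r, symmetric] using c[of n] by (simp add: ennreal_mult')
    also have "\<dots> \<le> (\<integral>\<^sup>+\<omega>. ennreal (kernel_mass (radius_seq \<rho> n)) * (ennreal (T \<omega>) + ennreal (\<epsilon> * C) * ennreal (log_mod_excess R (f \<omega>) 0)) \<partial>M) / ennreal (kernel_mass (radius_seq \<rho> n))"
    proof (rule divide_right_mono_ennreal, rule nn_integral_mono_AE, use AE_admissible T' in eventually_elim)
      case (elim \<omega>)
      let ?I = "indicator (cball 0 ((1 + \<rho>) / 2)) :: complex \<Rightarrow> real"
      have j: "0 \<le> log_mod_excess R (f \<omega>) 0"
        using log_mod_excess_eq_zero_sum[of "f \<omega>" R 0] elim(1) R by (simp add: admissible_def zero_sum_nonneg)
      have "zero_sum (f \<omega>) (mollify (radius_seq \<rho> n) \<phi>) \<le> zero_sum (f \<omega>) (\<lambda>p. \<phi> p + \<epsilon> * ?I p)"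
      proof (rule zero_sum_mono[OF elim(1) h(2)])
        show "mollify (radius_seq \<rho> n) \<phi> p \<noteq> 0 \<Longrightarrow> cmod p \<le> (1 + \<rho>) / 2" for p by (rule mollify_support'[OF t])
        show "\<phi> p + \<epsilon> * ?I p \<noteq> 0 \<Longrightarrow> cmod p \<le> (1 + \<rho>) / 2" for p
          using test_fun_half[OF t, of p] by (cases "\<phi> p = 0") (auto simp: indicator_def split: if_splits)
        fix p :: complex assume p: "p \<in> ball 0 1"
        show "mollify (radius_seq \<rho> n) \<phi> p \<le> \<phi> p + \<epsilon> * ?I p"
        proof (cases "cmod p \<le> (1 + \<rho>) / 2")
          case True
          have "\<bar>mollify (radius_seq \<rho> n) \<phi> p - \<phi> p\<bar> \<le> \<epsilon>" using m p by blast
          then show ?thesis using True by simp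
        next
          case False
          then have "mollify (radius_seq \<rho> n) \<phi> p = 0" using mollify_support'[OF t] by blast
          then show ?thesis using t e by (simp add: test_fun_def)
        qed
      qed
      also have "\<dots> = zero_sum (f \<omega>) \<phi> + \<epsilon> * zero_sum (f \<omega>) ?I"
        unfolding zero_sum_cmult[symmetric]
        by (rule zero_sum_add[OF elim(1) h(2)]) (use test_fun_half[OF t] in \<open>auto simp: indicator_def split: if_splits\<close>)
      also have "zero_sum (f \<omega>) ?I \<le> 1 / ln (R / ((1 + \<rho>) / 2)) * log_mod_excess R (f \<omega>) 0"
        by (rule zero_sum_le_log_mod_excess[OF elim(1) h(1) R(1,2)]) (auto simp: indicator_def split: if_splits)
      finally have "zero_sum (f \<omega>) (mollify (radius_seq \<rho> n) \<phi>) \<le> T \<omega> + \<epsilon> * C * log_mod_excess R (f \<omega>) 0"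
        using e elim(2) by (simp add: C_def)
      moreover have "0 \<le> T \<omega>" using elim(2) t by (simp add: zero_sum_nonneg test_fun_def)
      ultimately have "ennreal (zero_sum (f \<omega>) (mollify (radius_seq \<rho> n) \<phi>)) \<le> ennreal (T \<omega>) + ennreal (\<epsilon> * C) * ennreal (log_mod_excess R (f \<omega>) 0)"
        using j e C by (simp add: ennreal_mult[symmetric] ennreal_plus[symmetric] ennreal_leI del: ennreal_plus)
      then show ?case by (rule mult_left_mono) simp
    qed
    also have "\<dots> = (\<integral>\<^sup>+\<omega>. ennreal (T \<omega>) + ennreal (\<epsilon> * C) * ennreal (log_mod_excess R (f \<omega>) 0) \<partial>M)"
      using c[of n] by (subst nn_integral_cmult) (auto simp: mult.commute[of "ennreal (kernel_mass _)"] ennreal_mult_divide_eq)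
    also have "\<dots> = (\<integral>\<^sup>+\<omega>. ennreal (T \<omega>) \<partial>M) + ennreal (\<epsilon> * C) * ennreal (log_excess V 0 R / 2)"
      using R by (subst nn_integral_add) (auto simp: nn_integral_cmult nn_integral_log_mod_excess_at)
    also have "(\<integral>\<^sup>+\<omega>. ennreal (T \<omega>) \<partial>M) = expected_zero_sum M X \<phi>"
      by (rule nn_integral_cong_AE) (use T' in eventually_elim, simp)
    also have "ennreal (\<epsilon> * C) * ennreal (log_excess V 0 R / 2) \<le> ennreal (\<epsilon> * K)"
      unfolding K_def using e C by (subst ennreal_mult'[symmetric]) (auto intro!: ennreal_leI mult_left_mono)
    finally show ?case by (simp add: add_left_mono)
  qed
  have K: "0 \<le> K" using C by (simp add: K_def)
  show ?thesis
  proof (rule ennreal_le_epsilon)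
    fix e :: real assume e: "0 < e"
    \<comment> \<open>The tolerance for \<epsilon> is \<open>e / (K + 1)\<close> rather than
      \<open>e / K\<close>, as \<open>K\<close> may be 0.\<close>
    have "e / (K + 1) * K \<le> e" using e K by (simp add: field_simps)
    then have "expected_zero_sum M X \<phi> + ennreal (e / (K + 1) * K) \<le> expected_zero_sum M X \<phi> + ennreal e"
      by (intro add_left_mono ennreal_leI)
    moreover have "0 < e / (K + 1)" using e K by simp
    ultimately show "limsup (mollified_sum V \<phi> \<rho>)
      \<le> expected_zero_sum M X \<phi> + ennreal e"
      using main order_trans by blast
  qed
qed

end

text \<open>The two one-sided limits are used on opposite sides: Fatou's bound for the smaller
  series, the uniform bound for the larger one. In between, the mollified sums are compared centre
  by centre.\<close>

lemma compare_zero_sum: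
  assumes "gaussian_series M X V" "gaussian_series N Y W" and t: "test_fun \<rho> \<phi>"
    and le: "\<And>a r. 0 < r \<Longrightarrow> cmod a + r < 1 \<Longrightarrow> log_excess V a r \<le> log_excess W a r"
  shows "expected_zero_sum M X \<phi> \<le> expected_zero_sum N Y \<phi>"
proof -
  interpret A: gaussian_series M X V by fact
  interpret B: gaussian_series N Y W by fact
  have \<rho>: "0 \<le> \<rho>" "\<rho> < 1" using t by (auto simp: test_fun_def)
  have "expected_zero_sum M X \<phi> \<le> liminf (mollified_sum V \<phi> \<rho>)"
    by (rule A.nn_integral_zero_sum_liminf[OF t])
  also have "\<dots> \<le> liminf (mollified_sum W \<phi> \<rho>)"
  proof (intro Liminf_mono always_eventually allI divide_right_mono_ennreal nn_integral_mono)
    fix n a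
    show "ennreal (\<phi> a) * ennreal (log_excess V a (radius_seq \<rho> n) / 2) \<le> ennreal (\<phi> a) * ennreal (log_excess W a (radius_seq \<rho> n) / 2)"
    proof (cases "\<phi> a = 0")
      case False
      then have "cmod a \<le> \<rho>" using t by (simp add: test_fun_def)
      then have "cmod a + radius_seq \<rho> n < 1" using radius_seq(3)[OF \<rho>, of n] by linarith
      then show ?thesis using le[OF radius_seq(1)[OF \<rho>]] by (intro mult_left_mono ennreal_leI) auto
    qed simp
  qed
  also have "\<dots> \<le> limsup (mollified_sum W \<phi> \<rho>)" by (rule Liminf_le_Limsup) simp
  also have "\<dots> \<le> expected_zero_sum N Y \<phi>"
    by (rule B.nn_integral_zero_sum_limsup[OF t])
  finally show ?thesis .
qed

section \<open>Comparison of expected numbers of zeros\<close>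

text \<open>The subtracted 1 makes the function vanish within distance \<open>1 / (k + 1)\<close> of
  the complement of \<open>D\<close>, which separates its support from the unit circle; it equals 1
  from distance \<open>2 / (k + 1)\<close> on.\<close>

definition bump :: "complex set \<Rightarrow> nat \<Rightarrow> complex \<Rightarrow> real" where
  "bump D k p = max 0 (min 1 (real (k + 1) * infdist p (- D) - 1))"

lemma bump_basic: "0 \<le> bump D k p" "bump D k p \<le> 1" "p \<notin> D \<Longrightarrow> bump D k p = 0"
  by (auto simp: bump_def infdist_zero)

lemma bump_mono: "k \<le> l \<Longrightarrow> bump D k p \<le> bump D l p"
  unfolding bump_def
  by (intro max.mono min.mono order_refl diff_right_mono mult_right_mono) (auto simp: infdist_nonneg)

lemma bump_eq_1: "2 \<le> real (k + 1) * infdist p (- D) \<Longrightarrow> bump D k p = 1"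
  by (simp add: bump_def)

text \<open>The radial projection \<open>sgn p\<close> lies on the unit circle, hence outside
  \<open>D\<close>, so the distance from \<open>p\<close> to the complement is at most
  \<open>1 - cmod p\<close>.\<close>

lemma test_fun_bump:
  assumes D: "D \<subseteq> ball 0 1"
  shows "test_fun (real k / real (k + 1)) (bump D k)"
proof -
  have "cmod p \<le> real k / real (k + 1)" if p: "bump D k p \<noteq> 0" for p
  proof (cases "p = 0")
    case False
    have "1 \<le> real (k + 1) * infdist p (- D)" using p by (auto simp: bump_def max_def min_def split: if_splits)
    then have 1: "1 / real (k + 1) \<le> infdist p (- D)" by (simp add: field_simps)
    have "p \<in> D" using bump_basic(3) p by blast
    then have p1: "cmod p < 1" using D by auto
    have ps: "p - sgn p = of_real (cmod p - 1) * sgn p"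
      using False by (simp add: sgn_eq field_simps)
    have "sgn p \<in> - D" using D False by (auto simp: norm_sgn dest!: subsetD)
    then have "infdist p (- D) \<le> dist p (sgn p)" by (rule infdist_le)
    also have "dist p (sgn p) = cmod (of_real (cmod p - 1) * sgn p)" by (simp only: dist_norm ps)
    also have "\<dots> = \<bar>cmod p - 1\<bar>" using False by (simp add: norm_mult norm_sgn del: of_real_diff)
    also have "\<bar>cmod p - 1\<bar> = 1 - cmod p" using p1 by simp
    finally have "1 / real (k + 1) \<le> 1 - cmod p" using 1 by linarith
    then show ?thesis by (simp add: field_simps)
  qed simp
  then show ?thesis
    by (auto simp: test_fun_def bump_basic) (auto simp: bump_def[abs_def] intro!: continuous_intros)
qed

lemma bump_tendsto:
  assumes "open D" "p \<in> D" "D \<noteq> UNIV"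
  shows "(\<lambda>k. bump D k p) \<longlonglongrightarrow> 1"
proof -
  have d: "0 < infdist p (- D)" using assms by (intro infdist_pos_not_in_closed) auto
  then obtain K where K: "2 / infdist p (- D) \<le> real K" using real_arch_simple by blast
  have "bump D k p = 1" if "K \<le> k" for k
  proof (rule bump_eq_1)
    have "2 \<le> real K * infdist p (- D)" using K d by (simp add: field_simps)
    also have "\<dots> \<le> real (k + 1) * infdist p (- D)" using that d by (intro mult_right_mono) auto
    finally show "2 \<le> real (k + 1) * infdist p (- D)" .
  qed
  then have "\<forall>\<^sub>F k in sequentially. bump D k p = 1" by (auto simp: eventually_sequentially)
  then show ?thesis by (rule tendsto_eventually)
qed

text \<open>The count may be infinite, so it is approached through finite sets of zeros, on each of
  which the bumps tend to 1. Conversely each bump sees finitely many zeros, with weight at most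
  1.\<close>

lemma num_zeros_eq_SUP:
  assumes F: "admissible F" and D: "open D" "D \<subseteq> ball 0 1"
  shows "num_zeros F D = (SUP k. ennreal (zero_sum F (bump D k)))"
proof (rule antisym)
  have DU: "D \<noteq> UNIV" using D by (metis bounded_ball bounded_subset not_bounded_UNIV)
  let ?m = "\<lambda>p. real (nat (zorder F p))"
  have fin: "finite {p \<in> ball 0 1. F p = 0 \<and> bump D k p \<noteq> 0}" for k
  proof (rule finite_subset)
    show "finite {p \<in> cball 0 (real k / real (k + 1)). F p = 0}" by (rule admissible_finite_zeros[OF F]) simp
    show "{p \<in> ball 0 1. F p = 0 \<and> bump D k p \<noteq> 0} \<subseteq> {p \<in> cball 0 (real k / real (k + 1)). F p = 0}"
      using test_fun_bump[OF D(2), of k] by (auto simp: test_fun_def)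
  qed
  show "num_zeros F D \<le> (SUP k. ennreal (zero_sum F (bump D k)))"
    unfolding num_zeros_def
  proof (rule infsum_le_finite_sums)
    fix G assume G: "finite G" "G \<subseteq> {z \<in> D. F z = 0}"
    have "(\<lambda>k. ennreal (\<Sum>p\<in>G. ?m p * bump D k p)) \<longlonglongrightarrow> ennreal (\<Sum>p\<in>G. ?m p * 1)"
      using G DU D by (intro tendsto_ennrealI tendsto_sum tendsto_mult tendsto_const bump_tendsto) auto
    moreover have "ennreal (\<Sum>p\<in>G. ?m p * bump D k p) \<le> (SUP k. ennreal (zero_sum F (bump D k)))" for k
    proof (rule SUP_upper2[of k])
      have "(\<Sum>p\<in>G. ?m p * bump D k p) = (\<Sum>p\<in>{p\<in>G. bump D k p \<noteq> 0}. ?m p * bump D k p)"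
        using G by (intro sum.mono_neutral_right) auto
      also have "\<dots> \<le> zero_sum F (bump D k)"
        unfolding zero_sum_def using G D fin by (intro sum_mono2) (auto simp: bump_basic)
      finally show "ennreal (\<Sum>p\<in>G. ?m p * bump D k p) \<le> ennreal (zero_sum F (bump D k))" by (rule ennreal_leI)
    qed simp
    ultimately have "ennreal (\<Sum>p\<in>G. ?m p * 1) \<le> (SUP k. ennreal (zero_sum F (bump D k)))"
      by (intro LIMSEQ_le_const2) auto
    then show "(\<Sum>p\<in>G. of_nat (nat (zorder F p))) \<le> (SUP k. ennreal (zero_sum F (bump D k)))"
      by (simp add: ennreal_of_nat_eq_real_of_nat flip: sum_ennreal)
  qed (rule nonneg_summable_on_complete, simp)
  show "(SUP k. ennreal (zero_sum F (bump D k))) \<le> num_zeros F D"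
  proof (rule SUP_least)
    fix k
    let ?S = "{p \<in> ball 0 1. F p = 0 \<and> bump D k p \<noteq> 0}"
    have "zero_sum F (bump D k) \<le> (\<Sum>p\<in>?S. ?m p)"
      unfolding zero_sum_def using bump_basic by (intro sum_mono mult_right_le_one_le) auto
    then have "ennreal (zero_sum F (bump D k)) \<le> (\<Sum>p\<in>?S. of_nat (nat (zorder F p)))"
      by (simp add: ennreal_leI ennreal_of_nat_eq_real_of_nat)
    also have "\<dots> = (\<Sum>\<^sub>\<infinity>p\<in>?S. of_nat (nat (zorder F p)))" using fin by (simp add: infsum_finite)
    also have "\<dots> \<le> num_zeros F D"
      unfolding num_zeros_def using bump_basic(3)[of _ D k]
      by (intro infsum_mono_neutral nonneg_summable_on_complete) auto
    finally show "ennreal (zero_sum F (bump D k)) \<le> num_zeros F D" .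
  qed
qed

text \<open>A bounded continuous version of \<open>log_kernel r (p - a)\<close>, so that it qualifies as a test function.\<close>

definition trunc_kernel :: "real \<Rightarrow> complex \<Rightarrow> nat \<Rightarrow> complex \<Rightarrow> real" where
  "trunc_kernel r a n p = max 0 (ln (r / max (cmod (p - a)) (r * exp (- real n))))"

lemma trunc_kernel:
  assumes r: "0 < r"
  shows "0 \<le> trunc_kernel r a n p" "trunc_kernel r a n p \<le> real n" "trunc_kernel r a n p \<noteq> 0 \<Longrightarrow> cmod (p - a) \<le> r"
    "p \<noteq> a \<Longrightarrow> trunc_kernel r a n p \<le> log_kernel r (p - a)" "n \<le> m \<Longrightarrow> trunc_kernel r a n p \<le> trunc_kernel r a m p"
    "p \<noteq> a \<Longrightarrow> (\<lambda>n. trunc_kernel r a n p) \<longlonglongrightarrow> log_kernel r (p - a)" "continuous_on UNIV (trunc_kernel r a n)"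
proof -
  let ?M = "\<lambda>n p. max (cmod (p - a)) (r * exp (- real n))"
  have M: "0 < ?M n p" for n p using r by (simp add: less_max_iff_disj)
  show "0 \<le> trunc_kernel r a n p" by (simp add: trunc_kernel_def)
  have "r / ?M n p \<le> exp (real n)"
  proof -
    have "r = exp (real n) * (r * exp (- real n))" by (simp add: exp_minus)
    also have "\<dots> \<le> exp (real n) * ?M n p" by (intro mult_left_mono) auto
    finally show ?thesis using M[where n=n and p=p] by (simp add: pos_divide_le_eq)
  qed
  then have "ln (r / ?M n p) \<le> ln (exp (real n))" using M r by (intro ln_mono) auto
  then show "trunc_kernel r a n p \<le> real n" by (simp add: trunc_kernel_def)
  show "cmod (p - a) \<le> r" if "trunc_kernel r a n p \<noteq> 0"
  proof (rule ccontr)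
    assume "\<not> cmod (p - a) \<le> r"
    then have "r \<le> ?M n p" by auto
    then have "r / ?M n p \<le> 1" "0 < r / ?M n p" using M r by (auto simp: pos_divide_le_eq)
    then have "ln (r / ?M n p) \<le> 0" by (subst ln_le_zero_iff)
    then show False using that by (simp add: trunc_kernel_def)
  qed
  show "trunc_kernel r a n p \<le> log_kernel r (p - a)" if "p \<noteq> a"
    unfolding trunc_kernel_def log_kernel_def using that r M by (intro max.mono ln_mono divide_left_mono) auto
  show "trunc_kernel r a n p \<le> trunc_kernel r a m p" if "n \<le> m"
    unfolding trunc_kernel_def using that r M by (intro max.mono ln_mono divide_left_mono mult_pos_pos divide_pos_pos) auto
  show "(\<lambda>n. trunc_kernel r a n p) \<longlonglongrightarrow> log_kernel r (p - a)" if "p \<noteq> a"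
  proof -
    have "(\<lambda>n. r * exp (- real n)) \<longlonglongrightarrow> 0" by real_asymp
    then have "(\<lambda>n. trunc_kernel r a n p) \<longlonglongrightarrow> max 0 (ln (r / max (cmod (p - a)) 0))"
      unfolding trunc_kernel_def using that r by (intro tendsto_max tendsto_ln tendsto_divide tendsto_const) (auto simp: max_def)
    then show ?thesis by (simp add: log_kernel_def)
  qed
  show "continuous_on UNIV (trunc_kernel r a n)"
    unfolding trunc_kernel_def[abs_def] using M r by (intro continuous_on_max continuous_on_ln continuous_on_divide continuous_intros) (metis less_irrefl divide_eq_0_iff)+
qed

section \<open>Monotone limits of expected zero sums\<close>

context gaussian_series
begin

lemma nn_integral_zero_sum_cmult:
  assumes t: "test_fun \<rho> \<phi>" and c: "0 \<le> c"
  shows "expected_zero_sum M X (\<lambda>p. c * \<phi> p) = ennreal c * expected_zero_sum M X \<phi>"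
proof -
  obtain T where T[measurable]: "T \<in> borel_measurable M" and T': "AE \<omega> in M. T \<omega> = zero_sum (f \<omega>) \<phi>"
    using zero_sum_AE_measurable[OF t] .
  have "expected_zero_sum M X (\<lambda>p. c * \<phi> p) = (\<integral>\<^sup>+\<omega>. ennreal c * ennreal (T \<omega>) \<partial>M)"
    by (rule nn_integral_cong_AE) (use T' in eventually_elim, simp add: zero_sum_cmult ennreal_mult'[OF c])
  also have "\<dots> = ennreal c * (\<integral>\<^sup>+\<omega>. ennreal (T \<omega>) \<partial>M)" by (rule nn_integral_cmult) simp
  also have "(\<integral>\<^sup>+\<omega>. ennreal (T \<omega>) \<partial>M) = expected_zero_sum M X \<phi>"
    by (rule nn_integral_cong_AE) (use T' in eventually_elim, simp)
  finally show ?thesis .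
qed

lemma incseq_zero_sum:
  assumes t: "\<And>k. test_fun (\<rho> k) (\<phi> k)" and mono: "\<And>k l p. k \<le> l \<Longrightarrow> \<phi> k p \<le> \<phi> l p" and F: "admissible F"
  shows "incseq (\<lambda>k. ennreal (zero_sum F (\<phi> k)))"
  unfolding incseq_def
proof (intro allI impI ennreal_leI)
  fix k l :: nat assume kl: "k \<le> l"
  have s: "cmod p \<le> \<rho> l" if "0 < \<phi> l p" for p using that t[of l] by (simp add: test_fun_def)
  have n: "0 \<le> \<phi> m p" for m p using t[of m] by (simp add: test_fun_def)
  show "zero_sum F (\<phi> k) \<le> zero_sum F (\<phi> l)"
  proof (rule zero_sum_mono[OF F _ _ _ mono[OF kl]])
    show "\<rho> l < 1" using t[of l] by (simp add: test_fun_def)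
    show "\<phi> k p \<noteq> 0 \<Longrightarrow> cmod p \<le> \<rho> l" for p using s[of p] n[of k p] mono[OF kl, of p] by linarith
    show "\<phi> l p \<noteq> 0 \<Longrightarrow> cmod p \<le> \<rho> l" for p using s[of p] n[of l p] by linarith
  qed
qed

text \<open>Monotone convergence is applied to measurable representatives \<open>T k\<close>;
  countably many null sets are discarded so that all of them agree with the zero sums on the same
  paths.\<close>

lemma zero_sum_monotone_convergence:
  assumes t: "\<And>k. test_fun (\<rho> k) (\<phi> k)" and mono: "\<And>k l p. k \<le> l \<Longrightarrow> \<phi> k p \<le> \<phi> l p"
  shows "incseq (\<lambda>k. expected_zero_sum M X (\<phi> k))"
    "(SUP k. expected_zero_sum M X (\<phi> k)) = (\<integral>\<^sup>+\<omega>. (SUP k. ennreal (zero_sum (f \<omega>) (\<phi> k))) \<partial>M)"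
proof -
  have inc: "ennreal (zero_sum F (\<phi> k)) \<le> ennreal (zero_sum F (\<phi> l))" if "admissible F" "k \<le> l" for F k l
    using incseq_zero_sum[of \<rho> \<phi>, OF t mono that(1)] that(2) by (rule incseqD)
  show "incseq (\<lambda>k. expected_zero_sum M X (\<phi> k))"
    unfolding incseq_def by (intro allI impI nn_integral_mono_AE) (use AE_admissible in eventually_elim, rule inc)
  have "\<forall>k. \<exists>T. T \<in> borel_measurable M \<and> (AE \<omega> in M. T \<omega> = zero_sum (f \<omega>) (\<phi> k))"
    using zero_sum_AE_measurable[OF t] by metis
  then obtain T where T[measurable]: "\<And>k. T k \<in> borel_measurable M" and T': "\<And>k. AE \<omega> in M. T k \<omega> = zero_sum (f \<omega>) (\<phi> k)"
    by metis
  have AT: "AE \<omega> in M. \<forall>k. T k \<omega> = zero_sum (f \<omega>) (\<phi> k)" using T' by (simp add: AE_all_countable)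
  have "(SUP k. expected_zero_sum M X (\<phi> k)) = (SUP k. \<integral>\<^sup>+\<omega>. ennreal (T k \<omega>) \<partial>M)"
    by (intro SUP_cong refl nn_integral_cong_AE) (use AT in eventually_elim, simp)
  also have "\<dots> = (\<integral>\<^sup>+\<omega>. (SUP k. ennreal (T k \<omega>)) \<partial>M)"
  proof (rule nn_integral_monotone_convergence_SUP_AE[symmetric])
    show "AE \<omega> in M. ennreal (T k \<omega>) \<le> ennreal (T (Suc k) \<omega>)" for k
      using AE_admissible AT by eventually_elim (simp add: inc)
  qed simp
  also have "\<dots> = (\<integral>\<^sup>+\<omega>. (SUP k. ennreal (zero_sum (f \<omega>) (\<phi> k))) \<partial>M)"
    by (rule nn_integral_cong_AE) (use AT in eventually_elim, simp)
  finally show "(SUP k. expected_zero_sum M X (\<phi> k)) = (\<integral>\<^sup>+\<omega>. (SUP k. ennreal (zero_sum (f \<omega>) (\<phi> k))) \<partial>M)" .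
qed

lemma expected_zeros_eq_SUP:
  assumes D: "open D" "D \<subseteq> ball 0 1"
  shows "expected_zeros M f D = (SUP k. expected_zero_sum M X (bump D k))"
proof -
  have "expected_zeros M f D = (\<integral>\<^sup>+\<omega>. (SUP k. ennreal (zero_sum (f \<omega>) (bump D k))) \<partial>M)"
    unfolding expected_zeros_def
    by (rule nn_integral_cong_AE) (use AE_admissible in eventually_elim, simp add: num_zeros_eq_SUP[OF _ D])
  also have "\<dots> = (SUP k. expected_zero_sum M X (bump D k))"
    by (rule zero_sum_monotone_convergence(2)[symmetric, OF test_fun_bump[OF D(2)] bump_mono])
  finally show ?thesis .
qed

text \<open>By compactness the closure lies in a smaller disc \<open>cball 0 \<rho>\<close>, where
  Jensen's count bounds the expectations for all bumps by one constant.\<close>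

lemma expected_zeros_finite:
  assumes D: "open D" "closure D \<subseteq> ball 0 1"
  shows "expected_zeros M f D < \<infinity>"
proof -
  have sub: "D \<subseteq> ball 0 1" using D closure_subset by blast
  have "compact (closure D)"
    using D by (metis bounded_ball bounded_subset closed_closure compact_eq_bounded_closed)
  then obtain \<rho> where \<rho>: "0 < \<rho>" "\<rho> < 1" "closure D \<subseteq> cball 0 \<rho>"
  proof (cases "closure D = {}")
    case False
    have "continuous_on (closure D) cmod" by (intro continuous_intros)
    from continuous_attains_sup[OF \<open>compact (closure D)\<close> False this]
    obtain q where q: "q \<in> closure D" "\<And>p. p \<in> closure D \<Longrightarrow> cmod p \<le> cmod q" by blast
    have "cmod q < 1" using q D by auto
    then show ?thesis using q that[of "(1 + cmod q) / 2"] norm_ge_zero[of q] by (force simp: subset_iff)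
  qed (use that[of "1/2"] in auto)
  obtain C where C: "\<And>(\<phi> :: complex \<Rightarrow> real) B. 0 \<le> B \<Longrightarrow> (\<And>p. \<phi> p \<noteq> 0 \<Longrightarrow> cmod p \<le> \<rho>) \<Longrightarrow> (\<And>p. \<phi> p \<le> B) \<Longrightarrow>
    expected_zero_sum M X \<phi> \<le> ennreal (B * C)"
    using nn_integral_zero_sum_bound[OF \<rho>(1,2)] by metis
  have "expected_zeros M f D \<le> ennreal (1 * C)"
    unfolding expected_zeros_eq_SUP[OF D(1) sub]
  proof (intro SUP_least C)
    show "bump D k p \<noteq> 0 \<Longrightarrow> cmod p \<le> \<rho>" for k p
      using \<rho>(3) bump_basic(3)[of p D k] closure_subset[of D] by (metis in_mono mem_cball_0)
  qed (auto simp: bump_basic)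
  then show ?thesis by (auto intro: le_less_trans)
qed

text \<open>Subharmonicity of \<open>ln V\<close>, read off from the zeros: up to the factor 2 the
  excess is the expectation of a nonnegative zero sum.\<close>

lemma log_excess_nonneg:
  assumes r: "0 < r" and a: "cmod a + r < 1"
  shows "0 \<le> log_excess V a r"
proof -
  have "0 \<le> expectation (\<lambda>\<omega>. log_mod_excess r (f \<omega>) a)"
    by (rule integral_nonneg_AE) (use AE_log_mod_excess_eq[OF r a] in eventually_elim, simp add: zero_sum_nonneg)
  then show ?thesis by (simp add: log_mod_excess_expectation[OF r a])
qed

lemma test_fun_trunc_kernel:
  assumes "0 < r" "cmod a + r < 1"
  shows "test_fun (cmod a + r) (trunc_kernel r a n)"
proof -
  have "cmod p \<le> cmod a + r" if "trunc_kernel r a n p \<noteq> 0" for p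
    using trunc_kernel(3)[OF assms(1) that] norm_triangle_ineq[of a "p - a"] by simp
  then show ?thesis using assms trunc_kernel[OF assms(1)] by (auto simp: test_fun_def)
qed

text \<open>The truncations increase to the logarithmic kernel at every point except
  \<open>a\<close>, and almost surely \<open>a\<close> is not a zero. So the expected truncated sums
  determine the excess of the variance.\<close>

lemma trunc_kernel_limit:
  assumes r: "0 < r" and a: "cmod a + r < 1"
  shows "(SUP n. expected_zero_sum M X (trunc_kernel r a n)) = ennreal (log_excess V a r / 2)"
proof -
  have supp: "trunc_kernel r a k p \<noteq> 0 \<Longrightarrow> cmod p \<le> cmod a + r" for k p
    using test_fun_trunc_kernel[OF r a, of k] by (auto simp: test_fun_def)
  have suppk: "log_kernel r (p - a) \<noteq> 0 \<Longrightarrow> cmod p \<le> cmod a + r" for p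
    using log_kernel_eq_0[OF r, of "p - a"] norm_triangle_ineq[of a "p - a"] by (simp, linarith)
  have "a \<in> ball 0 1" using r a by simp
  note AEa = AE_nonzero[OF this]
  have "(SUP n. expected_zero_sum M X (trunc_kernel r a n)) = (\<integral>\<^sup>+\<omega>. (SUP n. ennreal (zero_sum (f \<omega>) (trunc_kernel r a n))) \<partial>M)"
    by (rule zero_sum_monotone_convergence(2)[OF test_fun_trunc_kernel[OF r a] trunc_kernel(5)[OF r]])
  also have "\<dots> = (\<integral>\<^sup>+\<omega>. ennreal (log_mod_excess r (f \<omega>) a) \<partial>M)"
  proof (rule nn_integral_cong_AE, use AE_admissible AEa in eventually_elim)
    case (elim \<omega>)
    have "(\<lambda>n. zero_sum (f \<omega>) (trunc_kernel r a n)) \<longlonglongrightarrow> zero_sum (f \<omega>) (\<lambda>p. log_kernel r (p - a))"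
    proof (rule zero_sum_tendsto[OF elim(1) a])
      show "\<forall>\<^sub>F n in sequentially. \<forall>p. trunc_kernel r a n p \<noteq> 0 \<longrightarrow> cmod p \<le> cmod a + r"
        using supp by (intro always_eventually) auto
      show "log_kernel r (p - a) \<noteq> 0 \<Longrightarrow> cmod p \<le> cmod a + r" for p by (rule suppk)
      show "(\<lambda>n. trunc_kernel r a n p) \<longlonglongrightarrow> log_kernel r (p - a)" if "f \<omega> p = 0" for p
        using that elim(2) by (intro trunc_kernel(6)[OF r]) auto
    qed
    then have lim: "(\<lambda>n. ennreal (zero_sum (f \<omega>) (trunc_kernel r a n))) \<longlonglongrightarrow> ennreal (log_mod_excess r (f \<omega>) a)"
      unfolding log_mod_excess_eq_zero_sum[OF elim(1) r a elim(2)] by (rule tendsto_ennrealI)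
    have "incseq (\<lambda>n. ennreal (zero_sum (f \<omega>) (trunc_kernel r a n)))"
      by (rule incseq_zero_sum[OF test_fun_trunc_kernel[OF r a] trunc_kernel(5)[OF r] elim(1)])
    from LIMSEQ_unique[OF LIMSEQ_SUP[OF this] lim] show ?case .
  qed
  also have "\<dots> = ennreal (log_excess V a r / 2)" by (rule nn_integral_log_mod_excess_at[OF r a])
  finally show ?thesis .
qed

end

section \<open>Comparison on open sets and its equality case\<close>

lemma compare_zeros:
  assumes M: "gaussian_series M X V" and N: "gaussian_series N Y W" and D: "open D" "D \<subseteq> ball 0 1"
    and le: "\<And>a r. 0 < r \<Longrightarrow> cmod a + r < 1 \<Longrightarrow> log_excess V a r \<le> log_excess W a r"
  shows "expected_zeros M (random_series X) D \<le> expected_zeros N (random_series Y) D"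
  unfolding gaussian_series.expected_zeros_eq_SUP[OF M D] gaussian_series.expected_zeros_eq_SUP[OF N D]
  by (intro SUP_mono') (rule compare_zero_sum[OF M N test_fun_bump[OF D(2)] le])

text \<open>The terms in \<open>A\<close> and \<open>B\<close> agree only in the limit, so the limit
  is taken before they are cancelled. Cancellation in \<open>ennreal\<close> requires this common
  limit to be finite.\<close>

lemma ennreal_cancel_limit:
  fixes A B :: "nat \<Rightarrow> ennreal"
  assumes "\<And>k. k0 \<le> k \<Longrightarrow> n * A k + h \<le> n * B k + g" and "incseq A" "incseq B" "(SUP k. A k) = (SUP k. B k)"
    and fin: "(SUP k. B k) < \<infinity>" "n < \<infinity>"
  shows "h \<le> g"
proof -
  have "A \<longlonglongrightarrow> (SUP k. A k)" "B \<longlonglongrightarrow> (SUP k. A k)" using LIMSEQ_SUP[OF assms(2)] LIMSEQ_SUP[OF assms(3)] assms(4) by auto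
  then have "(\<lambda>k. n * A k + h) \<longlonglongrightarrow> n * (SUP k. A k) + h" "(\<lambda>k. n * B k + g) \<longlonglongrightarrow> n * (SUP k. A k) + g"
    using fin by (auto intro!: tendsto_add ennreal_tendsto_cmult tendsto_const)
  then have "n * (SUP k. A k) + h \<le> n * (SUP k. A k) + g"
    by (rule LIMSEQ_le) (use assms(1) in blast)
  moreover have "n * (SUP k. A k) < top" using fin unfolding assms(4) ennreal_mult_less_top infinity_ennreal_def by blast
  ultimately show ?thesis by (auto simp: ennreal_add_left_cancel_le)
qed

text \<open>Testing with \<open>n * bump D k - trunc_kernel r a n\<close>, which is a test function for large \<open>k\<close>, reverses the
  comparison for the truncated kernel once the expected numbers of zeros in \<open>D\<close> agree.\<close>

lemma log_excess_eq_of_expected_zeros_eq: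
  assumes M: "gaussian_series M X V" and N: "gaussian_series N Y W" and D: "open D" "closure D \<subseteq> ball 0 1"
    and le: "\<And>a r. 0 < r \<Longrightarrow> cmod a + r < 1 \<Longrightarrow> log_excess V a r \<le> log_excess W a r"
    and eq: "expected_zeros M (random_series X) D = expected_zeros N (random_series Y) D"
    and r: "0 < r" "cmod a + r < 1" and aD: "cball a r \<subseteq> D"
  shows "log_excess V a r = log_excess W a r"
proof -
  interpret A: gaussian_series M X V by fact
  interpret B: gaussian_series N Y W by fact
  have sub: "D \<subseteq> ball 0 1" using D closure_subset by blast
  have DU: "D \<noteq> UNIV" using sub by (metis bounded_ball bounded_subset not_bounded_UNIV)
  have "cball a r \<noteq> {}" using r by auto
  moreover have "continuous_on (cball a r) (\<lambda>p. infdist p (- D))" by (intro continuous_intros)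
  ultimately obtain q where q: "q \<in> cball a r" "\<And>p. p \<in> cball a r \<Longrightarrow> infdist q (- D) \<le> infdist p (- D)"
    using continuous_attains_inf[of "cball a r" "\<lambda>p. infdist p (- D)"] by (metis compact_cball)
  have d: "0 < infdist q (- D)" using D DU aD q by (intro infdist_pos_not_in_closed) auto
  then obtain k0 where k0: "2 / infdist q (- D) \<le> real k0" using real_arch_simple by blast
  \<comment> \<open>\<open>q\<close> is a point of the compact disc nearest to the complement of
    \<open>D\<close>, so from \<open>k0\<close> on the bump equals 1 on the whole disc.\<close>
  have one: "bump D k p = 1" if "k0 \<le> k" "cmod (p - a) \<le> r" for k p
  proof (rule bump_eq_1)
    have "2 \<le> real k0 * infdist q (- D)" using k0 d by (simp add: field_simps)
    also have "\<dots> \<le> real (k + 1) * infdist p (- D)"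
      using that d q(2)[of p] by (intro mult_mono) (auto simp: dist_norm norm_minus_commute)
    finally show "2 \<le> real (k + 1) * infdist p (- D)" .
  qed
  let ?A = "\<lambda>k. expected_zero_sum M X (bump D k)"
  let ?B = "\<lambda>k. expected_zero_sum N Y (bump D k)"
  let ?G = "\<lambda>n. expected_zero_sum M X (trunc_kernel r a n)"
  let ?H = "\<lambda>n. expected_zero_sum N Y (trunc_kernel r a n)"
  have "?H n \<le> ?G n" for n
  proof (rule ennreal_cancel_limit[where A = ?A and B = ?B and n = "ennreal (real n)"])
    fix k assume k: "k0 \<le> k"
    let ?\<psi> = "\<lambda>p. real n * bump D k p - trunc_kernel r a n p"
    \<comment> \<open>On \<open>cball a r\<close> the bump is 1 and the truncated kernel at most
      \<open>n\<close>; outside it the kernel vanishes. So the difference is nonnegative and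
      supported where the bump is.\<close>
    have \<psi>: "test_fun (real k / real (k + 1)) ?\<psi>"
    proof -
      have "0 \<le> ?\<psi> p" "?\<psi> p \<noteq> 0 \<Longrightarrow> bump D k p \<noteq> 0" for p
        using one[OF k, of p] trunc_kernel(2)[OF r(1), of a n p] trunc_kernel(3)[OF r(1), of a n p] bump_basic(1)[of D k p]
        by (cases "trunc_kernel r a n p = 0"; force)+
      moreover have "continuous_on UNIV ?\<psi>"
        using test_fun_bump[OF sub, of k] trunc_kernel(7)[OF r(1), of a n] by (intro continuous_intros) (auto simp: test_fun_def)
      ultimately show ?thesis using test_fun_bump[OF sub, of k] unfolding test_fun_def by blast
    qed
    have s: "(\<lambda>p. ?\<psi> p + trunc_kernel r a n p) = (\<lambda>p. real n * bump D k p)" by auto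
    have t: "test_fun (max (real k / real (k + 1)) (cmod a + r)) ?\<psi>" "test_fun (max (real k / real (k + 1)) (cmod a + r)) (trunc_kernel r a n)"
      using \<psi> A.test_fun_trunc_kernel[OF r, of n] by (auto simp: test_fun_def max.coboundedI1 max.coboundedI2)
    have a: "ennreal (real n) * ?A k = expected_zero_sum M X ?\<psi> + ?G n"
      using A.nn_integral_zero_sum_add[OF t] A.nn_integral_zero_sum_cmult[OF test_fun_bump[OF sub], of "real n" k] unfolding s by simp
    have b: "ennreal (real n) * ?B k = expected_zero_sum N Y ?\<psi> + ?H n"
      using B.nn_integral_zero_sum_add[OF t] B.nn_integral_zero_sum_cmult[OF test_fun_bump[OF sub], of "real n" k] unfolding s by simp
    \<comment> \<open>The comparison for \<open>?\<psi>\<close> with both kernel terms added to each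
      side, so that nothing is subtracted in \<open>ennreal\<close>.\<close>
    show "ennreal (real n) * ?A k + ?H n \<le> ennreal (real n) * ?B k + ?G n"
      unfolding a b using compare_zero_sum[OF M N \<psi> le] by (simp add: add_mono ac_simps)
  next
    show "incseq ?A" by (rule A.zero_sum_monotone_convergence(1)[OF test_fun_bump[OF sub] bump_mono])
    show "incseq ?B" by (rule B.zero_sum_monotone_convergence(1)[OF test_fun_bump[OF sub] bump_mono])
    show "(SUP k. ?A k) = (SUP k. ?B k)"
      using eq unfolding A.expected_zeros_eq_SUP[OF D(1) sub] B.expected_zeros_eq_SUP[OF D(1) sub] .
    show "(SUP k. ?B k) < \<infinity>"
      using B.expected_zeros_finite[OF D] unfolding B.expected_zeros_eq_SUP[OF D(1) sub] .
  qed simp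
  then have "(SUP n. ?H n) \<le> (SUP n. ?G n)" by (intro SUP_mono') 
  then have "ennreal (log_excess W a r / 2) \<le> ennreal (log_excess V a r / 2)"
    unfolding A.trunc_kernel_limit[OF r] B.trunc_kernel_limit[OF r] .
  then have "log_excess W a r \<le> log_excess V a r" using A.log_excess_nonneg[OF r] by (simp add: ennreal_le_iff)
  then show ?thesis using le[OF r] by simp
qed

section \<open>The covariance of a stationary Gaussian process\<close>

definition square_int :: "'a measure \<Rightarrow> ('a \<Rightarrow> complex) \<Rightarrow> bool" where
  "square_int M g \<longleftrightarrow> g \<in> borel_measurable M \<and> integrable M (\<lambda>\<omega>. (cmod (g \<omega>))\<^sup>2)"

lemma square_int_mult:
  assumes "square_int M g" "square_int M h"
  shows "integrable M (\<lambda>\<omega>. cnj (g \<omega>) * h \<omega>)"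
proof (rule Bochner_Integration.integrable_bound)
  have [measurable]: "g \<in> borel_measurable M" "h \<in> borel_measurable M" using assms by (auto simp: square_int_def)
  show "integrable M (\<lambda>\<omega>. (cmod (g \<omega>))\<^sup>2 + (cmod (h \<omega>))\<^sup>2)" using assms by (auto simp: square_int_def)
  have [measurable]: "cnj \<in> borel_measurable borel" by (intro borel_measurable_continuous_onI continuous_intros)
  show "(\<lambda>\<omega>. cnj (g \<omega>) * h \<omega>) \<in> borel_measurable M" by measurable
  show "AE \<omega> in M. norm (cnj (g \<omega>) * h \<omega>) \<le> norm ((cmod (g \<omega>))\<^sup>2 + (cmod (h \<omega>))\<^sup>2)"
  proof (rule AE_I2)
    fix \<omega>
    have "0 \<le> (cmod (g \<omega>) - cmod (h \<omega>))\<^sup>2" by simp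
    moreover have "0 \<le> cmod (g \<omega>) * cmod (h \<omega>)" by simp
    ultimately have "cmod (g \<omega>) * cmod (h \<omega>) \<le> (cmod (g \<omega>))\<^sup>2 + (cmod (h \<omega>))\<^sup>2"
      unfolding power2_diff by linarith
    then show "norm (cnj (g \<omega>) * h \<omega>) \<le> norm ((cmod (g \<omega>))\<^sup>2 + (cmod (h \<omega>))\<^sup>2)" by (simp add: norm_mult)
  qed
qed

lemma square_int_cmult: "square_int M g \<Longrightarrow> square_int M (\<lambda>\<omega>. c * g \<omega>)"
  by (auto simp: square_int_def norm_mult power_mult_distrib)

lemma cmod_add_sq: "(cmod (a + b))\<^sup>2 = (cmod a)\<^sup>2 + (cmod b)\<^sup>2 + 2 * Re (cnj a * b)"
  by (simp add: cmod_power2 power2_sum algebra_simps)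

lemma square_int_add:
  assumes "square_int M g" "square_int M h"
  shows "square_int M (\<lambda>\<omega>. g \<omega> + h \<omega>)"
    "(\<integral>\<omega>. (cmod (g \<omega> + h \<omega>))\<^sup>2 \<partial>M) = (\<integral>\<omega>. (cmod (g \<omega>))\<^sup>2 \<partial>M) + (\<integral>\<omega>. (cmod (h \<omega>))\<^sup>2 \<partial>M) + 2 * Re (\<integral>\<omega>. cnj (g \<omega>) * h \<omega> \<partial>M)"
proof -
  define p where "p \<omega> = cnj (g \<omega>) * h \<omega>" for \<omega>
  have p: "integrable M p" unfolding p_def by (rule square_int_mult[OF assms])
  have e: "(cmod (g \<omega> + h \<omega>))\<^sup>2 = (cmod (g \<omega>))\<^sup>2 + (cmod (h \<omega>))\<^sup>2 + 2 * Re (p \<omega>)" for \<omega>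
    by (simp only: cmod_add_sq p_def)
  show "square_int M (\<lambda>\<omega>. g \<omega> + h \<omega>)" using assms p unfolding square_int_def e by auto
  show "(\<integral>\<omega>. (cmod (g \<omega> + h \<omega>))\<^sup>2 \<partial>M) = (\<integral>\<omega>. (cmod (g \<omega>))\<^sup>2 \<partial>M) + (\<integral>\<omega>. (cmod (h \<omega>))\<^sup>2 \<partial>M) + 2 * Re (\<integral>\<omega>. cnj (g \<omega>) * h \<omega> \<partial>M)"
    using assms p unfolding e p_def[symmetric] by (simp add: square_int_def)
qed

lemma square_int_zero: "square_int M (\<lambda>\<omega>. 0)"
  by (simp add: square_int_def)

lemma square_int_sum:
  assumes "\<And>k. k \<in> J \<Longrightarrow> square_int M (g k)"
  shows "square_int M (\<lambda>\<omega>. \<Sum>k\<in>J. g k \<omega>)"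
  using assms by (induction J rule: infinite_finite_induct) (auto intro: square_int_zero square_int_add)

lemma cmod_le_one_plus_sq: "cmod x \<le> 1 + (cmod x)\<^sup>2"
proof -
  have "0 \<le> (cmod x - 1)\<^sup>2" by simp
  then have "2 * cmod x \<le> 1 + (cmod x)\<^sup>2" by (simp add: power2_diff)
  then show ?thesis using norm_ge_zero[of x] by linarith
qed

text \<open>A degenerate variable fits the same formula: being centred it vanishes almost
  everywhere, with second moment 0.\<close>

lemma (in prob_space) gaussian_rv_cis:
  assumes g: "gaussian_rv M Y" and m: "expectation Y = 0"
  shows "expectation (\<lambda>\<omega>. cis (Y \<omega>)) = of_real (exp (- expectation (\<lambda>\<omega>. (Y \<omega>)\<^sup>2) / 2))"
proof -
  have [measurable]: "Y \<in> borel_measurable M" using g by (simp add: gaussian_rv_def)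
  from g consider \<mu> where "AE \<omega> in M. Y \<omega> = \<mu>"
    | \<mu> \<sigma> where "0 < \<sigma>" "distributed M lborel Y (\<lambda>x. ennreal (normal_density \<mu> \<sigma> x))"
    by (auto simp: gaussian_rv_def)
  then show ?thesis
  proof cases
    case 1
    have "expectation Y = expectation (\<lambda>_. \<mu>)" using 1 by (intro integral_cong_AE) auto
    then have "\<mu> = 0" using m by (simp add: prob_space)
    then have A: "AE \<omega> in M. Y \<omega> = 0" using 1 by simp
    have "expectation (\<lambda>\<omega>. cis (Y \<omega>)) = expectation (\<lambda>_. 1)"
      using A by (intro integral_cong_AE) auto
    moreover have "expectation (\<lambda>\<omega>. (Y \<omega>)\<^sup>2) = expectation (\<lambda>_. 0)"
      using A by (intro integral_cong_AE) auto
    ultimately show ?thesis by (simp add: prob_space)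
  next
    case 2
    have "\<mu> = 0" using normal_distributed_expectation[OF 2] m by simp
    moreover have "\<sigma>\<^sup>2 = expectation (\<lambda>\<omega>. (Y \<omega>)\<^sup>2)" using normal_distributed_variance[OF 2] m by simp
    ultimately show ?thesis using expectation_cis_normal[OF 2(2,1), of 1] by simp
  qed
qed

locale stationary_gaussian = prob_space M for M :: "'a measure" +
  fixes \<xi> :: "int \<Rightarrow> 'a \<Rightarrow> complex"
  assumes gaussian: "complex_gaussian_process M \<xi>" and centered: "centered_process M \<xi>"
    and unit: "unit_variance_process M \<xi>" and stationary: "stationary_process M \<xi>"
begin

lemma xi_meas[measurable]: "\<xi> k \<in> borel_measurable M"
  using gaussian by (simp add: complex_gaussian_process_def)

lemma xi_sq: "(\<integral>\<omega>. (cmod (\<xi> k \<omega>))\<^sup>2 \<partial>M) = 1"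
  using unit by (simp add: unit_variance_process_def)

lemma square_int_xi: "square_int M (\<xi> k)"
  \<comment> \<open>A function that is not integrable has integral 0 by default, whereas this one
    has integral 1.\<close>
  using xi_sq[of k] not_integrable_integral_eq[of M "\<lambda>\<omega>. (cmod (\<xi> k \<omega>))\<^sup>2"] by (auto simp: square_int_def)

lemma square_int_combination: "square_int M (\<lambda>\<omega>. \<Sum>k\<in>J. c k * \<xi> (h k) \<omega>)"
  by (intro square_int_sum square_int_cmult square_int_xi)

lemma integrable_xi: "integrable M (\<xi> k)"
proof (rule Bochner_Integration.integrable_bound)
  show "integrable M (\<lambda>\<omega>. 1 + (cmod (\<xi> k \<omega>))\<^sup>2)" using square_int_xi[of k] by (auto simp: square_int_def)
  show "AE \<omega> in M. norm (\<xi> k \<omega>) \<le> norm (1 + (cmod (\<xi> k \<omega>))\<^sup>2)"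
    using cmod_le_one_plus_sq by (intro AE_I2) simp
qed simp

lemma process_meas: "(\<lambda>\<omega> k. \<xi> (h k) \<omega>) \<in> measurable M (\<Pi>\<^sub>M k\<in>UNIV. borel)"
  by (rule measurable_PiM_single') auto

lemma expectation_shift:
  fixes F :: "(int \<Rightarrow> complex) \<Rightarrow> 'b::{banach, second_countable_topology}"
  assumes [measurable]: "F \<in> borel_measurable (\<Pi>\<^sub>M k\<in>UNIV. borel)"
  shows "(\<integral>\<omega>. F (\<lambda>k. \<xi> (k + n) \<omega>) \<partial>M) = (\<integral>\<omega>. F (\<lambda>k. \<xi> k \<omega>) \<partial>M)"
proof -
  have "(\<integral>\<omega>. F (\<lambda>k. \<xi> (k + n) \<omega>) \<partial>M) = (\<integral>x. F x \<partial>process_law M (\<lambda>k. \<xi> (k + n)))"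
    unfolding process_law_def by (subst integral_distr[OF process_meas]) auto
  also have "process_law M (\<lambda>k. \<xi> (k + n)) = process_law M \<xi>" using stationary by (simp add: stationary_process_def)
  also have "(\<integral>x. F x \<partial>process_law M \<xi>) = (\<integral>\<omega>. F (\<lambda>k. \<xi> k \<omega>) \<partial>M)"
    unfolding process_law_def by (subst integral_distr[OF process_meas]) auto
  finally show ?thesis .
qed

lemma expectation_rotate:
  fixes F :: "(int \<Rightarrow> complex) \<Rightarrow> 'b::{banach, second_countable_topology}"
  assumes [measurable]: "F \<in> borel_measurable (\<Pi>\<^sub>M k\<in>UNIV. borel)"
  shows "(\<integral>\<omega>. F (\<lambda>k. cis \<theta> * \<xi> k \<omega>) \<partial>M) = (\<integral>\<omega>. F (\<lambda>k. \<xi> k \<omega>) \<partial>M)"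
proof -
  have m: "(\<lambda>\<omega> k. cis \<theta> * \<xi> k \<omega>) \<in> measurable M (\<Pi>\<^sub>M k\<in>UNIV. borel)"
    by (rule measurable_PiM_single') auto
  have "(\<integral>\<omega>. F (\<lambda>k. cis \<theta> * \<xi> k \<omega>) \<partial>M) = (\<integral>x. F x \<partial>process_law M (\<lambda>k \<omega>. cis \<theta> * \<xi> k \<omega>))"
    unfolding process_law_def by (subst integral_distr[OF m]) auto
  also have "process_law M (\<lambda>k \<omega>. cis \<theta> * \<xi> k \<omega>) = process_law M \<xi>" using gaussian by (simp add: complex_gaussian_process_def)
  also have "(\<integral>x. F x \<partial>process_law M \<xi>) = (\<integral>\<omega>. F (\<lambda>k. \<xi> k \<omega>) \<partial>M)"
    unfolding process_law_def by (subst integral_distr[OF process_meas]) auto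
  finally show ?thesis .
qed

text \<open>Circular symmetry with a quarter turn makes the real and imaginary parts of the
  combination equal in second moment, so the real part carries half of the total. This turns the 2
  of the real Gaussian formula into 4.\<close>

lemma char_combination:
  assumes J: "finite J"
  shows "expectation (\<lambda>\<omega>. cis (Re (\<Sum>k\<in>J. c k * \<xi> k \<omega>))) = of_real (exp (- expectation (\<lambda>\<omega>. (cmod (\<Sum>k\<in>J. c k * \<xi> k \<omega>))\<^sup>2) / 4))"
proof -
  let ?Y = "\<lambda>x. \<Sum>k\<in>J. c k * x k :: complex"
  have Y[measurable]: "?Y \<in> borel_measurable (\<Pi>\<^sub>M k\<in>UNIV. borel)" by measurable
  let ?Z = "\<lambda>\<omega>. \<Sum>k\<in>J. c k * \<xi> k \<omega>"
  have "gaussian_rv M (\<lambda>\<omega>. \<Sum>k\<in>J. Re (c k) * Re (\<xi> k \<omega>) + (- Im (c k)) * Im (\<xi> k \<omega>))"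
    using gaussian J unfolding complex_gaussian_process_def
    by (elim conjE allE[of _ J] allE[of _ "\<lambda>k. Re (c k)"] allE[of _ "\<lambda>k. - Im (c k)"]) blast
  then have g: "gaussian_rv M (\<lambda>\<omega>. Re (?Z \<omega>))" by (simp add: Re_sum)
  have iZ: "integrable M ?Z" by (intro Bochner_Integration.integrable_sum integrable_mult_right integrable_xi)
  have "(\<integral>\<omega>. ?Z \<omega> \<partial>M) = (\<Sum>k\<in>J. c k * (\<integral>\<omega>. \<xi> k \<omega> \<partial>M))"
    by (subst Bochner_Integration.integral_sum) (auto intro: integrable_xi)
  also have "\<dots> = 0" using centered by (simp add: centered_process_def)
  finally have m: "expectation (\<lambda>\<omega>. Re (?Z \<omega>)) = 0" using integral_Re[OF iZ] by (simp del: Re_sum)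
  have sZ: "integrable M (\<lambda>\<omega>. (cmod (?Z \<omega>))\<^sup>2)" using square_int_combination[of c id J] by (simp add: square_int_def)
  have mZ[measurable]: "?Z \<in> borel_measurable M" by measurable
  have sR: "integrable M (\<lambda>\<omega>. (Re (?Z \<omega>))\<^sup>2)"
    by (rule Bochner_Integration.integrable_bound[OF sZ]) (auto simp: cmod_power2 simp del: Re_sum)
  have sI: "integrable M (\<lambda>\<omega>. (Im (?Z \<omega>))\<^sup>2)"
    by (rule Bochner_Integration.integrable_bound[OF sZ]) (auto simp: cmod_power2 simp del: Im_sum)
  have "expectation (\<lambda>\<omega>. (Re (?Y (\<lambda>k. cis (pi/2) * \<xi> k \<omega>)))\<^sup>2) = expectation (\<lambda>\<omega>. (Re (?Z \<omega>))\<^sup>2)"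
    by (rule expectation_rotate[where F="\<lambda>x. (Re (?Y x))\<^sup>2"]) measurable
  moreover have "?Y (\<lambda>k. cis (pi/2) * \<xi> k \<omega>) = \<i> * ?Z \<omega>" for \<omega>
    by (simp add: sum_distrib_left ac_simps)
  ultimately have "expectation (\<lambda>\<omega>. (Im (?Z \<omega>))\<^sup>2) = expectation (\<lambda>\<omega>. (Re (?Z \<omega>))\<^sup>2)"
    by (simp del: Re_sum Im_sum)
  moreover have "expectation (\<lambda>\<omega>. (cmod (?Z \<omega>))\<^sup>2) = expectation (\<lambda>\<omega>. (Re (?Z \<omega>))\<^sup>2) + expectation (\<lambda>\<omega>. (Im (?Z \<omega>))\<^sup>2)"
    unfolding cmod_power2 using sR sI by (rule Bochner_Integration.integral_add)
  ultimately have "expectation (\<lambda>\<omega>. (cmod (?Z \<omega>))\<^sup>2) / 4 = expectation (\<lambda>\<omega>. (Re (?Z \<omega>))\<^sup>2) / 2" by simp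
  with gaussian_rv_cis[OF g m] show ?thesis by (simp del: Re_sum)
qed

text \<open>This is the complex conjugate of \<gamma>(k), hence the k-th coefficient of the power
  series G.\<close>

definition covariance :: "nat \<Rightarrow> complex" where
  "covariance k = (\<integral>\<omega>. cnj (\<xi> 0 \<omega>) * \<xi> (int k) \<omega> \<partial>M)"

lemma covariance_shift: "(\<integral>\<omega>. cnj (\<xi> n \<omega>) * \<xi> (n + int k) \<omega> \<partial>M) = covariance k"
proof -
  have [measurable]: "cnj \<in> borel_measurable borel" by (intro borel_measurable_continuous_onI continuous_intros)
  show ?thesis
    using expectation_shift[of "\<lambda>x. cnj (x 0) * x (int k)" n] by (simp add: covariance_def add.commute)
qed

lemma covariance_bound: "cmod (covariance k) \<le> 1"
proof -
  have i: "integrable M (\<lambda>\<omega>. cnj (\<xi> 0 \<omega>) * \<xi> (int k) \<omega>)" by (rule square_int_mult[OF square_int_xi square_int_xi])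
  have "cmod (covariance k) \<le> (\<integral>\<omega>. cmod (cnj (\<xi> 0 \<omega>) * \<xi> (int k) \<omega>) \<partial>M)"
    unfolding covariance_def by (rule integral_norm_bound)
  also have "\<dots> \<le> (\<integral>\<omega>. ((cmod (\<xi> 0 \<omega>))\<^sup>2 + (cmod (\<xi> (int k) \<omega>))\<^sup>2) / 2 \<partial>M)"
  proof (rule integral_mono)
    show "integrable M (\<lambda>\<omega>. ((cmod (\<xi> 0 \<omega>))\<^sup>2 + (cmod (\<xi> (int k) \<omega>))\<^sup>2) / 2)"
      using square_int_xi by (auto simp: square_int_def)
    fix \<omega>
    have "0 \<le> (cmod (\<xi> 0 \<omega>) - cmod (\<xi> (int k) \<omega>))\<^sup>2" by simp
    then show "cmod (cnj (\<xi> 0 \<omega>) * \<xi> (int k) \<omega>) \<le> ((cmod (\<xi> 0 \<omega>))\<^sup>2 + (cmod (\<xi> (int k) \<omega>))\<^sup>2) / 2"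
      by (simp add: norm_mult power2_diff)
  qed (use i in auto)
  also have "\<dots> = 1" using square_int_xi by (simp add: square_int_def xi_sq)
  finally show ?thesis .
qed

definition partial_sum_var :: "nat \<Rightarrow> complex \<Rightarrow> real" where
  "partial_sum_var n z = (\<integral>\<omega>. (cmod (\<Sum>k<n. z ^ k * \<xi> (int k) \<omega>))\<^sup>2 \<partial>M)"

lemma partial_sum_var_nonneg: "0 \<le> partial_sum_var n z"
  by (simp add: partial_sum_var_def)

text \<open>Splitting off the constant coefficient and shifting the others by stationarity.\<close>

lemma partial_sum_var_Suc: "partial_sum_var (Suc n) z = (cmod z)\<^sup>2 * partial_sum_var n z + (1 + 2 * Re (\<Sum>k<n. covariance (Suc k) * z ^ Suc k))"
proof -
  let ?Y = "\<lambda>\<omega>. \<Sum>k<n. z ^ Suc k * \<xi> (int (Suc k)) \<omega>"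
  have "(\<integral>\<omega>. (cmod (?Y \<omega>))\<^sup>2 \<partial>M) = (\<integral>\<omega>. (cmod z)\<^sup>2 * (cmod (\<Sum>k<n. z ^ k * \<xi> (int k + 1) \<omega>))\<^sup>2 \<partial>M)"
    by (intro Bochner_Integration.integral_cong refl)
       (simp add: sum_distrib_left ac_simps flip: power_mult_distrib norm_mult)
  also have "\<dots> = (cmod z)\<^sup>2 * partial_sum_var n z"
    using expectation_shift[of "\<lambda>x. (cmod (\<Sum>k<n. z ^ k * x (int k)))\<^sup>2" 1] by (simp add: partial_sum_var_def)
  finally have 1: "(\<integral>\<omega>. (cmod (?Y \<omega>))\<^sup>2 \<partial>M) = (cmod z)\<^sup>2 * partial_sum_var n z" .
  have "(\<integral>\<omega>. cnj (\<xi> 0 \<omega>) * ?Y \<omega> \<partial>M) = (\<integral>\<omega>. (\<Sum>k<n. z ^ Suc k * (cnj (\<xi> 0 \<omega>) * \<xi> (int (Suc k)) \<omega>)) \<partial>M)"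
    by (simp add: sum_distrib_left ac_simps)
  also have "\<dots> = (\<Sum>k<n. z ^ Suc k * covariance (Suc k))"
    unfolding covariance_def by (subst Bochner_Integration.integral_sum) (auto intro!: square_int_mult square_int_xi simp del: of_nat_Suc power_Suc)
  finally have 2: "(\<integral>\<omega>. cnj (\<xi> 0 \<omega>) * ?Y \<omega> \<partial>M) = (\<Sum>k<n. covariance (Suc k) * z ^ Suc k)" by (simp add: mult.commute)
  have sY: "square_int M ?Y" by (rule square_int_combination)
  have "partial_sum_var (Suc n) z = (\<integral>\<omega>. (cmod (\<xi> 0 \<omega> + ?Y \<omega>))\<^sup>2 \<partial>M)"
    unfolding partial_sum_var_def by (subst sum.lessThan_Suc_shift) simp
  then show ?thesis using square_int_add(2)[OF square_int_xi sY, of 0] 1 2 xi_sq[of 0] by simp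
qed

lemma char_partial_sum:
  "expectation (\<lambda>\<omega>. cis (Re (w * (\<Sum>k<n. \<xi> (int k) \<omega> * z ^ k)))) = of_real (exp (- ((cmod w)\<^sup>2 * partial_sum_var n z) / 4))"
proof -
  have s: "(\<Sum>k\<in>int ` {..<n}. w * z ^ nat k * \<xi> k \<omega>) = w * (\<Sum>k<n. \<xi> (int k) \<omega> * z ^ k)" for \<omega>
    by (subst sum.reindex) (auto simp: sum_distrib_left ac_simps)
  have "expectation (\<lambda>\<omega>. (cmod (w * (\<Sum>k<n. \<xi> (int k) \<omega> * z ^ k)))\<^sup>2) = (cmod w)\<^sup>2 * partial_sum_var n z"
    unfolding partial_sum_var_def norm_mult power_mult_distrib by (simp add: mult.commute)
  then show ?thesis using char_combination[of "int ` {..<n}" "\<lambda>k. w * z ^ nat k"] unfolding s by simp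
qed

end

text \<open>The error satisfies a contraction with a perturbation tending to 0. With
  \<open>q = (cmod z)\<^sup>2\<close> and \<open>S\<close> the variance of the partial sums, the
  fixed point is the covariance kernel on the diagonal.\<close>

lemma recursion_limit:
  fixes S :: "nat \<Rightarrow> real"
  assumes S: "\<And>n. S (Suc n) = q * S n + b n" and b: "b \<longlonglongrightarrow> B" and q: "0 \<le> q" "q < 1"
  shows "S \<longlonglongrightarrow> B / (1 - q)"
proof -
  define e where "e n = \<bar>S n - B / (1 - q)\<bar>" for n
  define d where "d n = \<bar>b n - B\<bar>" for n
  have d: "d \<longlonglongrightarrow> 0" unfolding d_def using b by (simp add: LIM_zero tendsto_rabs_zero)
  have e_Suc: "e (Suc n) \<le> q * e n + d n" for n
  proof -
    have "S (Suc n) - B / (1 - q) = q * (S n - B / (1 - q)) + (b n - B)"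
      using q by (simp add: S field_simps)
    then show ?thesis unfolding e_def d_def using q abs_triangle_ineq[of "q * (S n - B / (1 - q))" "b n - B"] by (simp add: abs_mult)
  qed
  have e0: "0 \<le> e n" for n by (simp add: e_def)
  have "e \<longlonglongrightarrow> 0"
  proof (rule LIMSEQ_I)
    fix \<epsilon> :: real assume \<epsilon>: "0 < \<epsilon>"
    then have "0 < \<epsilon> * (1 - q) / 2" using q by simp
    then have "\<forall>\<^sub>F n in sequentially. d n < \<epsilon> * (1 - q) / 2" by (rule order_tendstoD(2)[OF d])
    then obtain N where N: "\<And>n. N \<le> n \<Longrightarrow> d n < \<epsilon> * (1 - q) / 2" by (auto simp: eventually_sequentially)
    have bound: "e (N + m) \<le> q ^ m * e N + \<epsilon> / 2" for m
    proof (induction m)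
      case 0
      then show ?case using \<epsilon> by simp
    next
      case (Suc m)
      have "e (N + Suc m) \<le> q * e (N + m) + \<epsilon> * (1 - q) / 2" using e_Suc[of "N + m"] N[of "N + m"] by simp
      also have "\<dots> \<le> q * (q ^ m * e N + \<epsilon> / 2) + \<epsilon> * (1 - q) / 2" using Suc q by (intro add_right_mono mult_left_mono) auto
      also have "\<dots> = q ^ Suc m * e N + \<epsilon> / 2" by (simp add: field_simps)
      finally show ?case .
    qed
    have "(\<lambda>m. q ^ m * e N) \<longlonglongrightarrow> 0 * e N" using q by (intro tendsto_mult LIMSEQ_power_zero tendsto_const) auto
    then have "\<forall>\<^sub>F m in sequentially. q ^ m * e N < \<epsilon> / 2" using \<epsilon> by (intro order_tendstoD(2)) auto
    then obtain K where K: "\<And>m. K \<le> m \<Longrightarrow> q ^ m * e N < \<epsilon> / 2" by (auto simp: eventually_sequentially)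
    show "\<exists>n0. \<forall>n\<ge>n0. norm (e n - 0) < \<epsilon>"
    proof (intro exI[of _ "N + K"] allI impI)
      fix n assume "N + K \<le> n"
      then have "n = N + (n - N)" "K \<le> n - N" by auto
      then have "e n < \<epsilon>" using bound[of "n - N"] K[of "n - N"] by simp
      then show "norm (e n - 0) < \<epsilon>" using e0[of n] by simp
    qed
  qed
  then show ?thesis unfolding e_def using LIM_zero_cancel tendsto_rabs_zero_iff by blast
qed

section \<open>Open mapping and positive harmonic functions\<close>

lemma Re_constant_imp_constant:
  assumes g: "g holomorphic_on S" and S: "open S" "connected S" and c: "\<And>z. z \<in> S \<Longrightarrow> Re (g z) = c"
  shows "g constant_on S"
proof (rule ccontr)
  assume n: "\<not> g constant_on S"
  then obtain z where z: "z \<in> S" by (force simp: constant_on_def)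
  have "open (g ` S)" by (rule open_mapping_thm[OF g S S(1) _ n]) auto
  then obtain e where e: "0 < e" "ball (g z) e \<subseteq> g ` S" using z by (meson imageI open_contains_ball)
  \<comment> \<open>An open image contains points displaced in the real direction, where the real
    part differs from \<open>c\<close>.\<close>
  have "g z + of_real (e / 2) \<in> ball (g z) e" using e by (simp add: dist_norm)
  then obtain y where "y \<in> S" "g z + of_real (e / 2) = g y" using e by blast
  then have "Re (g z) + e / 2 = Re (g y)" by (metis Re_complex_of_real plus_complex.simps(1))
  then show False using c[OF z] c[OF \<open>y \<in> S\<close>] e by simp
qed

text \<open>The minimum principle: by the open mapping theorem a nonconstant \<open>g\<close> takes
  values with smaller real part near each of its values, so the real part cannot be 0 while staying
  nonnegative.\<close>

lemma Re_pos_of_nonneg: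
  assumes g: "g holomorphic_on S" and S: "open S" "connected S" and c: "\<And>z. z \<in> S \<Longrightarrow> 0 \<le> Re (g z)"
    and a: "a \<in> S" "0 < Re (g a)" and z: "z \<in> S"
  shows "0 < Re (g z)"
proof (cases "g constant_on S")
  case True
  then show ?thesis using a z unfolding constant_on_def by metis
next
  case n: False
  have "open (g ` S)" by (rule open_mapping_thm[OF g S S(1) _ n]) auto
  then obtain e where e: "0 < e" "ball (g z) e \<subseteq> g ` S" using z by (meson imageI open_contains_ball)
  have "g z - of_real (e / 2) \<in> ball (g z) e" using e by (simp add: dist_norm)
  then obtain y where "y \<in> S" "g z - of_real (e / 2) = g y" using e by blast
  then have "Re (g z) - e / 2 = Re (g y)" by (metis Re_complex_of_real minus_complex.simps(1))
  then show ?thesis using c[OF \<open>y \<in> S\<close>] e by simp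
qed

text \<open>The angles with nonzero value form an open null set, which must be empty. The endpoints
  are left out to keep that set open.\<close>

lemma circ_AE_eq_continuous:
  fixes u :: "real \<Rightarrow> real"
  assumes u: "continuous_on UNIV u" and AE: "AE \<theta> in circ. u \<theta> = 0" and \<theta>: "0 < \<theta>" "\<theta> < 2 * pi"
  shows "u \<theta> = 0"
proof (rule ccontr)
  assume n: "u \<theta> \<noteq> 0"
  let ?S = "{0<..<2*pi} \<inter> u -` (- {0})"
  have o: "open ?S" using u by (intro open_Int continuous_open_vimage) (auto simp: continuous_on_eq_continuous_at)
  have "AE x in lborel. 0 < ennreal (indicator {0..2*pi} x / (2*pi)) \<longrightarrow> u x = 0"
    using AE u unfolding circ_def by (subst (asm) AE_density) auto
  then have "AE x in lborel. x \<notin> ?S"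
    by eventually_elim (auto simp: indicator_def split: if_splits)
  then have "?S \<in> null_sets lborel" using o by (subst (asm) AE_iff_null_sets[symmetric]) auto
  then have "negligible ?S" by (metis null_sets_completionI negligible_iff_null_sets)
  moreover have "\<theta> \<in> ?S" using n \<theta> by simp
  ultimately show False using open_not_negligible[OF o] by blast
qed

lemma positive_harmonic_log_excess:
  assumes g: "g holomorphic_on ball 0 1" and pos: "\<And>z. z \<in> ball 0 1 \<Longrightarrow> 0 < Re (g z)"
    and r: "0 < r" and a: "cmod a + r < 1"
  shows "integrable circ (\<lambda>\<theta>. ln (Re (g (a + of_real r * cis \<theta>))))" "log_excess (\<lambda>z. Re (g z)) a r \<le> 0"
    "log_excess (\<lambda>z. Re (g z)) a r = 0 \<Longrightarrow> 0 < \<theta> \<Longrightarrow> \<theta> < 2 * pi \<Longrightarrow> Re (g (a + of_real r * cis \<theta>)) = Re (g a)"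
proof -
  note in_ball = circle_in_disc[OF r a]
  have a_ball: "a \<in> ball 0 1" using r a by simp
  note sub = cball_in_disc[OF a]
  let ?h = "\<lambda>\<theta>. Re (g (a + of_real r * cis \<theta>))"
  let ?H = "Re (g a)"
  have H: "0 < ?H" by (rule pos[OF a_ball])
  have hp: "0 < ?h \<theta>" for \<theta> by (rule pos[OF in_ball])
  have cont: "continuous_on UNIV (\<lambda>\<theta>. g (a + of_real r * cis \<theta>))"
    by (rule continuous_on_compose2[OF holomorphic_on_imp_continuous_on[OF g]]) (use in_ball in \<open>auto intro!: continuous_intros\<close>)
  have "continuous_on (cball a r) g" using g sub by (meson holomorphic_on_imp_continuous_on continuous_on_subset)
  moreover have "g holomorphic_on ball a r" using g sub by (meson holomorphic_on_subset ball_subset_cball order_trans)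
  ultimately have mv: "integrable circ (\<lambda>\<theta>. g (a + of_real r * cis \<theta>))" "(\<integral>\<theta>. g (a + of_real r * cis \<theta>) \<partial>circ) = g a"
    using circ_mean_value r by auto
  have ih: "integrable circ ?h" and mh: "(\<integral>\<theta>. ?h \<theta> \<partial>circ) = ?H" using mv by auto
  have contln: "continuous_on UNIV (\<lambda>\<theta>. ln (?h \<theta>))"
    using cont hp by (intro continuous_on_ln continuous_intros) (auto simp: less_imp_neq[THEN not_sym])
  show iln: "integrable circ (\<lambda>\<theta>. ln (?h \<theta>))" by (rule circ_integrable_continuous[OF contln])
  \<comment> \<open>The gap in the tangent inequality \<open>ln x \<le> x - 1\<close> at
    \<open>x = ?h \<theta> / ?H\<close>. By the mean value property the linear part has mean 0, so
    the gap has mean minus the excess; equality forces \<open>x = 1\<close>.\<close>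
  let ?u = "\<lambda>\<theta>. ln ?H + (?h \<theta> / ?H - 1) - ln (?h \<theta>)"
  have u0: "0 \<le> ?u \<theta>" for \<theta>
  proof -
    have "ln (?h \<theta> / ?H) \<le> ?h \<theta> / ?H - 1" using hp H by (intro ln_le_minus_one) simp
    then show ?thesis using hp[of \<theta>] H by (simp add: ln_div)
  qed
  have iu: "integrable circ ?u" using ih iln by simp
  have "(\<integral>\<theta>. ?u \<theta> \<partial>circ) = ln ?H + ((\<integral>\<theta>. ?h \<theta> \<partial>circ) / ?H - 1) - (\<integral>\<theta>. ln (?h \<theta>) \<partial>circ)"
    using ih iln by simp
  then have I: "(\<integral>\<theta>. ?u \<theta> \<partial>circ) = - log_excess (\<lambda>z. Re (g z)) a r" unfolding mh log_excess_def using H by simp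
  have "0 \<le> (\<integral>\<theta>. ?u \<theta> \<partial>circ)" using u0 by (intro Bochner_Integration.integral_nonneg)
  then show "log_excess (\<lambda>z. Re (g z)) a r \<le> 0" unfolding I by simp
  assume "log_excess (\<lambda>z. Re (g z)) a r = 0" and \<theta>: "0 < \<theta>" "\<theta> < 2 * pi"
  then have "(\<integral>\<theta>. ?u \<theta> \<partial>circ) = 0" unfolding I by simp
  then have "AE \<theta> in circ. ?u \<theta> = 0" using integral_nonneg_eq_0_iff_AE[OF iu] u0 by simp
  then have "?u \<theta> = 0"
    by (rule circ_AE_eq_continuous[rotated]) (use \<theta> H in \<open>auto intro!: continuous_intros cont contln\<close>)
  then have "ln (?h \<theta> / ?H) = ?h \<theta> / ?H - 1" using hp[of \<theta>] H by (simp add: ln_div)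
  then have "?h \<theta> / ?H = 1" using hp[of \<theta>] H by (intro ln_eq_minus_one) auto
  then show "?h \<theta> = ?H" using H by simp
qed

text \<open>The partial sums converge on almost every path and characters are bounded by 1, so the
  characteristic functions converge by dominated convergence.\<close>

lemma gaussian_seriesI:
  assumes M: "prob_space M" and [measurable]: "\<And>k. X k \<in> borel_measurable M"
    and bound: "\<exists>C. \<forall>k. (\<integral>\<^sup>+\<omega>. ennreal (cmod (X k \<omega>)) \<partial>M) \<le> ennreal C"
    and S: "\<And>n w z. (\<integral>\<omega>. cis (Re (w * (\<Sum>k<n. X k \<omega> * z ^ k))) \<partial>M) = of_real (exp (- ((cmod w)\<^sup>2 * S n z) / 4))"
    and lim: "\<And>z. z \<in> ball 0 1 \<Longrightarrow> (\<lambda>n. S n z) \<longlonglongrightarrow> V z"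
    and V: "\<And>z. z \<in> ball 0 1 \<Longrightarrow> 0 < V z" "continuous_on (ball 0 1) V"
  shows "gaussian_series M X V"
proof -
  interpret prob_space M by fact
  show ?thesis
  proof
    fix w z :: complex assume z: "z \<in> ball 0 1"
    have "(\<lambda>n. \<integral>\<omega>. cis (Re (w * (\<Sum>k<n. X k \<omega> * z ^ k))) \<partial>M) \<longlonglongrightarrow> (\<integral>\<omega>. cis (Re (w * random_series X \<omega> z)) \<partial>M)"
    proof (rule integral_dominated_convergence[where w="\<lambda>_. 1"])
      show "AE \<omega> in M. (\<lambda>n. cis (Re (w * (\<Sum>k<n. X k \<omega> * z ^ k)))) \<longlonglongrightarrow> cis (Re (w * random_series X \<omega> z))"
        using AE_summable_coefficients[of X, OF assms(2) bound]
      proof eventually_elim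
        case (elim \<omega>)
        have "(\<lambda>k. X k \<omega> * z ^ k) sums random_series X \<omega> z"
          by (rule random_series_holomorphic(2)) (use elim z in auto)
        moreover have "continuous_on UNIV cis" by (intro continuous_intros)
        then have "isCont cis x" for x by (simp add: continuous_on_eq_continuous_at)
        ultimately show ?case unfolding sums_def
          by (intro isCont_tendsto_compose[of _ cis] tendsto_Re tendsto_mult tendsto_const)
      qed
    qed auto
    moreover have "(\<lambda>n. complex_of_real (exp (- ((cmod w)\<^sup>2 * S n z) / 4))) \<longlonglongrightarrow> of_real (exp (- ((cmod w)\<^sup>2 * V z) / 4))"
      by (intro tendsto_intros lim[OF z]) auto
    ultimately show "expectation (\<lambda>\<omega>. cis (Re (w * random_series X \<omega> z))) = of_real (exp (- ((cmod w)\<^sup>2 * V z) / 4))"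
      unfolding S by (rule LIMSEQ_unique)
  qed (use assms in auto)
qed

section \<open>Variances of the two series\<close>

definition pv_variance :: "complex \<Rightarrow> real" where
  "pv_variance z = 1 / (1 - (cmod z)\<^sup>2)"

lemma pv_variance: "z \<in> ball 0 1 \<Longrightarrow> 0 < pv_variance z" "continuous_on (ball 0 1) pv_variance" "z \<in> ball 0 1 \<Longrightarrow> 0 < 1 - (cmod z)\<^sup>2"
proof -
  show p: "0 < 1 - (cmod z)\<^sup>2" if "z \<in> ball 0 1" for z :: complex
    using that by (simp add: power_less_one_iff)
  then show "z \<in> ball 0 1 \<Longrightarrow> 0 < pv_variance z" by (simp add: pv_variance_def)
  show "continuous_on (ball 0 1) pv_variance" unfolding pv_variance_def[abs_def]
    using p by (intro continuous_intros) (metis less_irrefl)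
qed

lemma iid_std_complex_gaussian_law:
  assumes "iid_std_complex_gaussian N \<zeta>"
  shows "\<zeta> k \<in> borel_measurable N" "distr N borel (\<zeta> k) = complex_normal"
proof -
  have D: "distributed N lborel (\<zeta> k) (\<lambda>z. ennreal (exp (- (cmod z)\<^sup>2) / pi))"
    using assms by (simp add: iid_std_complex_gaussian_def)
  show "\<zeta> k \<in> borel_measurable N" using distributed_measurable[OF D] by simp
  show "distr N borel (\<zeta> k) = complex_normal"
    using distributed_distr_eq_density[OF D] unfolding complex_normal_def by (metis distr_cong sets_lborel)
qed

lemma iid_char:
  assumes N: "prob_space N" and iid: "iid_std_complex_gaussian N \<zeta>" and J: "finite J"
  shows "(\<integral>\<omega>. cis (Re (\<Sum>k\<in>J. c k * \<zeta> k \<omega>)) \<partial>N) = of_real (exp (- (\<Sum>k\<in>J. (cmod (c k))\<^sup>2) / 4))"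
proof -
  interpret prob_space N by fact
  have ind: "indep_vars (\<lambda>_. borel) \<zeta> UNIV" using iid by (simp add: iid_std_complex_gaussian_def)
  note [measurable] = iid_std_complex_gaussian_law(1)[OF iid] and law = iid_std_complex_gaussian_law(2)[OF iid]
  have one: "(\<integral>\<omega>. cis (Re (c k * \<zeta> k \<omega>)) \<partial>N) = of_real (exp (- (cmod (c k))\<^sup>2 / 4))" for k
    unfolding complex_normal_cis[symmetric] law[of k, symmetric] by (subst integral_distr) auto
  have ind2: "indep_vars (\<lambda>_. borel) (\<lambda>k \<omega>. cis (Re (c k * \<zeta> k \<omega>))) J"
    using indep_vars_compose2[OF indep_vars_subset[OF ind subset_UNIV], of J "\<lambda>k z. cis (Re (c k * z))" "\<lambda>_. borel"] by auto
  have "cis (\<Sum>k\<in>J. x k) = (\<Prod>k\<in>J. cis (x k))" for x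
    using J by (induction J rule: finite_induct) (auto simp: cis_mult[symmetric])
  then have "(\<integral>\<omega>. cis (Re (\<Sum>k\<in>J. c k * \<zeta> k \<omega>)) \<partial>N) = (\<integral>\<omega>. (\<Prod>k\<in>J. cis (Re (c k * \<zeta> k \<omega>))) \<partial>N)"
    by (simp only: Re_sum)
  also have "\<dots> = (\<Prod>k\<in>J. \<integral>\<omega>. cis (Re (c k * \<zeta> k \<omega>)) \<partial>N)"
    by (rule indep_vars_lebesgue_integral[OF J ind2]) (rule integrable_const_bound[of _ 1], auto)
  also have "\<dots> = of_real (\<Prod>k\<in>J. exp (- (cmod (c k))\<^sup>2 / 4))" unfolding one by simp
  also have "(\<Prod>k\<in>J. exp (- (cmod (c k))\<^sup>2 / 4)) = exp (- (\<Sum>k\<in>J. (cmod (c k))\<^sup>2) / 4)"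
    using J by (simp add: exp_sum[symmetric] sum_negf sum_divide_distrib)
  finally show ?thesis .
qed

lemma gaussian_series_PV:
  assumes N: "prob_space N" and iid: "iid_std_complex_gaussian N \<zeta>"
  shows "gaussian_series N \<zeta> pv_variance"
proof (rule gaussian_seriesI[OF N, where S="\<lambda>n z. \<Sum>k<n. ((cmod z)\<^sup>2) ^ k"])
  interpret prob_space N by fact
  note law = iid_std_complex_gaussian_law(2)[OF iid]
  show m[measurable]: "\<zeta> k \<in> borel_measurable N" for k by (rule iid_std_complex_gaussian_law(1)[OF iid])
  have "(\<integral>\<^sup>+z. ennreal (cmod z) \<partial>complex_normal) < \<infinity>"
  proof -
    have f: "(\<integral>\<^sup>+x. ennreal \<bar>x\<bar> \<partial>half_var_normal) < \<infinity>"
      using integrable_half_var_normal_id by (simp add: integrable_iff_bounded)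
    have "(\<integral>\<^sup>+z. ennreal (cmod z) \<partial>complex_normal) = (\<integral>\<^sup>+p. ennreal (cmod (of_real (fst p) + \<i> * of_real (snd p))) \<partial>(half_var_normal \<Otimes>\<^sub>M half_var_normal))"
      unfolding complex_normal_eq by (subst nn_integral_distr) (auto simp: case_prod_unfold)
    also have "\<dots> \<le> (\<integral>\<^sup>+p. ennreal \<bar>fst p\<bar> + ennreal \<bar>snd p\<bar> \<partial>(half_var_normal \<Otimes>\<^sub>M half_var_normal))"
    proof (rule nn_integral_mono)
      fix p :: "real \<times> real"
      have "cmod (of_real (fst p) + \<i> * of_real (snd p)) \<le> \<bar>fst p\<bar> + \<bar>snd p\<bar>"
        using norm_triangle_ineq[of "complex_of_real (fst p)" "\<i> * complex_of_real (snd p)"] by (simp add: norm_mult)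
      then show "ennreal (cmod (of_real (fst p) + \<i> * of_real (snd p))) \<le> ennreal \<bar>fst p\<bar> + ennreal \<bar>snd p\<bar>"
        by (simp add: ennreal_plus[symmetric] ennreal_leI del: ennreal_plus)
    qed
    also have "\<dots> = (\<integral>\<^sup>+x. \<integral>\<^sup>+y. ennreal \<bar>x\<bar> + ennreal \<bar>y\<bar> \<partial>half_var_normal \<partial>half_var_normal)"
      by (subst half_var_normal.nn_integral_fst[symmetric]) auto
    also have "\<dots> = (\<integral>\<^sup>+x. ennreal \<bar>x\<bar> \<partial>half_var_normal) + (\<integral>\<^sup>+x. ennreal \<bar>x\<bar> \<partial>half_var_normal)"
      using half_var_normal.emeasure_space_1 by (simp add: nn_integral_add)
    also have "\<dots> < \<infinity>" using f by simp
    finally show ?thesis .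
  qed
  moreover have "(\<integral>\<^sup>+\<omega>. ennreal (cmod (\<zeta> k \<omega>)) \<partial>N) = (\<integral>\<^sup>+z. ennreal (cmod z) \<partial>complex_normal)" for k
    unfolding law[of k, symmetric] by (subst nn_integral_distr) auto
  ultimately show "\<exists>C. \<forall>k. (\<integral>\<^sup>+\<omega>. ennreal (cmod (\<zeta> k \<omega>)) \<partial>N) \<le> ennreal C"
    by (intro exI[of _ "enn2real (\<integral>\<^sup>+z. ennreal (cmod z) \<partial>complex_normal)"]) simp
  show "(\<integral>\<omega>. cis (Re (w * (\<Sum>k<n. \<zeta> k \<omega> * z ^ k))) \<partial>N) = of_real (exp (- ((cmod w)\<^sup>2 * (\<Sum>k<n. ((cmod z)\<^sup>2) ^ k)) / 4))" for n w z
  proof -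
    have s: "w * (\<Sum>k<n. \<zeta> k \<omega> * z ^ k) = (\<Sum>k<n. (w * z ^ k) * \<zeta> k \<omega>)" for \<omega>
      by (simp add: sum_distrib_left ac_simps)
    show ?thesis unfolding s iid_char[OF N iid finite_lessThan]
      by (simp add: norm_mult norm_power power_mult_distrib sum_distrib_left power_mult[symmetric] mult.commute)
  qed
  show "(\<lambda>n. \<Sum>k<n. ((cmod z)\<^sup>2) ^ k) \<longlonglongrightarrow> pv_variance z" if "z \<in> ball 0 1" for z
    using geometric_sums[of "(cmod z)\<^sup>2"] pv_variance(3)[OF that] by (simp add: sums_def pv_variance_def)
qed (use pv_variance in auto)

text \<open>The logarithm separates the two factors of the variance, so comparing the two series
  amounts to finding the sign of the excess of the harmonic factor.\<close>

lemma log_excess_pv_variance_mult: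
  assumes g: "g holomorphic_on ball 0 1" and pos: "\<And>z. z \<in> ball 0 1 \<Longrightarrow> 0 < Re (g z)"
    and r: "0 < r" and a: "cmod a + r < 1"
  shows "log_excess (\<lambda>z. Re (g z) * pv_variance z) a r = log_excess (\<lambda>z. Re (g z)) a r + log_excess pv_variance a r"
proof -
  note in_ball = circle_in_disc[OF r a]
  have a_ball: "a \<in> ball 0 1" using r a by simp
  have l: "ln (Re (g z) * pv_variance z) = ln (Re (g z)) + ln (pv_variance z)" if "z \<in> ball 0 1" for z
    using pos[OF that] pv_variance(1)[OF that] by (simp add: ln_mult)
  have "integrable circ (\<lambda>\<theta>. ln (pv_variance (a + of_real r * cis \<theta>)))"
  proof (rule circ_integrable_continuous, intro continuous_on_ln continuous_on_compose2[OF pv_variance(2)] continuous_intros)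
    show "(\<lambda>\<theta>. a + of_real r * cis \<theta>) ` UNIV \<subseteq> ball 0 1" using in_ball by blast
    show "\<forall>\<theta>\<in>UNIV. pv_variance (a + of_real r * cis \<theta>) \<noteq> 0" using pv_variance(1)[OF in_ball] by (metis less_irrefl)
  qed
  then show ?thesis unfolding log_excess_def l[OF in_ball] l[OF a_ball]
    using positive_harmonic_log_excess(1)[OF g pos r a] by simp
qed

text \<open>Evaluating the power series at all points of the disc is one measurable map of the
  coefficient sequence, and laws are carried over by it.\<close>

lemma law_on_disc_of_process_law:
  assumes [measurable]: "\<And>k. X k \<in> borel_measurable M" "\<And>k. Y k \<in> borel_measurable N"
    and eq: "process_law M X = process_law N Y"
  shows "law_on_disc M (random_series X) = law_on_disc N (random_series Y)"
proof -
  define \<Phi> where "\<Phi> x = (\<lambda>z\<in>ball 0 1. \<Sum>k. x k * z ^ k)" for x :: "nat \<Rightarrow> complex"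
  have \<Phi>: "\<Phi> \<in> measurable (\<Pi>\<^sub>M k\<in>UNIV. borel) (\<Pi>\<^sub>M z\<in>ball 0 1. borel)"
    unfolding \<Phi>_def by (rule measurable_restrict) measurable
  have "law_on_disc R (random_series Z) = distr (process_law R Z) (\<Pi>\<^sub>M z\<in>ball 0 1. borel) \<Phi>"
    if [measurable]: "\<And>k. Z k \<in> borel_measurable R" for R :: "'c measure" and Z
  proof -
    have "(\<lambda>\<omega> k. Z k \<omega>) \<in> measurable R (\<Pi>\<^sub>M k\<in>UNIV. borel)" by (rule measurable_PiM_single') auto
    then show ?thesis unfolding law_on_disc_def process_law_def
      by (subst distr_distr[OF \<Phi>]) (auto simp: \<Phi>_def random_series_def[abs_def] o_def)
  qed
  from this[OF assms(1)] this[OF assms(2)] show ?thesis by (simp add: eq)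
qed

text \<open>The law determines the characteristic function at each point, and its value
  \<open>exp (- V z / 4)\<close> at frequency 1 determines the variance.\<close>

lemma variance_eq_of_law_on_disc:
  assumes M: "gaussian_series M X V" and N: "gaussian_series N Y W"
    and law: "law_on_disc M (random_series X) = law_on_disc N (random_series Y)" and z: "z \<in> ball 0 1"
  shows "V z = W z"
proof -
  interpret A: gaussian_series M X V by fact
  interpret B: gaussian_series N Y W by fact
  have *: "(\<integral>\<omega>. cis (Re (1 * random_series Z \<omega> z)) \<partial>R) = (\<integral>x. cis (Re (x z)) \<partial>law_on_disc R (random_series Z))"
    if [measurable]: "\<And>k. Z k \<in> borel_measurable R" for R :: "'c measure" and Z
  proof -
    have "(\<lambda>\<omega>. \<lambda>z\<in>ball 0 1. random_series Z \<omega> z) \<in> measurable R (\<Pi>\<^sub>M z\<in>ball 0 1. borel)"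
      by (rule measurable_restrict) measurable
    then show ?thesis unfolding law_on_disc_def using z by (subst integral_distr) auto
  qed
  have "complex_of_real (exp (- V z / 4)) = of_real (exp (- W z / 4))"
    using *[OF A.X_meas] *[OF B.X_meas] A.char_series[OF z, of 1] B.char_series[OF z, of 1] law by simp
  then show ?thesis by simp
qed

lemma log_excess_cong:
  assumes "\<And>z. z \<in> ball 0 1 \<Longrightarrow> V z = W z" "0 < r" "cmod a + r < 1"
  shows "log_excess V a r = log_excess W a r"
proof -
  have "a \<in> ball 0 1" using assms by simp
  then show ?thesis unfolding log_excess_def by (simp only: assms(1) circle_in_disc[OF assms(2,3)])
qed

section \<open>The harmonic factor of the variance and its rigidity\<close>

context stationary_gaussian
begin

text \<open>A deterministic series, encoded as a random series over the one-point space
  \<open>unit\<close> so that convergence and holomorphy are inherited from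
  \<open>random_series_holomorphic\<close>.\<close>

definition covariance_series :: "complex \<Rightarrow> complex" where
  "covariance_series = random_series (\<lambda>k _. if k = 0 then 0 else covariance k) ()"

text \<open>In the notation of the paper this is \<open>1 + 2 * G\<close>, so that the variance of the series at \<open>z\<close> is
  \<open>Re (spectral z) / (1 - (cmod z)\<^sup>2)\<close>.\<close>

definition spectral :: "complex \<Rightarrow> complex" where
  "spectral z = 1 + 2 * covariance_series z"

lemma spectral_series:
  "covariance_series holomorphic_on ball 0 1"
  "z \<in> ball 0 1 \<Longrightarrow> (\<lambda>k. (if k = 0 then 0 else covariance k) * z ^ k) sums covariance_series z"
proof -
  have s: "summable (\<lambda>k. cmod (if k = 0 then 0 else covariance k) * (real n / (real n + 1)) ^ k)" for n
  proof (rule summable_comparison_test')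
    show "summable (\<lambda>k. (real n / (real n + 1)) ^ k)" by (rule summable_geometric) simp
    show "norm (cmod (if k = 0 then 0 else covariance k) * (real n / (real n + 1)) ^ k) \<le> (real n / (real n + 1)) ^ k" for k
      using covariance_bound[of k] by (auto simp: abs_mult mult_left_le_one_le)
  qed
  show "covariance_series holomorphic_on ball 0 1"
    unfolding covariance_series_def by (rule random_series_holomorphic(1)) (rule s)
  show "z \<in> ball 0 1 \<Longrightarrow> (\<lambda>k. (if k = 0 then 0 else covariance k) * z ^ k) sums covariance_series z"
    using random_series_holomorphic(2)[where X="\<lambda>k _. if k = 0 then 0 else covariance k" and \<omega>="()"] s
    unfolding covariance_series_def by blast
qed

lemma spectral_holomorphic: "spectral holomorphic_on ball 0 1"
  unfolding spectral_def[abs_def] by (intro holomorphic_intros spectral_series)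

lemma partial_sum_var_tendsto:
  assumes z: "z \<in> ball 0 1"
  shows "(\<lambda>n. partial_sum_var n z) \<longlonglongrightarrow> Re (spectral z) * pv_variance z"
proof -
  have "(\<lambda>n. \<Sum>k<Suc n. (if k = 0 then 0 else covariance k) * z ^ k) \<longlonglongrightarrow> covariance_series z"
    using spectral_series(2)[OF z] unfolding sums_def by (rule LIMSEQ_Suc)
  then have "(\<lambda>n. \<Sum>k<n. covariance (Suc k) * z ^ Suc k) \<longlonglongrightarrow> covariance_series z"
    by (subst (asm) sum.lessThan_Suc_shift) simp
  then have "(\<lambda>n. 1 + 2 * Re (\<Sum>k<n. covariance (Suc k) * z ^ Suc k)) \<longlonglongrightarrow> 1 + 2 * Re (covariance_series z)"
    by (intro tendsto_intros)
  from recursion_limit[of "\<lambda>n. partial_sum_var n z", OF partial_sum_var_Suc this]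
  show ?thesis using pv_variance(3)[OF z] by (simp add: pv_variance_def spectral_def)
qed

lemma spectral_0: "spectral 0 = 1"
  by (simp add: spectral_def covariance_series_def random_series_def)

text \<open>The real part is nonnegative because it is, up to a positive factor, a limit of
  variances; it is 1 at the origin, so the minimum principle makes it positive everywhere.\<close>

lemma spectral_pos:
  assumes z: "z \<in> ball 0 1"
  shows "0 < Re (spectral z)"
proof (rule Re_pos_of_nonneg[OF spectral_holomorphic _ _ _ _ _ z, where a = 0])
  fix y :: complex assume y: "y \<in> ball 0 1"
  have "0 \<le> Re (spectral y) * pv_variance y" by (rule LIMSEQ_le_const[OF partial_sum_var_tendsto[OF y]]) (auto simp: partial_sum_var_nonneg)
  then show "0 \<le> Re (spectral y)" using pv_variance(1)[OF y] by (simp add: zero_le_mult_iff)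
qed (auto simp: spectral_0)

lemma gaussian_series: "gaussian_series M (\<lambda>k. \<xi> (int k)) (\<lambda>z. Re (spectral z) * pv_variance z)"
proof (rule gaussian_seriesI[OF prob_space_axioms _ _ char_partial_sum partial_sum_var_tendsto])
  show "\<exists>C. \<forall>k. (\<integral>\<^sup>+\<omega>. ennreal (cmod (\<xi> (int k) \<omega>)) \<partial>M) \<le> ennreal C"
  proof (intro exI allI)
    fix k
    have i: "integrable M (\<lambda>\<omega>. 1 + (cmod (\<xi> (int k) \<omega>))\<^sup>2)" using square_int_xi[of "int k"] by (auto simp: square_int_def)
    have "(\<integral>\<^sup>+\<omega>. ennreal (cmod (\<xi> (int k) \<omega>)) \<partial>M) \<le> (\<integral>\<^sup>+\<omega>. ennreal (1 + (cmod (\<xi> (int k) \<omega>))\<^sup>2) \<partial>M)"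
      by (intro nn_integral_mono ennreal_leI cmod_le_one_plus_sq)
    also have "\<dots> = ennreal (\<integral>\<omega>. 1 + (cmod (\<xi> (int k) \<omega>))\<^sup>2 \<partial>M)" by (rule nn_integral_eq_integral[OF i]) simp
    also have "(\<integral>\<omega>. 1 + (cmod (\<xi> (int k) \<omega>))\<^sup>2 \<partial>M) = 2"
      using square_int_xi[of "int k"] by (simp add: square_int_def xi_sq prob_space)
    finally show "(\<integral>\<^sup>+\<omega>. ennreal (cmod (\<xi> (int k) \<omega>)) \<partial>M) \<le> ennreal 2" .
  qed
  show "continuous_on (ball 0 1) (\<lambda>z. Re (spectral z) * pv_variance z)"
    by (intro continuous_intros pv_variance holomorphic_on_imp_continuous_on spectral_holomorphic)
  show "0 < Re (spectral z) * pv_variance z" if "z \<in> ball 0 1" for z using spectral_pos[OF that] pv_variance(1)[OF that] by simp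
qed auto

lemma log_excess_le:
  assumes "0 < r" "cmod a + r < 1"
  shows "log_excess (\<lambda>z. Re (spectral z) * pv_variance z) a r \<le> log_excess pv_variance a r"
  using positive_harmonic_log_excess(2)[OF spectral_holomorphic spectral_pos assms] log_excess_pv_variance_mult[OF spectral_holomorphic spectral_pos assms] by simp

lemma covariance_zero_of_log_excess_eq:
  assumes D: "open D" "D \<noteq> {}" "D \<subseteq> ball 0 1"
    and eq: "\<And>a r. 0 < r \<Longrightarrow> cmod a + r < 1 \<Longrightarrow> cball a r \<subseteq> D \<Longrightarrow> log_excess (\<lambda>z. Re (spectral z) * pv_variance z) a r = log_excess pv_variance a r"
    and k: "0 < k"
  shows "covariance k = 0"
proof -
  obtain a where a: "a \<in> D" using D by blast
  then obtain e where e: "0 < e" "cball a e \<subseteq> D" using D open_contains_cball by blast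
  have a1: "cmod a < 1" using a D by auto
  define R where "R = min e ((1 - cmod a) / 2)"
  have R: "0 < R" "R \<le> e" "cmod a + R < 1" using e a1 by (auto simp: R_def min_def field_simps)
  have const: "Re (spectral (a + of_real r * cis \<theta>)) = Re (spectral a)" if r: "0 < r" "r \<le> R" and \<theta>: "0 < \<theta>" "\<theta> < 2 * pi" for r \<theta>
  proof -
    have ar: "cmod a + r < 1" using r R by linarith
    have "cball a r \<subseteq> D" using e r R by (meson order_trans subset_cball)
    then have "log_excess (\<lambda>z. Re (spectral z)) a r = 0"
      using eq[OF r(1) ar] log_excess_pv_variance_mult[OF spectral_holomorphic spectral_pos r(1) ar] by simp
    then show ?thesis using positive_harmonic_log_excess(3)[OF spectral_holomorphic spectral_pos r(1) ar _ \<theta>] by blast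
  qed
  \<comment> \<open>The constancy \<open>const\<close> leaves out the angle 0, the ray from
    \<open>a\<close> to the right. This ball lies to the left of \<open>a\<close> and touches
    \<open>a\<close> only with its boundary, so it avoids the ray.\<close>
  let ?B = "ball (a - of_real (R / 2)) (R / 2)"
  have Bc: "Re (spectral z) = Re (spectral a) \<and> z \<in> ball 0 1" if "z \<in> ?B" for z
  proof -
    have d: "cmod (z - a + of_real (R / 2)) < R / 2" using that by (simp add: dist_norm norm_minus_commute algebra_simps)
    have "Re (z - a + of_real (R / 2)) < R / 2" using complex_Re_le_cmod[of "z - a + of_real (R / 2)"] d by linarith
    then have neg: "Re (z - a) < 0" by simp
    then have nz: "z - a \<noteq> 0" by auto
    have le: "cmod (z - a) \<le> R"
      using norm_triangle_ineq4[of "z - a + of_real (R / 2)" "of_real (R / 2)"] d R by simp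
    define \<theta> where "\<theta> = Arg2pi (z - a)"
    have rep: "z - a = of_real (cmod (z - a)) * cis \<theta>"
      using Arg2pi_eq[of "z - a"] by (simp add: \<theta>_def cis_conv_exp)
    have "\<theta> \<noteq> 0"
    proof
      assume "\<theta> = 0"
      then have "Re (z - a) = cmod (z - a)" using rep by (metis cis_zero mult.right_neutral Re_complex_of_real)
      then show False using neg norm_ge_zero[of "z - a"] by linarith
    qed
    moreover have "0 \<le> \<theta>" "\<theta> < 2 * pi" unfolding \<theta>_def by (auto simp: Arg2pi_ge_0 Arg2pi_lt_2pi)
    ultimately have "Re (spectral (a + of_real (cmod (z - a)) * cis \<theta>)) = Re (spectral a)"
      using nz le by (intro const) auto
    moreover have "z \<in> ball 0 1" using norm_triangle_ineq[of a "z - a"] le R by simp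
    ultimately show ?thesis using rep by (metis add.commute diff_add_cancel)
  qed
  have "spectral constant_on ?B"
    by (rule Re_constant_imp_constant[where c="Re (spectral a)"])
       (use Bc in \<open>auto intro: holomorphic_on_subset[OF spectral_holomorphic]\<close>)
  then obtain c where c: "\<And>z. z \<in> ?B \<Longrightarrow> spectral z = c" unfolding constant_on_def by blast
  have all: "spectral z = c" if "z \<in> ball 0 1" for z
  proof (rule analytic_continuation_open[of ?B "ball 0 1" spectral "\<lambda>_. c"])
    show "?B \<noteq> {}" using R by simp
    show "?B \<subseteq> ball 0 1" using Bc by blast
  qed (use that c spectral_holomorphic in auto)
  have "c = 1" using all[of 0] spectral_0 by simp
  have zero: "covariance_series z = 0" if "z \<in> ball 0 1" for z
    using all[OF that] \<open>c = 1\<close> by (simp add: spectral_def)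
  show ?thesis
  proof (rule ccontr)
    assume n: "covariance k \<noteq> 0"
    \<comment> \<open>A power series with a nonzero coefficient has no zeros near 0 except possibly
      0 itself, which contradicts \<open>zero\<close>.\<close>
    obtain s where s: "0 < s" "\<And>z. z \<in> cball 0 s - {0} \<Longrightarrow> covariance_series z \<noteq> 0"
    proof (rule powser_0_nonzero[of 1 0 "\<lambda>k. if k = 0 then 0 else covariance k" "covariance_series" k])
      show "(\<lambda>n. (if n = 0 then 0 else covariance n) * (x - 0) ^ n) sums covariance_series x" if "norm (x - 0) < 1" for x
        using spectral_series(2)[of x] that by simp
    qed (use n k zero[of 0] in auto)
    let ?z = "complex_of_real (min s (1/2))"
    have "?z \<in> cball 0 s - {0}" "?z \<in> ball 0 1" using s(1) by (auto simp: min_def)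
    then show False using s(2) zero by blast
  qed
qed

text \<open>Uncorrelated coefficients make the second moment of a linear combination the sum of
  squared moduli of its weights. For a circular Gaussian process this fixes all characteristic
  functions, and they coincide with those of independent coefficients.\<close>

lemma process_law_eq_of_covariance_zero:
  assumes c0: "\<And>k. 0 < k \<Longrightarrow> covariance k = 0" and N: "prob_space N" and iid: "iid_std_complex_gaussian N \<zeta>"
  shows "process_law M (\<lambda>k. \<xi> (int k)) = process_law N \<zeta>"
proof (rule complex_process_law_unique[OF prob_space_axioms N])
  show "\<zeta> k \<in> borel_measurable N" for k by (rule gaussian_series.X_meas[OF gaussian_series_PV[OF N iid]])
  fix c :: "nat \<Rightarrow> complex" and J :: "nat set"
  assume J: "finite J"
  have orth: "(\<integral>\<omega>. cnj (\<xi> (int k) \<omega>) * \<xi> (int l) \<omega> \<partial>M) = 0" if "k \<noteq> l" for k l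
  proof -
    consider m where "l = k + m" "0 < m" | m where "k = l + m" "0 < m"
      using \<open>k \<noteq> l\<close> by (metis less_imp_add_positive linorder_neqE_nat)
    then show ?thesis
    proof cases
      case 1
      then show ?thesis using covariance_shift[of "int k" m] c0[of m] by simp
    next
      case 2
      have "(\<integral>\<omega>. cnj (\<xi> (int k) \<omega>) * \<xi> (int l) \<omega> \<partial>M) = (\<integral>\<omega>. cnj (cnj (\<xi> (int l) \<omega>) * \<xi> (int k) \<omega>) \<partial>M)"
        by (simp add: mult.commute)
      also have "\<dots> = cnj (\<integral>\<omega>. cnj (\<xi> (int l) \<omega>) * \<xi> (int k) \<omega> \<partial>M)" by (rule Bochner_Integration.integral_cnj)
      finally show ?thesis using 2 covariance_shift[of "int l" m] c0[of m] by simp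
    qed
  qed
  have sq: "(\<integral>\<omega>. (cmod (\<Sum>k\<in>J. c k * \<xi> (int k) \<omega>))\<^sup>2 \<partial>M) = (\<Sum>k\<in>J. (cmod (c k))\<^sup>2)"
    using J
  proof (induction J rule: finite_induct)
    case (insert j J)
    have "(\<integral>\<omega>. cnj (c j * \<xi> (int j) \<omega>) * (\<Sum>k\<in>J. c k * \<xi> (int k) \<omega>) \<partial>M) =
        (\<integral>\<omega>. (\<Sum>k\<in>J. cnj (c j) * c k * (cnj (\<xi> (int j) \<omega>) * \<xi> (int k) \<omega>)) \<partial>M)"
      by (simp add: sum_distrib_left ac_simps)
    also have "\<dots> = (\<Sum>k\<in>J. cnj (c j) * c k * (\<integral>\<omega>. cnj (\<xi> (int j) \<omega>) * \<xi> (int k) \<omega> \<partial>M))"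
      by (subst Bochner_Integration.integral_sum) (auto intro!: square_int_mult square_int_xi)
    also have "\<dots> = 0"
    proof (intro sum.neutral ballI)
      fix k assume "k \<in> J"
      then have "j \<noteq> k" using insert.hyps by auto
      from orth[OF this] show "cnj (c j) * c k * (\<integral>\<omega>. cnj (\<xi> (int j) \<omega>) * \<xi> (int k) \<omega> \<partial>M) = 0"
        by (metis mult_zero_right)
    qed
    finally have x: "(\<integral>\<omega>. cnj (c j * \<xi> (int j) \<omega>) * (\<Sum>k\<in>J. c k * \<xi> (int k) \<omega>) \<partial>M) = 0" .
    have "(\<integral>\<omega>. (cmod (c j * \<xi> (int j) \<omega>))\<^sup>2 \<partial>M) = (cmod (c j))\<^sup>2"
      by (simp add: norm_mult power_mult_distrib xi_sq)
    then show ?case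
      using insert square_int_add(2)[OF square_int_cmult[OF square_int_xi] square_int_combination, of "c j" "int j" c int J] x by simp
  qed simp
  have s: "(\<Sum>k\<in>int ` J. c (nat k) * \<xi> k \<omega>) = (\<Sum>k\<in>J. c k * \<xi> (int k) \<omega>)" for \<omega>
    by (subst sum.reindex) auto
  show "expectation (\<lambda>\<omega>. cis (Re (\<Sum>k\<in>J. c k * \<xi> (int k) \<omega>))) = (\<integral>\<omega>. cis (Re (\<Sum>k\<in>J. c k * \<zeta> k \<omega>)) \<partial>N)"
    using char_combination[of "int ` J" "\<lambda>k. c (nat k)"] J sq iid_char[OF N iid J] unfolding s by simp
qed auto

end

section \<open>The disc as a smooth domain\<close>

text \<open>Every iterated derivative is a constant plus a polynomial times a power of
  \<open>1/4 - x\<^sup>2\<close> with exponent 1/2 - m. The family is closed under differentiation,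
  and the base stays positive on the open interval.\<close>

lemma smooth_on_interval_circle: "smooth_on_interval (\<lambda>x. 1/2 - sqrt (1/4 - x\<^sup>2)) (1/2)"
proof -
  let ?h = "\<lambda>x::real. 1/2 - sqrt (1/4 - x\<^sup>2)"
  define I where "I = {-(1/2)<..<1/2::real}"
  \<comment> \<open>The new polynomial after one differentiation, with one further power of
    \<open>[:1/4, 0, -1:]\<close>, that is \<open>1/4 - x\<^sup>2\<close>, taken out.\<close>
  define P' where "P' m P = pderiv P * [:1/4, 0, -1:] + smult (- 2 * (1/2 - real m)) ([:0, 1:] * P)" for m :: nat and P :: "real poly"
  have q: "0 < 1/4 - x\<^sup>2" if "x \<in> I" for x
  proof -
    have "0 < (1/2 - x) * (1/2 + x)" using that by (intro mult_pos_pos) (auto simp: I_def)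
    then show ?thesis by (simp add: algebra_simps power2_eq_square)
  qed
  have step: "((\<lambda>x. c + poly P x * (1/4 - x\<^sup>2) powr (1/2 - real m)) has_field_derivative
      0 + poly (P' m P) x * (1/4 - x\<^sup>2) powr (1/2 - real (Suc m))) (at x)"
    if x: "x \<in> I" for c P m x
  proof -
    have "((\<lambda>x. (1/4 - x\<^sup>2) powr (1/2 - real m)) has_field_derivative
        (1/2 - real m) * (1/4 - x\<^sup>2) powr ((1/2 - real m) - of_nat 1) * (0 - 2 * x)) (at x)"
      by (rule DERIV_fun_powr) (use q[OF x] in \<open>auto intro!: derivative_eq_intros\<close>)
    then have "((\<lambda>x. c + poly P x * (1/4 - x\<^sup>2) powr (1/2 - real m)) has_field_derivative
        0 + (poly (pderiv P) x * (1/4 - x\<^sup>2) powr (1/2 - real m)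
          + (1/2 - real m) * (1/4 - x\<^sup>2) powr ((1/2 - real m) - of_nat 1) * (0 - 2 * x) * poly P x)) (at x)"
      by (intro DERIV_add DERIV_const DERIV_mult poly_DERIV)
    moreover define B where "B = (1/4 - x\<^sup>2) powr (1/2 - real (Suc m))"
    have AB: "(1/4 - x\<^sup>2) powr (1/2 - real m) = (1/4 - x\<^sup>2) * B"
      unfolding B_def using q[OF x] by (subst powr_mult_base) auto
    have "poly (pderiv P) x * (1/4 - x\<^sup>2) powr (1/2 - real m) + (1/2 - real m) * B * (0 - 2 * x) * poly P x
        = poly (P' m P) x * B"
      unfolding AB P'_def by (simp add: algebra_simps power2_eq_square)
    moreover have "(1/4 - x\<^sup>2) powr ((1/2 - real m) - of_nat 1) = B" by (simp add: B_def)
    ultimately show ?thesis unfolding B_def[symmetric] by metis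
  qed
  have form: "\<exists>c P m. \<forall>x\<in>I. (deriv ^^ n) ?h x = c + poly P x * (1/4 - x\<^sup>2) powr (1/2 - real m)" for n
  proof (induction n)
    case 0
    show ?case
      by (rule exI[of _ "1/2"], rule exI[of _ "[:-1:]"], rule exI[of _ 0]) (use q in \<open>auto simp: powr_half_sqrt less_imp_le\<close>)
  next
    case (Suc n)
    then obtain c P m where E: "\<And>x. x \<in> I \<Longrightarrow> (deriv ^^ n) ?h x = c + poly P x * (1/4 - x\<^sup>2) powr (1/2 - real m)" by blast
    have "(deriv ^^ Suc n) ?h x = 0 + poly (P' m P) x * (1/4 - x\<^sup>2) powr (1/2 - real (Suc m))"
      if x: "x \<in> I" for x
    proof -
      have "((deriv ^^ n) ?h has_field_derivative 0 + poly (P' m P) x * (1/4 - x\<^sup>2) powr (1/2 - real (Suc m))) (at x)"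
        by (rule has_field_derivative_transform_within_open[OF step[OF x, of c P m], of I]) (use x E in \<open>auto simp: I_def\<close>)
      then show ?thesis by (simp only: funpow.simps o_apply DERIV_imp_deriv)
    qed
    then show ?case by blast
  qed
  show ?thesis unfolding smooth_on_interval_def I_def[symmetric]
  proof (intro allI ballI)
    fix n x assume x: "x \<in> I"
    obtain c P m where E: "\<And>x. x \<in> I \<Longrightarrow> (deriv ^^ n) ?h x = c + poly P x * (1/4 - x\<^sup>2) powr (1/2 - real m)" using form[of n] by blast
    have "((deriv ^^ n) ?h has_field_derivative 0 + poly (P' m P) x * (1/4 - x\<^sup>2) powr (1/2 - real (Suc m))) (at x)"
      by (rule has_field_derivative_transform_within_open[OF step[OF x, of c P m], of I]) (use x E in \<open>auto simp: I_def\<close>)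
    then show "(deriv ^^ n) ?h field_differentiable at x" unfolding field_differentiable_def by blast
  qed
qed

lemma smooth_domain_disc: "smooth_domain (ball 0 (1/2))"
proof -
  have "\<exists>\<theta> a b h. 0 < a \<and> 0 < b \<and> smooth_on_interval h a \<and>
        (\<forall>x y. \<bar>x\<bar> < a \<and> \<bar>y\<bar> < b \<longrightarrow> (p + cis \<theta> * Complex x y \<in> ball 0 (1/2) \<longleftrightarrow> h x < y))"
    if p: "p \<in> frontier (ball 0 (1/2))" for p :: complex
  proof -
    have np: "cmod p = 1/2" using p by (simp add: frontier_ball)
    \<comment> \<open>With \<open>cis \<theta> = 2 * \<i> * p\<close> the second coordinate axis
      points along \<open>-p\<close>, the inward normal. The boundary near \<open>p\<close> is then
      the lower arc of the circle of radius 1/2 about the point (0, 1/2).\<close>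
    define \<theta> where "\<theta> = Arg (\<i> * p)"
    have "cis \<theta> = sgn (\<i> * p)" unfolding \<theta>_def using np by (intro cis_Arg) auto
    then have c: "cis \<theta> = 2 * \<i> * p" using np by (simp add: sgn_eq norm_mult)
    have mem: "(p + cis \<theta> * Complex x y \<in> ball 0 (1/2)) \<longleftrightarrow> 1/2 - sqrt (1/4 - x\<^sup>2) < y" if x: "\<bar>x\<bar> < 1/2" and y: "\<bar>y\<bar> < 1/2" for x y
    proof -
      have "p + cis \<theta> * Complex x y = 2 * p * Complex (1/2 - y) x"
        unfolding c by (simp add: complex_eq_iff algebra_simps)
      then have "cmod (p + cis \<theta> * Complex x y) = sqrt ((1/2 - y)\<^sup>2 + x\<^sup>2)"
        using np by (simp add: norm_mult complex_norm)
      then have "(p + cis \<theta> * Complex x y \<in> ball 0 (1/2)) \<longleftrightarrow> sqrt ((1/2 - y)\<^sup>2 + x\<^sup>2) < sqrt (1/4)"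
        by (simp add: real_sqrt_divide)
      also have "\<dots> \<longleftrightarrow> (1/2 - y)\<^sup>2 < 1/4 - x\<^sup>2" by (simp only: real_sqrt_less_iff) auto
      also have "\<dots> \<longleftrightarrow> sqrt ((1/2 - y)\<^sup>2) < sqrt (1/4 - x\<^sup>2)" by (simp only: real_sqrt_less_iff)
      also have "\<dots> \<longleftrightarrow> 1/2 - sqrt (1/4 - x\<^sup>2) < y" using y by auto
      finally show ?thesis .
    qed
    show ?thesis
      by (rule exI[of _ \<theta>], rule exI[of _ "1/2"], rule exI[of _ "1/2"], rule exI[of _ "\<lambda>x. 1/2 - sqrt (1/4 - x\<^sup>2)"])
         (use mem smooth_on_interval_circle in auto)
  qed
  then show ?thesis unfolding smooth_domain_def smooth_boundary_def by auto
qed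

theorem theorem1p2:
  fixes M :: "'a measure" and \<xi> :: "int \<Rightarrow> 'a \<Rightarrow> complex"
    and N :: "'b measure" and \<zeta> :: "nat \<Rightarrow> 'b \<Rightarrow> complex"
  defines "f \<equiv> random_series (\<lambda>k. \<xi> (int k))"
    and "f\<^sub>P\<^sub>V \<equiv> random_series \<zeta>"
  assumes "prob_space M" and "prob_space N"
    and "complex_gaussian_process M \<xi>" and "centered_process M \<xi>"
    and "unit_variance_process M \<xi>" and "stationary_process M \<xi>"
    and "iid_std_complex_gaussian N \<zeta>"
  shows "(\<forall>D. smooth_domain D \<and> D \<subseteq> ball 0 1 \<longrightarrow>
            expected_zeros M f D \<le> expected_zeros N f\<^sub>P\<^sub>V D)
       \<and> ((\<exists>D. smooth_domain D \<and> closure D \<subseteq> ball 0 1 \<and>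
              expected_zeros M f D = expected_zeros N f\<^sub>P\<^sub>V D)
            \<longleftrightarrow> law_on_disc M f = law_on_disc N f\<^sub>P\<^sub>V)
       \<and> ((\<forall>D. smooth_domain D \<and> closure D \<subseteq> ball 0 1 \<longrightarrow>
              expected_zeros M f D = expected_zeros N f\<^sub>P\<^sub>V D)
            \<longleftrightarrow> law_on_disc M f = law_on_disc N f\<^sub>P\<^sub>V)"
proof -
  interpret stationary_gaussian M \<xi>
    using assms(3-8) by (intro stationary_gaussian.intro stationary_gaussian_axioms.intro)
  have A: "gaussian_series M (\<lambda>k. \<xi> (int k)) (\<lambda>z. Re (spectral z) * pv_variance z)" by (rule gaussian_series)
  have B: "gaussian_series N \<zeta> pv_variance" by (rule gaussian_series_PV[OF assms(4,9)])
  have le: "expected_zeros M f D \<le> expected_zeros N f\<^sub>P\<^sub>V D" if "smooth_domain D" "D \<subseteq> ball 0 1" for D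
    unfolding f_def f\<^sub>P\<^sub>V_def
    by (rule compare_zeros[OF A B _ that(2) log_excess_le]) (use that(1) in \<open>auto simp: smooth_domain_def\<close>)
  have eq_law: "law_on_disc M f = law_on_disc N f\<^sub>P\<^sub>V"
    if D: "smooth_domain D" "closure D \<subseteq> ball 0 1" and eq: "expected_zeros M f D = expected_zeros N f\<^sub>P\<^sub>V D" for D
  proof -
    have oD: "open D" "D \<noteq> {}" using D by (auto simp: smooth_domain_def)
    have sub: "D \<subseteq> ball 0 1" using D closure_subset by blast
    have "covariance k = 0" if "0 < k" for k
      by (rule covariance_zero_of_log_excess_eq[OF oD sub log_excess_eq_of_expected_zeros_eq[OF A B oD(1) D(2) log_excess_le eq[unfolded f_def f\<^sub>P\<^sub>V_def]] that])
    then show ?thesis unfolding f_def f\<^sub>P\<^sub>V_def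
      by (intro law_on_disc_of_process_law process_law_eq_of_covariance_zero assms gaussian_series.X_meas[OF B]) auto
  qed
  have law_eq: "expected_zeros M f D = expected_zeros N f\<^sub>P\<^sub>V D"
    if law: "law_on_disc M f = law_on_disc N f\<^sub>P\<^sub>V" and D: "smooth_domain D" "closure D \<subseteq> ball 0 1" for D
  proof -
    have oD: "open D" using D by (auto simp: smooth_domain_def)
    have sub: "D \<subseteq> ball 0 1" using D closure_subset by blast
    have v: "Re (spectral z) * pv_variance z = pv_variance z" if "z \<in> ball 0 1" for z
      by (rule variance_eq_of_law_on_disc[OF A B law[unfolded f_def f\<^sub>P\<^sub>V_def] that])
    have d: "log_excess (\<lambda>z. Re (spectral z) * pv_variance z) a r = log_excess pv_variance a r" if "0 < r" "cmod a + r < 1" for a r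
      by (rule log_excess_cong[OF v that])
    show ?thesis unfolding f_def f\<^sub>P\<^sub>V_def
      by (rule antisym; rule compare_zeros[OF A B oD sub] compare_zeros[OF B A oD sub]) (simp_all add: d)
  qed
  \<comment> \<open>A concrete smooth domain is needed to pass from equality on all domains to
    equality on some domain, and to exhibit one when the laws agree.\<close>
  have disc: "smooth_domain (ball 0 (1/2))" "closure (ball 0 (1/2)) \<subseteq> ball (0::complex) 1"
    using smooth_domain_disc by auto
  show ?thesis using le eq_law law_eq disc by blast
qed

end
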